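(* Let $G=(V,E)$ be a decomposable graph on $V=\{1,\dots,m\}$ with vertices ordered so that $V\in S_D$. Let $U$ be an $m\times m$ positive definite matrix and let $\alpha\in\mathbb{R}^m$ have nonnegative entries, with $z_G(U,\alpha)<\infty$. Let $Y_1,\dots,Y_n$ be an i.i.d. sample from $\mathcal{N}_m(0,LDL^T)$ with $(L,D)\in\Theta_G$, let $S=\frac1n\sum_{i=1}^nY_iY_i^T$, and put the prior $\pi_{U,\alpha}$ on $(L,D)$, so that the posterior distribution of $(L,D)$ is $\pi_{\widetilde U,\widetilde\alpha}$ with $\widetilde U=nS+U$ and $\widetilde\alpha=(n+\alpha_1,\dots,n+\alpha_m)$. Consider the block Gibbs sampler on $\Theta_G$ with blocks $L^G_{\cdot1},L^G_{\cdot2},\dots,L^G_{\cdot m-1},D$, that is, the Markov chain which cycles through these blocks, replacing each block by a draw from its conditional distribution under $\pi_{\widetilde U,\widetilde\alpha}$ given the current values of all the other blocks. This block Gibbs sampling Markov chain converges to the desired stationary distribution $\pi_{\widetilde U,\widetilde\alpha}$.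
   Context: Edges are undirected, no loops. $G$ is decomposable if it has no induced cycle of length at least four. $P_G$ is the set of $m\times m$ symmetric positive definite matrices $\Sigma$ with $\Sigma_{ij}=0$ whenever $i\ne j$ and $(i,j)\notin E$. $\mathcal{L}_G$ is the set of $m\times m$ lower-triangular matrices $L$ with $L_{ii}=1$ for all $i$ and $L_{ij}=0$ for $i>j$, $(i,j)\notin E$. $\Theta_G=\{(L,D): L\in\mathcal{L}_G,\ D \text{ diagonal with } D_{ii}>0 \text{ for all } i\}$. Every positive definite $\Sigma$ has a unique modified Cholesky decomposition $\Sigma=LDL^T$ with $L$ lower-triangular with unit diagonal and $D$ diagonal with positive diagonal entries. $V\in S_D$ means: for every positive definite $\Sigma=LDL^T$ (modified Cholesky), $L\in\mathcal{L}_G\Leftrightarrow\Sigma\in P_G$. For $U$ positive definite and $\alpha\in\mathbb{R}^m$ with nonnegative entries, let $$\widetilde\pi_{U,\alpha}(L,D)=\exp\Big(-\tfrac12\Big\{\operatorname{tr}((LDL^T)^{-1}U)+\sum_{i=1}^m\alpha_i\log D_{ii}\Big\}\Big),\quad (L,D)\in\Theta_G,$$ a density with respect to $dL\,dD=\prod_{(i,j)\in E,\,i>j}dL_{ij}\prod_{i=1}^m dD_{ii}$, and $z_G(U,\alpha)=\int_{\Theta_G}\widetilde\pi_{U,\alpha}(L,D)\,dL\,dD$. When $z_G(U,\alpha)<\infty$, $\pi_{U,\alpha}$ denotes the probability distribution on $\Theta_G$ with density $\widetilde\pi_{U,\alpha}/z_G(U,\alpha)$. For $v=1,\dots,m-1$,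 $L^G_{\cdot v}=(L_{uv})_{u>v,\,(u,v)\in E}$ is the vector of free entries in column $v$ of $L$ (possibly empty, in which case the block is vacuous). A point of $\Theta_G$ is identified with $(L^G_{\cdot1},\dots,L^G_{\cdot m-1},D)$. *)

theory Defs
  imports "HOL-Probability.Probability"
begin

text \<open>
  The vertex set \<open>{1, \<dots>, m}\<close> is the universe of a finite linearly ordered type
  \<open>'m\<close> (for a finite type, \<open>wellorder\<close> is the same as \<open>linorder\<close>), so \<open>m = CARD('m)\<close> and the
  order of \<open>'m\<close> is the vertex ordering.  A graph is its set of ordered pairs of adjacent
  vertices, a symmetric irreflexive relation.
\<close>

definition induced_cycle :: "'a rel \<Rightarrow> 'a list \<Rightarrow> bool" where
  "induced_cycle E c \<longleftrightarrow> length c \<ge> 3 \<and> distinct c \<and>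
     (\<forall>i<length c. \<forall>j<length c.
        (c ! i, c ! j) \<in> E \<longleftrightarrow> j = Suc i mod length c \<or> i = Suc j mod length c)"

definition decomposable :: "'a rel \<Rightarrow> bool" where
  "decomposable E \<longleftrightarrow> \<not> (\<exists>c. induced_cycle E c \<and> length c \<ge> 4)"


section \<open>Covariance graph models\<close>

type_synonym 'm rvec = "real^'m"
type_synonym 'm rmat = "real^'m^'m"

definition pos_def :: "'m::finite rmat \<Rightarrow> bool" where
  "pos_def A \<longleftrightarrow> transpose A = A \<and> (\<forall>x. x \<noteq> 0 \<longrightarrow> x \<bullet> (A *v x) > 0)"

definition PG :: "'m rel \<Rightarrow> 'm::finite rmat set" where
  "PG E = {\<Sigma>. pos_def \<Sigma> \<and> (\<forall>i j. i \<noteq> j \<and> (i, j) \<notin> E \<longrightarrow> \<Sigma> $ i $ j = 0)}"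

definition unit_lower :: "'m::{finite,wellorder} rmat \<Rightarrow> bool" where
  "unit_lower L \<longleftrightarrow> (\<forall>i. L $ i $ i = 1) \<and> (\<forall>i j. i < j \<longrightarrow> L $ i $ j = 0)"

definition pos_diag :: "'m::finite rmat \<Rightarrow> bool" where
  "pos_diag D \<longleftrightarrow> (\<forall>i j. i \<noteq> j \<longrightarrow> D $ i $ j = 0) \<and> (\<forall>i. D $ i $ i > 0)"

definition LG :: "'m rel \<Rightarrow> 'm::{finite,wellorder} rmat set" where
  "LG E = {L. unit_lower L \<and> (\<forall>i j. i > j \<and> (i, j) \<notin> E \<longrightarrow> L $ i $ j = 0)}"

type_synonym 'm state = "'m rmat \<times> 'm rmat"

definition ThetaG :: "'m rel \<Rightarrow> 'm::{finite,wellorder} state set" where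
  "ThetaG E = LG E \<times> {D. pos_diag D}"

definition cov :: "'m::finite state \<Rightarrow> 'm rmat" where
  "cov \<theta> = (case \<theta> of (L, D) \<Rightarrow> L ** D ** transpose L)"

text \<open>The order of \<open>'m\<close> belongs to \<open>S\<^sub>D\<close>.  Since the modified Cholesky decomposition is unique,
  ranging over all decompositions of \<open>\<Sigma>\<close> amounts to taking the decomposition of \<open>\<Sigma>\<close>.\<close>

definition S_D :: "'m::{finite,wellorder} rel \<Rightarrow> bool" where
  "S_D E \<longleftrightarrow> (\<forall>\<Sigma> L D. pos_def \<Sigma> \<and> unit_lower L \<and> pos_diag D \<and> \<Sigma> = L ** D ** transpose L \<longrightarrow>
     (L \<in> LG E \<longleftrightarrow> \<Sigma> \<in> PG E))"


section \<open>The distributions \<open>\<pi>\<^bsub>U,\<alpha>\<^esub>\<close>\<close>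

definition Theta_space :: "'m rel \<Rightarrow> 'm::{finite,wellorder} state measure" where
  "Theta_space E = restrict_space borel (ThetaG E)"

definition diag_of :: "('m::finite \<Rightarrow> real) \<Rightarrow> 'm rmat" where
  "diag_of d = (\<chi> i j. if i = j then d i else 0)"

definition lower_of :: "'m rel \<Rightarrow> ('m \<times> 'm \<Rightarrow> real) \<Rightarrow> 'm::{finite,wellorder} rmat" where
  "lower_of E l = (\<chi> i j. if i = j then 1 else if i > j \<and> (i, j) \<in> E then l (i, j) else 0)"

definition dD :: "('m::finite \<Rightarrow> real) measure" where
  "dD = (\<Pi>\<^sub>M i\<in>UNIV. restrict_space lborel {0<..})"

definition dLdD :: "'m rel \<Rightarrow> 'm::{finite,wellorder} state measure" where
  "dLdD E = distr ((\<Pi>\<^sub>M p\<in>{(i, j). (i, j) \<in> E \<and> i > j}. lborel) \<Otimes>\<^sub>M dD) (Theta_space E)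
     (\<lambda>(l, d). (lower_of E l, diag_of d))"

definition pi_tilde :: "'m rmat \<Rightarrow> 'm rvec \<Rightarrow> 'm::finite state \<Rightarrow> real" where
  "pi_tilde U \<alpha> \<theta> = exp (- (1/2) *
     (trace (matrix_inv (cov \<theta>) ** U) + (\<Sum>i\<in>UNIV. \<alpha> $ i * ln (snd \<theta> $ i $ i))))"

definition zG :: "'m rel \<Rightarrow> 'm rmat \<Rightarrow> 'm::{finite,wellorder} rvec \<Rightarrow> ennreal" where
  "zG E U \<alpha> = (\<integral>\<^sup>+ \<theta>. ennreal (pi_tilde U \<alpha> \<theta>) \<partial>dLdD E)"

definition piG :: "'m rel \<Rightarrow> 'm rmat \<Rightarrow> 'm rvec \<Rightarrow> 'm::{finite,wellorder} state measure" where
  "piG E U \<alpha> = density (dLdD E) (\<lambda>\<theta>. ennreal (pi_tilde U \<alpha> \<theta>) / zG E U \<alpha>)"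


section \<open>Gaussian sample, prior and posterior\<close>

definition mvn :: "'m::finite rmat \<Rightarrow> 'm rvec measure" where
  "mvn \<Sigma> = density lborel (\<lambda>y. ennreal
     (exp (- (1/2) * (y \<bullet> (matrix_inv \<Sigma> *v y))) / sqrt ((2 * pi) ^ CARD('m) * det \<Sigma>)))"

text \<open>\<open>\<theta>\<close> has distribution \<open>P\<close> and, given \<open>\<theta> = (L, D)\<close>, the random vectors \<open>Y 0, \<dots>, Y (n - 1)\<close> are
  independent with distribution \<open>N(0, L D L\<^sup>T)\<close>: the equation prescribes the joint law on
  measurable rectangles, which determine it.\<close>

definition gaussian_sample ::
  "'w measure \<Rightarrow> 'm rel \<Rightarrow> 'm::{finite,wellorder} state measure \<Rightarrow>
   ('w \<Rightarrow> 'm state) \<Rightarrow> nat \<Rightarrow> (nat \<Rightarrow> 'w \<Rightarrow> 'm rvec) \<Rightarrow> bool" where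
  "gaussian_sample M E P \<theta> n Y \<longleftrightarrow>
     prob_space M \<and> \<theta> \<in> M \<rightarrow>\<^sub>M Theta_space E \<and> (\<forall>i<n. Y i \<in> M \<rightarrow>\<^sub>M borel) \<and>
     (\<forall>A\<in>sets (Theta_space E). \<forall>B. (\<forall>i<n. B i \<in> sets borel) \<longrightarrow>
        emeasure M {\<omega> \<in> space M. \<theta> \<omega> \<in> A \<and> (\<forall>i<n. Y i \<omega> \<in> B i)} =
        (\<integral>\<^sup>+ t\<in>A. (\<Prod>i<n. emeasure (mvn (cov t)) (B i)) \<partial>P))"

text \<open>\<open>Q \<omega>\<close> is a regular conditional distribution of the random variable \<open>\<theta>\<close> (with values in \<open>N\<close>)
  given the sample \<open>Y 0, \<dots>, Y (n - 1)\<close>.\<close>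

definition posterior_distribution ::
  "'w measure \<Rightarrow> 'a measure \<Rightarrow> ('w \<Rightarrow> 'a) \<Rightarrow> nat \<Rightarrow> (nat \<Rightarrow> 'w \<Rightarrow> 'b::topological_space) \<Rightarrow>
   ('w \<Rightarrow> 'a measure) \<Rightarrow> bool" where
  "posterior_distribution M N \<theta> n Y Q \<longleftrightarrow>
     (let F = vimage_algebra (space M) (\<lambda>\<omega>. \<lambda>i\<in>{..<n}. Y i \<omega>) (\<Pi>\<^sub>M i\<in>{..<n}. borel)
      in Q \<in> F \<rightarrow>\<^sub>M prob_algebra N \<and>
         (\<forall>A\<in>sets N. AE \<omega> in M.
            measure (Q \<omega>) A = real_cond_exp M F (indicator (\<theta> -` A \<inter> space M)) \<omega>))"

definition sample_cov :: "nat \<Rightarrow> (nat \<Rightarrow> 'm::finite rvec) \<Rightarrow> 'm rmat" where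
  "sample_cov n y = (1 / real n) *\<^sub>R (\<Sum>i<n. (\<chi> a b. y i $ a * y i $ b))"

definition post_scale :: "'m::finite rmat \<Rightarrow> nat \<Rightarrow> (nat \<Rightarrow> 'm rvec) \<Rightarrow> 'm rmat" where
  "post_scale U n y = real n *\<^sub>R sample_cov n y + U"

definition post_shape :: "'m::finite rvec \<Rightarrow> nat \<Rightarrow> 'm rvec" where
  "post_shape \<alpha> n = (\<chi> i. real n + \<alpha> $ i)"


section \<open>The block Gibbs sampler\<close>

text \<open>A block is described by the Lebesgue measure \<open>R\<close> of its coordinates and the function \<open>put\<close>
  replacing the block in the current state.  For a target with unnormalised density \<open>f\<close>,
  the conditional distribution of the block given the other blocks of \<open>\<theta>\<close> has \<open>R\<close>-density
  proportional to \<open>\<lambda>b. f (put \<theta> b)\<close>.\<close>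

definition block_conditional ::
  "('s \<Rightarrow> real) \<Rightarrow> 'b measure \<Rightarrow> ('s \<Rightarrow> 'b \<Rightarrow> 's) \<Rightarrow> 's \<Rightarrow> 'b measure" where
  "block_conditional f R put \<theta> =
     density R (\<lambda>b. ennreal (f (put \<theta> b)) / (\<integral>\<^sup>+ b'. ennreal (f (put \<theta> b')) \<partial>R))"

definition block_update ::
  "'s measure \<Rightarrow> ('s \<Rightarrow> real) \<Rightarrow> 'b measure \<Rightarrow> ('s \<Rightarrow> 'b \<Rightarrow> 's) \<Rightarrow> 's \<Rightarrow> 's measure" where
  "block_update N f R put \<theta> = distr (block_conditional f R put \<theta>) N (put \<theta>)"

definition col_idx :: "'m rel \<Rightarrow> 'm::{finite,wellorder} \<Rightarrow> 'm set" where
  "col_idx E v = {u. u > v \<and> (u, v) \<in> E}"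

definition put_col :: "'m rel \<Rightarrow> 'm \<Rightarrow> 'm::{finite,wellorder} state \<Rightarrow> ('m \<Rightarrow> real) \<Rightarrow> 'm state" where
  "put_col E v \<theta> l =
     (\<chi> i j. if j = v \<and> i \<in> col_idx E v then l i else fst \<theta> $ i $ j, snd \<theta>)"

definition put_diag :: "'m::finite state \<Rightarrow> ('m \<Rightarrow> real) \<Rightarrow> 'm state" where
  "put_diag \<theta> d = (fst \<theta>, diag_of d)"

definition col_update ::
  "'m rel \<Rightarrow> 'm rmat \<Rightarrow> 'm rvec \<Rightarrow> 'm \<Rightarrow> 'm::{finite,wellorder} state \<Rightarrow> 'm state measure" where
  "col_update E U \<alpha> v =
     block_update (Theta_space E) (pi_tilde U \<alpha>) (\<Pi>\<^sub>M u\<in>col_idx E v. lborel) (put_col E v)"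

definition diag_update ::
  "'m rel \<Rightarrow> 'm rmat \<Rightarrow> 'm rvec \<Rightarrow> 'm::{finite,wellorder} state \<Rightarrow> 'm state measure" where
  "diag_update E U \<alpha> = block_update (Theta_space E) (pi_tilde U \<alpha>) dD put_diag"

text \<open>The transition kernel of one full cycle: the columns in increasing order (all but the last
  one, which has no entry below the diagonal), then \<open>D\<close>.\<close>

definition gibbs_kernel ::
  "'m rel \<Rightarrow> 'm rmat \<Rightarrow> 'm rvec \<Rightarrow> 'm::{finite,wellorder} state \<Rightarrow> 'm state measure" where
  "gibbs_kernel E U \<alpha> =
     fold (\<lambda>k K \<theta>. K \<theta> \<bind> k)
       (map (col_update E U \<alpha>) (sorted_list_of_set (UNIV - {Max UNIV})) @ [diag_update E U \<alpha>])
       (return (Theta_space E))"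

definition chain_law :: "('s \<Rightarrow> 's measure) \<Rightarrow> 's measure \<Rightarrow> nat \<Rightarrow> 's measure" where
  "chain_law K \<mu> t = ((\<lambda>\<nu>. \<nu> \<bind> K) ^^ t) \<mu>"

definition tv_dist :: "'s measure \<Rightarrow> 's measure \<Rightarrow> real" where
  "tv_dist \<mu> \<nu> = (SUP A\<in>sets \<mu>. \<bar>measure \<mu> A - measure \<nu> A\<bar>)"

text \<open>\<open>K\<close> is a Markov kernel on \<open>N\<close> with stationary distribution \<open>P\<close>, and the Markov chain with
  kernel \<open>K\<close> converges to \<open>P\<close> in total variation from every initial distribution (in particular
  from every point of \<open>N\<close>).\<close>

definition markov_chain_converges :: "'s measure \<Rightarrow> ('s \<Rightarrow> 's measure) \<Rightarrow> 's measure \<Rightarrow> bool" where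
  "markov_chain_converges N K P \<longleftrightarrow>
     K \<in> N \<rightarrow>\<^sub>M prob_algebra N \<and> P \<in> space (prob_algebra N) \<and> P \<bind> K = P \<and>
     (\<forall>\<mu>\<in>space (prob_algebra N). (\<lambda>t. tv_dist (chain_law K \<mu> t) P) \<longlonglongrightarrow> 0)"

end

theory Submission
  imports Defs
begin

text \<open>
  After one cycle every coordinate has been redrawn from a strictly positive conditional density, so
  the Gibbs kernel has a strictly positive density \<open>k\<close> with respect to its stationary distribution
  \<open>P\<close>.  Such a kernel contracts second moments: if \<open>u\<close> is bounded by 1 and has mean zero under \<open>P\<close>,
  then \<open>\<integral> (K u)\<^sup>2 dP \<le> (1 - s) \<integral> u\<^sup>2 dP + 4 s (P \<times> P)(k < s)\<close>, and the last factor vanishes as \<open>s \<rightarrow> 0\<close>,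
  uniformly in \<open>u\<close>.  Taking \<open>u\<close> to be centred indicators gives convergence in total variation.

  The conditional densities exist because
  \<open>tr((L D L\<^sup>T)\<^sup>-\<^sup>1 U) = \<Sum>\<^sub>i q\<^sub>i / D\<^sub>i\<^sub>i\<close>, where \<open>q\<^sub>i\<close> is the quadratic form of \<open>U\<close> at row \<open>i\<close> of \<open>L\<^sup>-\<^sup>1\<close>.
  This grows quadratically in each column of \<open>L\<close>.  For the block \<open>D\<close>, and for the posterior
  normalising constant, finiteness is inherited from the prior by rescaling \<open>D\<close>.
\<close>

section \<open>Kernels with a positive density\<close>

text \<open>No positive lower bound for the density is at hand, so a uniform minorisation of the
  kernel is replaced by averaging over the level sets of the density in L2 of \<open>P\<close>. The
  price is that second moments under \<open>P\<close> say nothing about a start singular to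
  \<open>P\<close>, such as a single point. One transition repairs this: every \<open>K x\<close>
  has a density with respect to \<open>P\<close>, hence so has the law after one cycle, and
  truncating that density turns the L2 estimate into one in total variation. Positivity is proved on
  a product of blocks, where a partial sweep has a density only in the coordinates already redrawn.
  A measurable bijection carries the result to pairs of matrices and identifies \<open>dLdD\<close>
  with a product measure. Finiteness of \<open>zG\<close> controls the integral over D for almost
  every L only, while the sampler needs it at every state; this is why two different L are compared
  by rescaling D. The posterior rests on a conjugacy identity and Tonelli; the latter needs
  sigma-finiteness of \<open>dLdD\<close>, which is recovered from the prior.\<close>

lemma variance_lower_bound:
  fixes u :: "'a \<Rightarrow> real" and q :: "'a \<Rightarrow> ennreal"
  assumes "prob_space P" "prob_space (density P q)"
    and [measurable]: "q \<in> borel_measurable P" "u \<in> borel_measurable P"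
    and u1: "\<And>y. y \<in> space P \<Longrightarrow> \<bar>u y\<bar> \<le> 1" and u0: "(\<integral>y. u y \<partial>P) = 0"
    and c: "\<bar>c\<bar> \<le> 1" and s: "0 \<le> s"
  shows "(\<integral>y. (u y - c)\<^sup>2 \<partial>density P q) \<ge>
    s * ((\<integral>y. (u y)\<^sup>2 \<partial>P) - 4 * measure P {y \<in> space P. q y < ennreal s})"
proof -
  interpret P: prob_space P by fact
  interpret Q: prob_space "density P q" by fact
  define B where "B = {y \<in> space P. q y < ennreal s}"
  have [measurable]: "B \<in> sets P" unfolding B_def by measurable
  have le4: "(u y - c)\<^sup>2 \<le> 4" if "y \<in> space P" for y
  proof -
    have "\<bar>u y - c\<bar> \<le> 2" using u1[OF that] c by linarith
    then have "(u y - c)\<^sup>2 \<le> 2\<^sup>2" by (metis abs_le_square_iff abs_numeral)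
    then show ?thesis by simp
  qed
  have iP: "integrable P (\<lambda>y. (u y - c)\<^sup>2)"
    by (rule P.integrable_const_bound[where B=4]) (auto simp: le4)
  have iu: "integrable P u"
    by (rule P.integrable_const_bound[where B=1]) (auto simp: u1)
  have iu2: "integrable P (\<lambda>y. (u y)\<^sup>2)"
    by (rule P.integrable_const_bound[where B=1]) (auto simp: u1 abs_square_le_1)
  have iQ: "integrable (density P q) (\<lambda>y. (u y - c)\<^sup>2)"
    by (rule Q.integrable_const_bound[where B=4]) (auto simp: le4)
  have ind: "integrable P (indicator B :: _ \<Rightarrow> real)"
    by (rule P.integrable_const_bound[where B=1]) auto
  have iB: "integrable P (\<lambda>y. s * ((u y - c)\<^sup>2 - 4 * indicator B y))"
    using iP ind by (intro integrable_mult_right Bochner_Integration.integrable_diff) auto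
  \<comment> \<open>As u has mean zero under \<open>P\<close>, the cross term vanishes, and
    replacing the centre c by 0 can only lower the integral.\<close>
  have "(\<integral>y. (u y - c)\<^sup>2 \<partial>P) = (\<integral>y. (u y)\<^sup>2 - 2 * c * u y + c\<^sup>2 \<partial>P)"
    by (simp add: power2_diff algebra_simps)
  also have "\<dots> = (\<integral>y. (u y)\<^sup>2 \<partial>P) + c\<^sup>2"
    using iu iu2 by (simp add: u0 P.prob_space)
  finally have "(\<integral>y. (u y)\<^sup>2 \<partial>P) \<le> (\<integral>y. (u y - c)\<^sup>2 \<partial>P)" by simp
  then have "s * ((\<integral>y. (u y)\<^sup>2 \<partial>P) - 4 * measure P B) \<le>
      (\<integral>y. s * ((u y - c)\<^sup>2 - 4 * indicator B y) \<partial>P)"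
    using iP ind s by (auto intro!: mult_left_mono)
  also have "\<dots> \<le> (\<integral>y. (u y - c)\<^sup>2 \<partial>density P q)"
  proof -
    \<comment> \<open>\<open>ennreal\<close> sends negative values to 0, so the nonnegative integral
      drops the negative part and can only be larger.\<close>
    have "ennreal (\<integral>y. s * ((u y - c)\<^sup>2 - 4 * indicator B y) \<partial>P) \<le>
        (\<integral>\<^sup>+y. ennreal (s * ((u y - c)\<^sup>2 - 4 * indicator B y)) \<partial>P)"
    proof -
      let ?f = "\<lambda>y. s * ((u y - c)\<^sup>2 - 4 * indicator B y)"
      have "(\<integral>y. ?f y \<partial>P) \<le> (\<integral>y. max 0 (?f y) \<partial>P)"
        using iB by (intro integral_mono) auto
      then have "ennreal (\<integral>y. ?f y \<partial>P) \<le> (\<integral>\<^sup>+y. ennreal (max 0 (?f y)) \<partial>P)"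
        using iB by (subst nn_integral_eq_integral) (auto intro: ennreal_leI)
      also have "\<dots> = (\<integral>\<^sup>+y. ennreal (?f y) \<partial>P)"
        by (intro nn_integral_cong) (auto simp: max_def ennreal_neg)
      finally show ?thesis .
    qed
    \<comment> \<open>On B the left side is at most 0, because |u - c| is at most 2 and its square
      at most 4; off B the density is at least s.\<close>
    also have "\<dots> \<le> (\<integral>\<^sup>+y. q y * ennreal ((u y - c)\<^sup>2) \<partial>P)"
    proof (rule nn_integral_mono)
      fix y assume y: "y \<in> space P"
      show "ennreal (s * ((u y - c)\<^sup>2 - 4 * indicator B y)) \<le> q y * ennreal ((u y - c)\<^sup>2)"
      proof (cases "y \<in> B")
        case True
        then have "s * ((u y - c)\<^sup>2 - 4 * indicator B y) \<le> 0"
          using s le4[OF y] by (auto simp: mult_nonneg_nonpos)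
        then show ?thesis by (simp add: ennreal_neg)
      next
        case False
        then have "ennreal s \<le> q y" using y by (auto simp: B_def)
        then show ?thesis using False s by (auto simp: ennreal_mult intro!: mult_right_mono)
      qed
    qed
    also have "\<dots> = (\<integral>\<^sup>+y. ennreal ((u y - c)\<^sup>2) \<partial>density P q)"
      by (simp add: nn_integral_density)
    also have "\<dots> = ennreal (\<integral>y. (u y - c)\<^sup>2 \<partial>density P q)"
      by (rule nn_integral_eq_integral[OF iQ]) auto
    finally show ?thesis by simp
  qed
  finally show ?thesis unfolding B_def .
qed

text \<open>\<open>k_pos\<close> asks for positivity only, without a lower bound.
  \<open>K_density\<close> holds at every state rather than almost everywhere, so that any starting
  law becomes absolutely continuous after one step.\<close>

locale positive_density_kernel =
  fixes N :: "'s measure" and K :: "'s \<Rightarrow> 's measure" and P :: "'s measure"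
    and k :: "'s \<Rightarrow> 's \<Rightarrow> ennreal"
  assumes K [measurable]: "K \<in> N \<rightarrow>\<^sub>M prob_algebra N"
    and P: "P \<in> space (prob_algebra N)"
    and inv: "P \<bind> K = P"
    and k_measurable: "case_prod k \<in> borel_measurable (N \<Otimes>\<^sub>M N)"
    and k_pos: "\<And>x y. x \<in> space N \<Longrightarrow> y \<in> space N \<Longrightarrow> 0 < k x y"
    and K_density: "\<And>x. x \<in> space N \<Longrightarrow> K x = density P (k x)"
begin

lemma sets_P [simp, measurable_cong]: "sets P = sets N"
  using P by (simp add: space_prob_algebra)

lemma space_P [simp]: "space P = space N"
  using sets_P by (rule sets_eq_imp_space_eq)

sublocale P: prob_space P
  using P by (simp add: space_prob_algebra)

lemma measure_P_space [simp]: "measure P (space N) = 1"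
  using P.prob_space by simp

lemma K_prob: "x \<in> space N \<Longrightarrow> prob_space (K x)"
  and K_sets: "x \<in> space N \<Longrightarrow> sets (K x) = sets N"
  using measurable_space[OF K] by (auto simp: space_prob_algebra)

lemma K_space: "x \<in> space N \<Longrightarrow> space (K x) = space N"
  using K_sets by (rule sets_eq_imp_space_eq)

text \<open>The kernel acting on functions, dual to its action on laws in
  \<open>chain_law\<close>.\<close>

definition avg :: "('s \<Rightarrow> real) \<Rightarrow> 's \<Rightarrow> real" where
  "avg u x = (\<integral>y. u y \<partial>K x)"

text \<open>A class stable under \<open>avg\<close> that contains the centred indicator of every
  measurable set; the common bound 1 makes the estimates uniform over it.\<close>

definition centred :: "('s \<Rightarrow> real) \<Rightarrow> bool" where
  "centred u \<longleftrightarrow> u \<in> borel_measurable N \<and> (\<forall>x\<in>space N. \<bar>u x\<bar> \<le> 1) \<and> (\<integral>x. u x \<partial>P) = 0"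

lemma avg_measurable [measurable]: "u \<in> borel_measurable N \<Longrightarrow> avg u \<in> borel_measurable N"
  unfolding avg_def
  by (rule measurable_compose[OF measurable_prob_algebraD[OF K] integral_measurable_subprob_algebra])

lemma integrable_bounded:
  fixes u :: "'s \<Rightarrow> real"
  assumes "finite_measure \<mu>" "sets \<mu> = sets N" "u \<in> borel_measurable N" "\<forall>x\<in>space N. \<bar>u x\<bar> \<le> b"
  shows "integrable \<mu> u"
proof -
  interpret finite_measure \<mu> by fact
  show ?thesis
    using assms sets_eq_imp_space_eq[OF assms(2)]
    by (intro integrable_const_bound[where B=b] AE_I2) (auto cong: measurable_cong_sets)
qed

lemma avg_bound:
  assumes u: "u \<in> borel_measurable N" "\<forall>x\<in>space N. \<bar>u x\<bar> \<le> b" and x: "x \<in> space N"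
  shows "\<bar>avg u x\<bar> \<le> b"
proof -
  interpret Kx: prob_space "K x" using K_prob[OF x] .
  have "integrable (K x) u"
    by (rule integrable_bounded[OF _ K_sets[OF x] u]) unfold_locales
  moreover have "\<bar>u y\<bar> \<le> b" if "y \<in> space (K x)" for y
    using that u(2) x K_space by auto
  ultimately have "avg u x \<le> b" "avg u x \<ge> -b" unfolding avg_def
    by (auto intro!: Kx.integral_le_const Kx.integral_ge_const AE_I2 simp: abs_le_iff minus_le_iff)
  then show ?thesis by linarith
qed

lemma integral_bind_K:
  fixes u :: "'s \<Rightarrow> real"
  assumes \<mu>: "\<mu> \<in> space (prob_algebra N)"
    and u: "u \<in> borel_measurable N" "\<forall>x\<in>space N. \<bar>u x\<bar> \<le> b"
  shows "(\<integral>y. u y \<partial>(\<mu> \<bind> K)) = (\<integral>x. avg u x \<partial>\<mu>)"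
proof -
  interpret \<mu>: prob_space \<mu> using \<mu> by (simp add: space_prob_algebra)
  have s: "sets \<mu> = sets N" using \<mu> by (simp add: space_prob_algebra)
  show ?thesis unfolding avg_def
  proof (rule integral_bind[where K=N and B'=1 and B=b])
    show "K \<in> \<mu> \<rightarrow>\<^sub>M subprob_algebra N"
      using measurable_prob_algebraD[OF K] s by (simp cong: measurable_cong_sets)
    show "finite_measure \<mu>" by unfold_locales
    show "AE x in \<mu>. emeasure (K x) (space (K x)) \<le> ennreal 1"
      using prob_space.emeasure_space_1[OF K_prob] sets_eq_imp_space_eq[OF s] by (intro AE_I2) auto
  qed (use u s K_space \<mu>.not_empty sets_eq_imp_space_eq[OF s] in auto)
qed

lemma avg_centred:
  assumes "centred u" shows "centred (avg u)"
  using assms avg_bound[of u 1] avg_measurable[of u] integral_bind_K[OF P, of u 1]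
  unfolding centred_def by (simp add: inv)

text \<open>The mass, under the product of \<open>P\<close> with itself, of the pairs where
  \<open>k\<close> is below s, as an iterated integral.\<close>

definition \<eta> :: "real \<Rightarrow> real" where
  "\<eta> s = (\<integral>x. measure P {y \<in> space N. k x y < ennreal s} \<partial>P)"

lemma level_set [measurable]:
  "x \<in> space N \<Longrightarrow> {y \<in> space N. k x y < ennreal s} \<in> sets N"
  using measurable_Pair2[OF k_measurable] by (simp) measurable

lemma measure_level_measurable [measurable]:
  "(\<lambda>x. measure P {y \<in> space N. k x y < ennreal s}) \<in> borel_measurable N"
proof -
  have "{z \<in> space (N \<Otimes>\<^sub>M N). case_prod k z < ennreal s} \<in> sets (N \<Otimes>\<^sub>M N)"
    using k_measurable by measurable
  also have "{z \<in> space (N \<Otimes>\<^sub>M N). case_prod k z < ennreal s} =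
      Sigma (space N) (\<lambda>x. {y \<in> space N. k x y < ennreal s})"
    by (auto simp: space_pair_measure)
  finally show ?thesis
    by (rule measure_measurable_prob_algebra2) (use P in simp)
qed

text \<open>For fixed x the level sets decrease to the empty set, by pointwise positivity of
  \<open>k\<close>; dominated convergence handles the outer integral.\<close>

lemma \<eta>_tendsto: "(\<lambda>n. \<eta> (1 / real (Suc n))) \<longlonglongrightarrow> 0"
proof -
  have "(\<lambda>n. measure P {y \<in> space N. k x y < ennreal (1 / real (Suc n))}) \<longlonglongrightarrow> 0" if x: "x \<in> space N" for x
  proof -
    have "(\<lambda>n. measure P {y \<in> space N. k x y < ennreal (1 / real (Suc n))}) \<longlonglongrightarrow>
      measure P (\<Inter>n. {y \<in> space N. k x y < ennreal (1 / real (Suc n))})"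
      using x by (intro P.finite_Lim_measure_decseq)
        (auto intro!: decseq_SucI elim!: less_le_trans ennreal_leI simp: divide_simps)
    also have "(\<Inter>n. {y \<in> space N. k x y < ennreal (1 / real (Suc n))}) = {}"
    proof safe
      fix y assume y: "y \<in> (\<Inter>n. {y \<in> space N. k x y < ennreal (1 / real (Suc n))})"
      have "(\<lambda>n. ennreal (1 / real (Suc n))) \<longlonglongrightarrow> ennreal 0"
        using LIMSEQ_inverse_real_of_nat by (intro tendsto_ennrealI) (simp add: divide_inverse)
      then have "k x y \<le> ennreal 0"
        by (rule LIMSEQ_le_const) (use y in \<open>auto intro: less_imp_le\<close>)
      with k_pos[OF x, of y] y show "y \<in> {}" by auto
    qed
    finally show ?thesis by simp
  qed
  then have "(\<lambda>n. \<eta> (1 / real (Suc n))) \<longlonglongrightarrow> (\<integral>x. 0 \<partial>P)"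
    unfolding \<eta>_def
    by (intro integral_dominated_convergence[where w="\<lambda>_. 1"]) (auto intro!: AE_I2)
  then show ?thesis by simp
qed

text \<open>The decrease of the second moment is the average variance of \<open>u\<close> under \<open>K x\<close>, which
  dominates \<open>s\<close> times the variance under \<open>P\<close> restricted to the set where \<open>k x y \<ge> s\<close>.\<close>

lemma second_moment_step:
  assumes u: "centred u" and s: "0 \<le> s"
  shows "(\<integral>x. (avg u x)\<^sup>2 \<partial>P) \<le> (1 - s) * (\<integral>x. (u x)\<^sup>2 \<partial>P) + 4 * s * \<eta> s"
proof -
  have um [measurable]: "u \<in> borel_measurable N" and u1: "\<forall>x\<in>space N. \<bar>u x\<bar> \<le> 1" and u0: "(\<integral>x. u x \<partial>P) = 0"
    using u unfolding centred_def by auto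
  let ?m = "\<lambda>x. measure P {y \<in> space N. k x y < ennreal s}"
  let ?a = "\<integral>x. (u x)\<^sup>2 \<partial>P"
  have u2: "\<forall>x\<in>space N. \<bar>(u x)\<^sup>2\<bar> \<le> 1" using u1 by (simp add: abs_square_le_1)
  have *: "s * (?a - 4 * ?m x) \<le> avg (\<lambda>y. (u y)\<^sup>2) x - (avg u x)\<^sup>2" if x: "x \<in> space N" for x
  proof -
    interpret Kx: prob_space "K x" using K_prob[OF x] .
    have i: "integrable (K x) u" "integrable (K x) (\<lambda>y. (u y)\<^sup>2)"
      using integrable_bounded[OF Kx.finite_measure_axioms K_sets[OF x] _ u1]
        integrable_bounded[OF Kx.finite_measure_axioms K_sets[OF x] _ u2] by auto
    have "s * (?a - 4 * ?m x) \<le> (\<integral>y. (u y - avg u x)\<^sup>2 \<partial>K x)"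
      using variance_lower_bound[of P "k x" u "avg u x" s] K_density[OF x] K_prob[OF x] u1 u0 s
        avg_bound[OF um u1 x] measurable_Pair2[OF k_measurable x] P.prob_space_axioms by simp
    also have "\<dots> = avg (\<lambda>y. (u y)\<^sup>2) x - (avg u x)\<^sup>2"
      using Kx.variance_eq[OF i] by (simp add: avg_def)
    finally show ?thesis .
  qed
  have i2: "integrable P (\<lambda>x. (avg u x)\<^sup>2)" "integrable P ?m" "integrable P (avg (\<lambda>y. (u y)\<^sup>2))"
    using avg_bound[OF um u1] avg_bound[OF _ u2]
    by (auto intro!: P.integrable_const_bound[where B=1] AE_I2 simp: abs_square_le_1)
  have "s * (?a - 4 * \<eta> s) = (\<integral>x. s * (?a - 4 * ?m x) \<partial>P)"
    using i2 by (simp add: \<eta>_def P.prob_space)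
  also have "\<dots> \<le> (\<integral>x. avg (\<lambda>y. (u y)\<^sup>2) x - (avg u x)\<^sup>2 \<partial>P)"
    using * i2 by (intro integral_mono_AE AE_I2) auto
  \<comment> \<open>Stationarity: the average of u^2 after one transition has the same
    \<open>P\<close>-integral as u^2.\<close>
  also have "\<dots> = ?a - (\<integral>x. (avg u x)\<^sup>2 \<partial>P)"
    using i2 integral_bind_K[OF P _ u2] by (simp add: inv)
  finally show ?thesis by (simp add: algebra_simps)
qed

text \<open>The recursion a -> (1 - s) a + 4 s \<eta> s has the fixed point 4 \<eta> s and contracts
  the distance to it by the factor 1 - s; the second moment starts from at most 1.\<close>

lemma second_moment_iterate:
  assumes u: "centred u" and s: "0 \<le> s" "s \<le> 1"
  shows "centred ((avg ^^ t) u) \<and> (\<integral>x. ((avg ^^ t) u x)\<^sup>2 \<partial>P) \<le> (1 - s) ^ t + 4 * \<eta> s"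
proof (induction t)
  case 0
  have "(\<integral>x. (u x)\<^sup>2 \<partial>P) \<le> 1"
    using u unfolding centred_def
    by (intro P.integral_le_const P.integrable_const_bound[where B=1] AE_I2) (auto simp: abs_square_le_1)
  moreover have "0 \<le> \<eta> s" by (simp add: \<eta>_def)
  ultimately show ?case using u by simp
next
  case (Suc t)
  have "(\<integral>x. ((avg ^^ Suc t) u x)\<^sup>2 \<partial>P) \<le> (1 - s) * (\<integral>x. ((avg ^^ t) u x)\<^sup>2 \<partial>P) + 4 * s * \<eta> s"
    using second_moment_step[of "(avg ^^ t) u" s] Suc s by simp
  also have "\<dots> \<le> (1 - s) * ((1 - s) ^ t + 4 * \<eta> s) + 4 * s * \<eta> s"
    using Suc s by (intro add_right_mono mult_left_mono) auto
  finally show ?case using Suc avg_centred by (simp add: algebra_simps)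
qed

text \<open>First s is chosen, to make the constant part small, and then T for the geometric part.
  Neither depends on u.\<close>

lemma second_moment_small:
  assumes "0 < e"
  shows "\<exists>T. \<forall>t\<ge>T. \<forall>u. centred u \<longrightarrow> (\<integral>x. ((avg ^^ t) u x)\<^sup>2 \<partial>P) < e"
proof -
  \<comment> \<open>With e / 8 the constant part 4 \<eta> s stays below e / 2, leaving e / 2 for the
    power of 1 - s.\<close>
  from \<eta>_tendsto assms obtain n where n: "\<eta> (1 / real (Suc n)) < e / 8"
    by (fastforce dest!: order_tendstoD(2)[where a="e/8"] simp: eventually_sequentially)
  define s where "s = 1 / real (Suc n)"
  have s: "0 < s" "s \<le> 1" by (auto simp: s_def)
  have "(\<lambda>t. (1 - s) ^ t) \<longlonglongrightarrow> 0" using s by (intro LIMSEQ_realpow_zero) auto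
  then obtain T where T: "\<forall>t\<ge>T. (1 - s) ^ t < e / 2"
    using assms by (auto dest!: order_tendstoD(2)[where a="e/2"] simp: eventually_sequentially)
  show ?thesis
  proof (intro exI allI impI)
    fix t u assume "T \<le> t" "centred u"
    then show "(\<integral>x. ((avg ^^ t) u x)\<^sup>2 \<partial>P) < e"
      using second_moment_iterate[of u s t] s T n by (fastforce simp: s_def)
  qed
qed

section \<open>From second moments to total variation\<close>

lemma chain_law_space:
  "\<mu> \<in> space (prob_algebra N) \<Longrightarrow> chain_law K \<mu> t \<in> space (prob_algebra N)"
  by (induction t) (auto simp: chain_law_def space_prob_algebra intro!: prob_space_bind'[where M=N] sets_bind'[where M=N] K)

text \<open>Transitions move one at a time from the law to the test function. The induction varies
  u, because the last transition of the chain is the first \<open>avg\<close> to be applied.\<close>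

lemma chain_law_integral:
  fixes u :: "'s \<Rightarrow> real"
  assumes "\<mu> \<in> space (prob_algebra N)" "u \<in> borel_measurable N" "\<forall>x\<in>space N. \<bar>u x\<bar> \<le> b"
  shows "(\<integral>x. u x \<partial>chain_law K \<mu> t) = (\<integral>x. (avg ^^ t) u x \<partial>\<mu>)"
  using assms(2,3)
proof (induction t arbitrary: u)
  case 0 then show ?case by (simp add: chain_law_def)
next
  case (Suc t)
  have "(\<integral>x. u x \<partial>chain_law K \<mu> (Suc t)) = (\<integral>x. u x \<partial>(chain_law K \<mu> t \<bind> K))"
    by (simp add: chain_law_def)
  also have "\<dots> = (\<integral>x. avg u x \<partial>chain_law K \<mu> t)"
    by (rule integral_bind_K[OF chain_law_space[OF assms(1)] Suc.prems])
  also have "\<dots> = (\<integral>x. (avg ^^ t) (avg u) x \<partial>\<mu>)"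
    using Suc.prems avg_bound by (intro Suc.IH) auto
  finally show ?case by (simp add: funpow_swap1)
qed

text \<open>The law after one transition has a density g with respect to \<open>P\<close>, so the
  error on a set A is the \<open>P\<close>-integral of g times w, where w is the iterated centred
  indicator of A. The part of g above a level n is small in mean, and below n only the mean of |w|
  matters, which the second moment controls.\<close>

lemma converges_tv:
  assumes \<mu>: "\<mu> \<in> space (prob_algebra N)"
  shows "(\<lambda>t. tv_dist (chain_law K \<mu> t) P) \<longlonglongrightarrow> 0"
proof -
  define \<nu> where "\<nu> = \<mu> \<bind> K"
  have \<nu>: "\<nu> \<in> space (prob_algebra N)"
    unfolding \<nu>_def using prob_space_bind'[OF \<mu> K] sets_bind'[OF \<mu> K] by (simp add: space_prob_algebra)
  interpret \<nu>: prob_space \<nu> using \<nu> by (simp add: space_prob_algebra)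
  have [measurable_cong, simp]: "sets \<nu> = sets N" using \<nu> by (simp add: space_prob_algebra)
  have "absolutely_continuous P \<nu>"
    unfolding absolutely_continuous_def
  proof
    fix A assume A: "A \<in> null_sets P"
    then have [measurable]: "A \<in> sets N" by auto
    have "emeasure (K x) A = 0" if x: "x \<in> space N" for x
      using A measurable_Pair2[OF k_measurable x] absolutely_continuousI_density[of "k x" P]
      unfolding K_density[OF x] absolutely_continuous_def by auto
    then have "emeasure \<nu> A = 0"
      unfolding \<nu>_def using \<mu> sets_eq_imp_space_eq[of \<mu> N]
      by (subst emeasure_bind_prob_algebra[OF \<mu> K])
        (auto simp: space_prob_algebra intro!: nn_integral_zero'[OF AE_I2])
    then show "A \<in> null_sets \<nu>" by (simp add: null_sets_def)
  qed
  then have dens: "density P (RN_deriv P \<nu>) = \<nu>"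
    by (rule P.density_RN_deriv) simp
  \<comment> \<open>The derivative is extended-real valued but finite almost everywhere, so its real
    part represents the same law.\<close>
  define g where "g = (\<lambda>x. enn2real (RN_deriv P \<nu> x))"
  have [measurable]: "g \<in> borel_measurable N"
    unfolding g_def using borel_measurable_RN_deriv[of P \<nu>] by simp
  have "AE x in P. RN_deriv P \<nu> x \<noteq> \<infinity>"
    by (rule P.RN_deriv_finite) (use \<open>absolutely_continuous P \<nu>\<close> in \<open>auto simp: \<nu>.sigma_finite_measure_axioms\<close>)
  then have g_dens: "density P (\<lambda>x. ennreal (g x)) = \<nu>"
    by (subst dens[symmetric], intro density_cong) (auto simp: g_def less_top elim!: eventually_mono)
  have g_nonneg: "0 \<le> g x" for x by (simp add: g_def)
  have g_int: "integrable P g"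
  proof (rule integrableI_nonneg)
    have "(\<integral>\<^sup>+x. ennreal (g x) \<partial>P) = emeasure \<nu> (space N)"
      by (subst g_dens[symmetric]) (auto simp: emeasure_density intro!: nn_integral_cong)
    also have "\<dots> = 1" using \<nu>.emeasure_space_1 sets_eq_imp_space_eq[of \<nu> N] by simp
    finally show "(\<integral>\<^sup>+x. ennreal (g x) \<partial>P) < \<infinity>" by simp
  qed (auto simp: g_nonneg)
  show ?thesis
  proof (rule LIMSEQ_I)
    fix r :: real assume r: "0 < r"
    \<comment> \<open>g is integrable but possibly unbounded, so it cannot be paired directly with a
      function that is small in L2; this disposes of the part above level n.\<close>
    have "(\<lambda>n. \<integral>x. g x - min (g x) (real n) \<partial>P) \<longlonglongrightarrow> (\<integral>x. 0 \<partial>P)"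
    proof (rule integral_dominated_convergence[where w=g])
      have "\<forall>\<^sub>F n in sequentially. g x - min (g x) (real n) = 0" for x
      proof -
        obtain n0 where "g x \<le> real n0" using real_arch_simple by blast
        then show ?thesis
          by (auto simp: eventually_sequentially intro!: exI[of _ n0])
      qed
      then show "AE x in P. (\<lambda>n. g x - min (g x) (real n)) \<longlonglongrightarrow> 0"
        by (intro AE_I2 tendsto_eventually)
    qed (use g_int g_nonneg in auto)
    then obtain n where n: "(\<integral>x. g x - min (g x) (real n) \<partial>P) < r / 4"
      using r by (fastforce dest!: order_tendstoD(2)[where a="r/4"] simp: eventually_sequentially)
    \<comment> \<open>Below, |w| is bounded by d + w^2 / d. A second moment under d * d makes the
      mean of this at most 2 d, so the part of g below n costs at most n * 2 d, which is at most r /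
      2.\<close>
    define d where "d = r / (4 * (real n + 1))"
    have d: "0 < d" "real n * (2 * d) \<le> r / 2" using r by (auto simp: d_def field_simps)
    from second_moment_small[of "d * d"] d obtain T where
      T: "\<And>t u. T \<le> t \<Longrightarrow> centred u \<Longrightarrow> (\<integral>x. ((avg ^^ t) u x)\<^sup>2 \<partial>P) < d * d" by auto
    \<comment> \<open>T was fixed before A, so the bound is uniform over measurable sets, as the
      supremum in \<open>tv_dist\<close> requires.\<close>
    have bound: "\<bar>measure (chain_law K \<mu> (Suc t)) A - measure P A\<bar> \<le> 3 * r / 4"
      if t: "T \<le> t" and A [measurable]: "A \<in> sets N" for t A
    proof -
      define u where "u = (\<lambda>x. indicator A x - measure P A)"
      have "integrable P (indicator A :: _ \<Rightarrow> real)"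
        by (rule P.integrable_const_bound[where B=1]) auto
      then have u: "centred u" unfolding centred_def u_def
        by (auto split: split_indicator)
      have um [measurable]: "u \<in> borel_measurable N" and u1: "\<forall>x\<in>space N. \<bar>u x\<bar> \<le> 1"
        using u unfolding centred_def by auto
      define w where "w = (avg ^^ t) u"
      have "centred w" using second_moment_iterate[OF u, of 0 t] by (simp add: w_def)
      then have [measurable]: "w \<in> borel_measurable N" and w1: "\<forall>x\<in>space N. \<bar>w x\<bar> \<le> 1"
        unfolding centred_def by auto
      have \<mu>t: "chain_law K \<mu> (Suc t) \<in> space (prob_algebra N)" by (rule chain_law_space[OF \<mu>])
      interpret \<mu>t: prob_space "chain_law K \<mu> (Suc t)" using \<mu>t by (simp add: space_prob_algebra)
      have [simp]: "sets (chain_law K \<mu> (Suc t)) = sets N" using \<mu>t by (simp add: space_prob_algebra)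
      have "measure (chain_law K \<mu> (Suc t)) A - measure P A = (\<integral>x. u x \<partial>chain_law K \<mu> (Suc t))"
        unfolding u_def using \<mu>t.prob_space
        by (subst Bochner_Integration.integral_diff) (auto simp: \<mu>t.emeasure_eq_measure)
      \<comment> \<open>The first transition is absorbed into \<open>\<nu>\<close>; hence
        \<open>Suc t\<close> in the claim, but only t applications of \<open>avg\<close>.\<close>
      also have "\<dots> = (\<integral>x. u x \<partial>chain_law K \<nu> t)"
        by (simp add: chain_law_def \<nu>_def funpow_Suc_right del: funpow.simps)
      also have "\<dots> = (\<integral>x. w x \<partial>\<nu>)"
        unfolding w_def by (rule chain_law_integral[OF \<nu> um u1])
      also have "\<dots> = (\<integral>x. g x * w x \<partial>P)"
        by (subst g_dens[symmetric], subst integral_density) (auto simp: g_nonneg)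
      finally have eq: "measure (chain_law K \<mu> (Suc t)) A - measure P A = (\<integral>x. g x * w x \<partial>P)" .
      have iw: "integrable P (\<lambda>x. (w x)\<^sup>2)"
        using w1 by (intro P.integrable_const_bound[where B=1] AE_I2) (auto simp: abs_square_le_1)
      have im: "integrable P (\<lambda>x. min (g x) (real n))"
        using g_nonneg by (intro P.integrable_const_bound[where B="real n"] AE_I2) auto
      have "\<bar>\<integral>x. g x * w x \<partial>P\<bar> \<le> (\<integral>x. (g x - min (g x) (real n)) + real n * (d + (w x)\<^sup>2 / d) \<partial>P)"
      proof (rule integral_abs_bound[THEN order_trans], rule integral_mono_AE)
        show "integrable P (\<lambda>x. \<bar>g x * w x\<bar>)"
          using w1 g_nonneg
          by (intro integrable_abs Bochner_Integration.integrable_bound[OF g_int] AE_I2)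
            (auto simp: abs_mult mult_left_le)
        show "AE x in P. \<bar>g x * w x\<bar> \<le> g x - min (g x) (real n) + real n * (d + (w x)\<^sup>2 / d)"
        proof (rule AE_I2)
          fix x assume x: "x \<in> space P"
          have "2 * d * \<bar>w x\<bar> \<le> d\<^sup>2 + (w x)\<^sup>2"
            using sum_squares_bound[of d "\<bar>w x\<bar>"] by simp
          then have "d * \<bar>w x\<bar> \<le> d * d + (w x)\<^sup>2"
            using mult_nonneg_nonneg[of d "\<bar>w x\<bar>"] d unfolding power2_eq_square by linarith
          then have w2: "\<bar>w x\<bar> \<le> d + (w x)\<^sup>2 / d" using d by (simp add: field_simps)
          have "g x * \<bar>w x\<bar> = (g x - min (g x) (real n)) * \<bar>w x\<bar> + min (g x) (real n) * \<bar>w x\<bar>"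
            by (simp add: algebra_simps)
          also have "\<dots> \<le> (g x - min (g x) (real n)) * 1 + real n * (d + (w x)\<^sup>2 / d)"
            using w1 x w2 g_nonneg[of x] by (intro add_mono mult_left_mono mult_mono) auto
          finally show "\<bar>g x * w x\<bar> \<le> g x - min (g x) (real n) + real n * (d + (w x)\<^sup>2 / d)"
            using g_nonneg[of x] by (simp add: abs_mult)
        qed
      qed (use g_int im iw in auto)
      also have "\<dots> = (\<integral>x. g x - min (g x) (real n) \<partial>P) + real n * (d + (\<integral>x. (w x)\<^sup>2 \<partial>P) / d)"
        using g_int im iw by (simp add: P.prob_space)
      also have "\<dots> \<le> r / 4 + real n * (d + (d * d) / d)"
        using n T[OF t u] d by (intro add_mono mult_left_mono divide_right_mono) (auto simp: w_def)
      also have "\<dots> \<le> 3 * r / 4" using d by (simp add: mult_ac)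
      finally show ?thesis using eq by simp
    qed
    show "\<exists>T. \<forall>t\<ge>T. norm (tv_dist (chain_law K \<mu> t) P - 0) < r"
    proof (intro exI allI impI)
      fix t assume t: "Suc T \<le> t"
      then obtain t' where t': "t = Suc t'" "T \<le> t'" by (cases t) auto
      have s: "sets (chain_law K \<mu> t) = sets N"
        using chain_law_space[OF \<mu>, of t] by (simp add: space_prob_algebra)
      have "tv_dist (chain_law K \<mu> t) P \<le> 3 * r / 4"
        unfolding tv_dist_def s using bound[OF t'(2)] t'(1) by (intro cSUP_least) auto
      \<comment> \<open>The empty set contributes the value 0; a real supremum dominates it only
        once the family is known to be bounded.\<close>
      moreover have "0 \<le> tv_dist (chain_law K \<mu> t) P"
        unfolding tv_dist_def s
      proof (rule cSUP_upper2[where x="{}"])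
        show "bdd_above ((\<lambda>A. \<bar>measure (chain_law K \<mu> t) A - measure P A\<bar>) ` sets N)"
          using bound[OF t'(2)] t'(1) by (intro bdd_aboveI2[where M="3 * r / 4"]) auto
      qed auto
      ultimately show "norm (tv_dist (chain_law K \<mu> t) P - 0) < r" using r by simp
    qed
  qed
qed

theorem converges: "markov_chain_converges N K P"
  unfolding markov_chain_converges_def using K P inv converges_tv by blast

end

text \<open>Densities are computed on a product of blocks while the chain lives on pairs of
  matrices; this transports the whole locale along a measurable bijection, later
  \<open>assemble\<close> with inverse \<open>coords\<close>.\<close>

lemma (in positive_density_kernel) isomorphic_copy:
  assumes \<Phi> [measurable]: "\<Phi> \<in> N \<rightarrow>\<^sub>M N'" and \<Psi> [measurable]: "\<Psi> \<in> N' \<rightarrow>\<^sub>M N"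
    and \<Psi>\<Phi>: "\<And>x. x \<in> space N \<Longrightarrow> \<Psi> (\<Phi> x) = x" and \<Phi>\<Psi>: "\<And>y. y \<in> space N' \<Longrightarrow> \<Phi> (\<Psi> y) = y"
    and K': "\<And>y. y \<in> space N' \<Longrightarrow> K' y = distr (K (\<Psi> y)) N' \<Phi>"
  shows "positive_density_kernel N' K' (distr P N' \<Phi>) (\<lambda>x y. k (\<Psi> x) (\<Psi> y))"
proof
  have "(\<lambda>y. distr (K (\<Psi> y)) N' \<Phi>) \<in> N' \<rightarrow>\<^sub>M prob_algebra N'"
    using measurable_compose[OF measurable_compose[OF \<Psi> K] measurable_distr_prob_space[OF \<Phi>]] .
  then show K'_meas: "K' \<in> N' \<rightarrow>\<^sub>M prob_algebra N'"
    by (subst measurable_cong[OF K'])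
  show "distr P N' \<Phi> \<in> space (prob_algebra N')"
    by (auto simp: space_prob_algebra intro!: P.prob_space_distr)
  have P\<Phi>: "\<Phi> \<in> P \<rightarrow>\<^sub>M N'" by simp
  have PK: "K \<in> P \<rightarrow>\<^sub>M subprob_algebra N"
    using measurable_prob_algebraD[OF K] by (simp cong: measurable_cong_sets)
  have "distr P N' \<Phi> \<bind> K' = P \<bind> (\<lambda>x. K' (\<Phi> x))"
    using measurable_prob_algebraD[OF K'_meas] P.not_empty by (intro bind_distr[OF P\<Phi>]) auto
  also have "\<dots> = P \<bind> (\<lambda>x. distr (K x) N' \<Phi>)"
    using measurable_space[OF \<Phi>] by (intro bind_cong refl) (simp add: K' \<Psi>\<Phi>)
  also have "\<dots> = distr P N' \<Phi>"
    using distr_bind[OF PK _ \<Phi>] P.not_empty by (simp add: inv)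
  finally show "distr P N' \<Phi> \<bind> K' = distr P N' \<Phi>" .
  have "(\<lambda>z. case_prod k (\<Psi> (fst z), \<Psi> (snd z))) \<in> borel_measurable (N' \<Otimes>\<^sub>M N')"
    using k_measurable by measurable
  then show "(\<lambda>(x, y). k (\<Psi> x) (\<Psi> y)) \<in> borel_measurable (N' \<Otimes>\<^sub>M N')"
    by (simp add: split_beta')
  show "0 < k (\<Psi> x) (\<Psi> y)" if "x \<in> space N'" "y \<in> space N'" for x y
    using that measurable_space[OF \<Psi>] by (intro k_pos)
  fix x assume x: "x \<in> space N'"
  then have \<Psi>x: "\<Psi> x \<in> space N" using measurable_space[OF \<Psi>] by blast
  note [measurable] = measurable_Pair2[OF k_measurable \<Psi>x, simplified]
  show "K' x = density (distr P N' \<Phi>) (\<lambda>y. k (\<Psi> x) (\<Psi> y))"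
  proof (rule measure_eqI)
    fix A assume "A \<in> sets (K' x)"
    then have A [measurable]: "A \<in> sets N'" using K'[OF x] by simp
    have "emeasure (K' x) A = emeasure (density P (k (\<Psi> x))) (\<Phi> -` A \<inter> space N)"
      unfolding K'[OF x] using K_density[OF \<Psi>x] by (subst emeasure_distr) (auto)
    also have "\<dots> = (\<integral>\<^sup>+y. k (\<Psi> x) y * indicator (\<Phi> -` A \<inter> space N) y \<partial>P)"
      by (rule emeasure_density) auto
    also have "\<dots> = (\<integral>\<^sup>+y. k (\<Psi> x) (\<Psi> (\<Phi> y)) * indicator A (\<Phi> y) \<partial>P)"
      by (intro nn_integral_cong) (auto simp: \<Psi>\<Phi> split: split_indicator)
    also have "\<dots> = (\<integral>\<^sup>+y. k (\<Psi> x) (\<Psi> y) * indicator A y \<partial>distr P N' \<Phi>)"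
      by (subst nn_integral_distr) auto
    also have "\<dots> = emeasure (density (distr P N' \<Phi>) (\<lambda>y. k (\<Psi> x) (\<Psi> y))) A"
      by (subst emeasure_density) auto
    finally show "emeasure (K' x) A = emeasure (density (distr P N' \<Phi>) (\<lambda>y. k (\<Psi> x) (\<Psi> y))) A" .
  qed (simp add: K'[OF x])
qed

text \<open>Sigma-finiteness of R makes the integral of h over a set measurable in the parameter. It
  serves both for the conditional law of a block and for the posterior as a function of the
  data.\<close>

lemma measurable_density_prob_algebra:
  fixes h :: "'a \<Rightarrow> 'b \<Rightarrow> ennreal"
  assumes "sigma_finite_measure R" and h [measurable]: "case_prod h \<in> borel_measurable (N \<Otimes>\<^sub>M R)"
    and 1: "\<And>x. x \<in> space N \<Longrightarrow> (\<integral>\<^sup>+b. h x b \<partial>R) = 1"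
  shows "(\<lambda>x. density R (h x)) \<in> N \<rightarrow>\<^sub>M prob_algebra R"
proof -
  interpret R: sigma_finite_measure R by fact
  have p: "prob_space (density R (h x))" if "x \<in> space N" for x
  proof
    have [measurable]: "h x \<in> borel_measurable R" using measurable_Pair2[OF h that] by simp
    show "emeasure (density R (h x)) (space (density R (h x))) = 1"
      using 1[OF that] by (auto simp: emeasure_density intro!: nn_integral_cong)
  qed
  show ?thesis
  proof (intro measurable_prob_algebraI p measurable_subprob_algebra)
    fix A assume [measurable]: "A \<in> sets R"
    have "(\<lambda>x. \<integral>\<^sup>+b. h x b * indicator A b \<partial>R) \<in> borel_measurable N"
      by measurable
    also have "?this \<longleftrightarrow> (\<lambda>x. emeasure (density R (h x)) A) \<in> borel_measurable N"
      using measurable_Pair2[OF h] by (intro measurable_cong) (simp add: emeasure_density)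
    finally show "(\<lambda>x. emeasure (density R (h x)) A) \<in> borel_measurable N" .
  qed (auto dest: p intro: prob_space_imp_subprob_space)
qed

lemma ennreal_cancel_factor:
  fixes s G z :: ennreal
  assumes "0 < s" "s < \<infinity>" shows "s * (G / s / z) = G / z"
proof -
  have "s * (G / s) = G"
    using assms ennreal_mult_divide_eq[of s G] by (simp add: ennreal_times_divide mult.commute)
  then show ?thesis by (simp add: ennreal_times_divide)
qed

section \<open>Single-site Gibbs samplers on product spaces\<close>

text \<open>\<open>section_finite\<close> is demanded at every point, since a conditional law must
  be a probability for every current state; \<open>f_pos\<close> and \<open>nonnull\<close> make its
  normaliser \<open>sec\<close> positive.\<close>

locale product_gibbs = product_sigma_finite M for M :: "'i \<Rightarrow> 'b measure" +
  fixes I :: "'i set" and f :: "('i \<Rightarrow> 'b) \<Rightarrow> ennreal"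
  assumes finite_I [simp]: "finite I"
    and f_measurable [measurable]: "f \<in> borel_measurable (PiM I M)"
    and f_pos: "\<And>x. x \<in> space (PiM I M) \<Longrightarrow> 0 < f x"
    and f_finite: "\<And>x. x \<in> space (PiM I M) \<Longrightarrow> f x < \<infinity>"
    and total_finite: "(\<integral>\<^sup>+x. f x \<partial>PiM I M) < \<infinity>"
    and section_finite: "\<And>i x. i \<in> I \<Longrightarrow> x \<in> space (PiM I M) \<Longrightarrow> (\<integral>\<^sup>+b. f (x(i := b)) \<partial>M i) < \<infinity>"
    and nonnull: "\<And>i. i \<in> I \<Longrightarrow> emeasure (M i) (space (M i)) \<noteq> 0"
begin

abbreviation N where "N \<equiv> PiM I M"

definition Z :: ennreal where "Z = (\<integral>\<^sup>+x. f x \<partial>N)"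

definition target :: "('i \<Rightarrow> 'b) measure" where "target = density N (\<lambda>x. f x / Z)"

definition sec :: "'i \<Rightarrow> ('i \<Rightarrow> 'b) \<Rightarrow> ennreal" where "sec i x = (\<integral>\<^sup>+b. f (x(i := b)) \<partial>M i)"

definition resample :: "'i \<Rightarrow> ('i \<Rightarrow> 'b) \<Rightarrow> ('i \<Rightarrow> 'b) measure" where
  "resample i x = distr (density (M i) (\<lambda>b. f (x(i := b)) / sec i x)) N (\<lambda>b. x(i := b))"

text \<open>The same fold as in \<open>gibbs_kernel\<close>, so that the two can be matched step by
  step.\<close>

definition sweep :: "'i list \<Rightarrow> ('i \<Rightarrow> 'b) \<Rightarrow> ('i \<Rightarrow> 'b) measure" where
  "sweep is = fold (\<lambda>k K x. K x \<bind> k) (map resample is) (return N)"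

lemma upd_measurable [measurable]:
  "i \<in> I \<Longrightarrow> (\<lambda>(x, b). x(i := b)) \<in> N \<Otimes>\<^sub>M M i \<rightarrow>\<^sub>M N"
  unfolding split_beta' by (rule measurable_fun_upd[where J=I]) auto

lemma upd_space: "i \<in> I \<Longrightarrow> x \<in> space N \<Longrightarrow> b \<in> space (M i) \<Longrightarrow> x(i := b) \<in> space N"
  by (auto simp: space_PiM PiE_def extensional_def)

lemma f_upd_measurable [measurable]:
  "i \<in> I \<Longrightarrow> (\<lambda>(x, b). f (x(i := b))) \<in> borel_measurable (N \<Otimes>\<^sub>M M i)"
  using measurable_compose[OF upd_measurable f_measurable] by (simp add: split_beta')

lemma sec_measurable [measurable]: "i \<in> I \<Longrightarrow> sec i \<in> borel_measurable N"
  unfolding sec_def by measurable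

lemma sec_finite: "i \<in> I \<Longrightarrow> x \<in> space N \<Longrightarrow> sec i x < \<infinity>"
  unfolding sec_def by (rule section_finite)

lemma sec_pos: assumes "i \<in> I" "x \<in> space N" shows "0 < sec i x"
proof -
  have [measurable]: "(\<lambda>b. f (x(i := b))) \<in> borel_measurable (M i)"
    using measurable_Pair2[OF f_upd_measurable[OF assms(1)] assms(2)] by simp
  have "\<not> (AE b in M i. f (x(i := b)) = 0)"
  proof
    assume "AE b in M i. f (x(i := b)) = 0"
    then have "AE b in M i. False"
    proof (rule AE_mp, intro AE_I2 impI)
      fix b assume "b \<in> space (M i)" "f (x(i := b)) = 0"
      then show False using f_pos[OF upd_space[OF assms]] by force
    qed
    then show False using nonnull[OF assms(1)] by (simp add: eventually_False ae_filter_eq_bot_iff)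
  qed
  then show ?thesis unfolding sec_def
    by (subst (asm) nn_integral_0_iff_AE[symmetric]) (auto simp: zero_less_iff_neq_zero)
qed

lemma sec_upd [simp]: "sec i (x(i := b)) = sec i x"
  by (simp add: sec_def)

lemma resample_measurable [measurable]:
  assumes i: "i \<in> I" shows "resample i \<in> N \<rightarrow>\<^sub>M prob_algebra N"
  unfolding resample_def
proof (rule measurable_distr_prob_space2[OF measurable_density_prob_algebra upd_measurable[OF i]])
  show "sigma_finite_measure (M i)" by (rule sigma_finite_measures)
  show "(\<lambda>(x, b). f (x(i := b)) / sec i x) \<in> borel_measurable (N \<Otimes>\<^sub>M M i)"
    using i by measurable
  show "(\<integral>\<^sup>+b. f (x(i := b)) / sec i x \<partial>M i) = 1" if x: "x \<in> space N" for x
  proof -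
    have [measurable]: "(\<lambda>b. f (x(i := b))) \<in> borel_measurable (M i)"
      using measurable_Pair2[OF f_upd_measurable[OF i] x] by simp
    have "(\<integral>\<^sup>+b. f (x(i := b)) / sec i x \<partial>M i) = sec i x / sec i x"
      by (subst nn_integral_divide) (auto simp: sec_def)
    also have "\<dots> = 1" using sec_pos[OF i x] sec_finite[OF i x] by (simp add: ennreal_divide_self)
    finally show ?thesis .
  qed
qed

lemma nn_integral_resample:
  assumes i: "i \<in> I" and x: "x \<in> space N" and g [measurable]: "g \<in> borel_measurable N"
  shows "(\<integral>\<^sup>+y. g y \<partial>resample i x) = (\<integral>\<^sup>+b. f (x(i := b)) * g (x(i := b)) \<partial>M i) / sec i x"
proof -
  have [measurable]: "(\<lambda>b. x(i := b)) \<in> M i \<rightarrow>\<^sub>M N"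
    using measurable_Pair2[OF upd_measurable[OF i] x] by simp
  have "(\<integral>\<^sup>+y. g y \<partial>resample i x) = (\<integral>\<^sup>+b. f (x(i := b)) / sec i x * g (x(i := b)) \<partial>M i)"
    unfolding resample_def by (simp add: nn_integral_distr nn_integral_density)
  also have "\<dots> = (\<integral>\<^sup>+b. f (x(i := b)) * g (x(i := b)) / sec i x \<partial>M i)"
    by (simp add: ennreal_times_divide mult.commute)
  finally show ?thesis by (simp add: nn_integral_divide)
qed

lemma Z_finite: "Z < \<infinity>" unfolding Z_def by (rule total_finite)

lemma Z_pos: "0 < Z"
proof -
  interpret finite_product_sigma_finite M I by standard simp
  have "emeasure N (space N) \<noteq> 0"
    using nonnull by (simp add: space_PiM emeasure_PiM)
  moreover have "\<not> (AE x in N. f x = 0)"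
  proof
    assume "AE x in N. f x = 0"
    then have "AE x in N. False"
      by (rule AE_mp) (use f_pos in \<open>force intro!: AE_I2\<close>)
    then show False using calculation by (simp add: eventually_False ae_filter_eq_bot_iff)
  qed
  ultimately show ?thesis unfolding Z_def
    by (subst (asm) nn_integral_0_iff_AE[symmetric]) (auto simp: zero_less_iff_neq_zero)
qed

lemma target_prob: "target \<in> space (prob_algebra N)"
proof -
  have "emeasure target (space N) = (\<integral>\<^sup>+x. f x / Z \<partial>N)"
    unfolding target_def by (auto simp: emeasure_density intro!: nn_integral_cong)
  also have "\<dots> = 1"
    using Z_pos Z_finite by (subst nn_integral_divide) (auto simp: Z_def[symmetric] ennreal_divide_self)
  finally show ?thesis
    by (auto simp: space_prob_algebra target_def intro!: prob_spaceI)
qed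

text \<open>Tonelli splits off coordinate i. Along a fibre the resampled law does not depend on the
  current coordinate, so integrating f along the fibre yields \<open>sec\<close>, which cancels the
  normaliser of the conditional law.\<close>

lemma resample_invariant:
  assumes i: "i \<in> I" shows "target \<bind> resample i = target"
proof (rule measure_eqI)
  show "sets (target \<bind> resample i) = sets target"
    using sets_bind'[OF target_prob resample_measurable[OF i]] by (simp add: target_def)
  fix A assume "A \<in> sets (target \<bind> resample i)"
  then have A [measurable]: "A \<in> sets N"
    using sets_bind'[OF target_prob resample_measurable[OF i]] by simp
  define J where "J = I - {i}"
  have J: "finite J" "i \<notin> J" "insert i J = I" using i by (auto simp: J_def)
  let ?g = "indicator A :: _ \<Rightarrow> ennreal"
  note [measurable] = measurable_prob_algebraD[OF resample_measurable[OF i]]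
  have "emeasure (target \<bind> resample i) A = (\<integral>\<^sup>+x. emeasure (resample i x) A \<partial>target)"
    by (rule emeasure_bind_prob_algebra[OF target_prob resample_measurable[OF i] A])
  also have "\<dots> = (\<integral>\<^sup>+x. f x / Z * emeasure (resample i x) A \<partial>N)"
    unfolding target_def by (subst nn_integral_density) auto
  also have "\<dots> = (\<integral>\<^sup>+x. \<integral>\<^sup>+y. f (x(i := y)) / Z * emeasure (resample i (x(i := y))) A \<partial>M i \<partial>PiM J M)"
    using product_nn_integral_insert[OF J(1,2), of "\<lambda>x. f x / Z * emeasure (resample i x) A"] J(3) by simp
  also have "\<dots> = (\<integral>\<^sup>+x. \<integral>\<^sup>+y. f (x(i := y)) / Z * ?g (x(i := y)) \<partial>M i \<partial>PiM J M)"
  proof (rule nn_integral_cong)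
    fix x assume x: "x \<in> space (PiM J M)"
    have xb: "x(i := b) \<in> space N" if "b \<in> space (M i)" for b
      using x that unfolding J(3)[symmetric] by (auto simp: space_PiM PiE_def extensional_def)
    \<comment> \<open>x lacks coordinate i; b0 only completes it to a point of \<open>N\<close>, and
      by \<open>sec_upd\<close> its choice does not matter.\<close>
    obtain b0 where b0: "b0 \<in> space (M i)" using nonnull[OF i] by (metis emeasure_empty ex_in_conv)
    let ?x = "x(i := b0)"
    have [measurable]: "(\<lambda>b. x(i := b)) \<in> M i \<rightarrow>\<^sub>M N"
      using measurable_Pair2[OF upd_measurable[OF i] xb[OF b0]] by simp
    let ?G = "\<integral>\<^sup>+b. f (x(i := b)) * ?g (x(i := b)) \<partial>M i"
    have r: "emeasure (resample i (x(i := y))) A = ?G / sec i ?x" if y: "y \<in> space (M i)" for y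
    proof -
      have "sets (resample i (x(i := y))) = sets N" by (simp add: resample_def)
      then have "emeasure (resample i (x(i := y))) A = (\<integral>\<^sup>+z. ?g z \<partial>resample i (x(i := y)))"
        using A by simp
      also have "\<dots> = ?G / sec i (x(i := y))"
        by (subst nn_integral_resample[OF i xb[OF y]]) auto
      finally show ?thesis by simp
    qed
    have "(\<integral>\<^sup>+y. f (x(i := y)) / Z * emeasure (resample i (x(i := y))) A \<partial>M i) =
        (\<integral>\<^sup>+y. f (x(i := y)) * (?G / sec i ?x / Z) \<partial>M i)"
      by (intro nn_integral_cong) (simp add: r divide_ennreal_def mult_ac)
    also have "\<dots> = sec i ?x * (?G / sec i ?x / Z)"
      by (subst nn_integral_multc) (auto simp: sec_def)
    also have "\<dots> = ?G / Z"
      using sec_pos[OF i xb[OF b0]] sec_finite[OF i xb[OF b0]] by (rule ennreal_cancel_factor)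
    also have "\<dots> = (\<integral>\<^sup>+y. f (x(i := y)) / Z * ?g (x(i := y)) \<partial>M i)"
      by (subst nn_integral_divide[symmetric]) (auto simp: divide_ennreal_def mult_ac)
    finally show "(\<integral>\<^sup>+y. f (x(i := y)) / Z * emeasure (resample i (x(i := y))) A \<partial>M i) =
      (\<integral>\<^sup>+y. f (x(i := y)) / Z * ?g (x(i := y)) \<partial>M i)" .
  qed
  also have "\<dots> = (\<integral>\<^sup>+x. f x / Z * ?g x \<partial>N)"
    using product_nn_integral_insert[OF J(1,2), of "\<lambda>x. f x / Z * ?g x"] J(3) by simp
  also have "\<dots> = emeasure target A"
    unfolding target_def by (subst emeasure_density) auto
  finally show "emeasure (target \<bind> resample i) A = emeasure target A" .
qed

lemma sweep_Nil [simp]: "sweep [] = return N"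
  by (simp add: sweep_def)

lemma sweep_snoc: "sweep (is @ [i]) x = sweep is x \<bind> resample i"
  by (simp add: sweep_def)

lemma sweep_measurable: "set is \<subseteq> I \<Longrightarrow> sweep is \<in> N \<rightarrow>\<^sub>M prob_algebra N"
proof (induction "is" rule: rev_induct)
  case (snoc i "is")
  then show ?case unfolding sweep_snoc[abs_def]
    by (intro measurable_bind_prob_space) auto
qed simp

lemma sweep_invariant: "set is \<subseteq> I \<Longrightarrow> target \<bind> sweep is = target"
proof (induction "is" rule: rev_induct)
  case Nil
  then show ?case by (simp add: bind_return'' target_def)
next
  case (snoc i "is")
  have "sweep is \<in> target \<rightarrow>\<^sub>M subprob_algebra N"
    using measurable_prob_algebraD[OF sweep_measurable[of "is"]] snoc.prems
    by (simp add: target_def cong: measurable_cong_sets)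
  then have "target \<bind> sweep (is @ [i]) = (target \<bind> sweep is) \<bind> resample i"
    unfolding sweep_snoc[abs_def]
    using snoc.prems measurable_prob_algebraD[OF resample_measurable, of i]
    by (subst bind_assoc[where N=N and R=N]) auto
  then show ?case using snoc resample_invariant by simp
qed

text \<open>The outer restriction to I makes the result extensional, as points of \<open>N\<close>
  must be.\<close>

definition override :: "'i set \<Rightarrow> ('i \<Rightarrow> 'b) \<Rightarrow> ('i \<Rightarrow> 'b) \<Rightarrow> 'i \<Rightarrow> 'b" where
  "override W x b = (\<lambda>j\<in>I. if j \<in> W then b j else x j)"

lemma override_measurable:
  "W \<subseteq> I \<Longrightarrow> (\<lambda>(x, b). override W x b) \<in> N \<Otimes>\<^sub>M PiM W M \<rightarrow>\<^sub>M N"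
  unfolding override_def split_beta'
proof (rule measurable_restrict)
  fix j assume "W \<subseteq> I" "j \<in> I"
  then show "(\<lambda>z. if j \<in> W then snd z j else fst z j) \<in> N \<Otimes>\<^sub>M PiM W M \<rightarrow>\<^sub>M M j"
    by (cases "j \<in> W") auto
qed

text \<open>Coordinates not yet visited still sit at their values in x, so a partial sweep need not
  have a density with respect to \<open>N\<close>. The statement therefore integrates over the
  visited coordinates alone and fills in the rest from x. Distinctness ensures that each drawn value
  is final.\<close>

lemma sweep_density:
  "distinct is \<Longrightarrow> set is \<subseteq> I \<Longrightarrow>
    \<exists>k. case_prod k \<in> borel_measurable (N \<Otimes>\<^sub>M PiM (set is) M) \<and>
      (\<forall>x\<in>space N. \<forall>b\<in>space (PiM (set is) M). 0 < k x b) \<and>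
      (\<forall>x\<in>space N. \<forall>g\<in>borel_measurable N.
        (\<integral>\<^sup>+y. g y \<partial>sweep is x) = (\<integral>\<^sup>+b. k x b * g (override (set is) x b) \<partial>PiM (set is) M))"
proof (induction "is" rule: rev_induct)
  case Nil
  \<comment> \<open>No site has been visited: the law is the point mass at x, and the product over
    the empty index set is one point of mass 1.\<close>
  have "override {} x b = x" if "x \<in> space N" for x b
    using that by (auto simp: override_def space_PiM)
  then show ?case
    by (intro exI[of _ "\<lambda>_ _. 1"])
      (auto simp: nn_integral_return PiM_empty nn_integral_count_space_finite)
next
  case (snoc i "is")
  define W where "W = set is"
  have i: "i \<in> I" "i \<notin> W" and W: "W \<subseteq> I" "finite W" using snoc.prems by (auto simp: W_def)
  have "distinct is" using snoc.prems by simp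
  from snoc.IH[folded W_def, OF this W(1)] obtain k
    where k [measurable]: "case_prod k \<in> borel_measurable (N \<Otimes>\<^sub>M PiM W M)"
    and k_pos': "\<forall>x\<in>space N. \<forall>b\<in>space (PiM W M). 0 < k x b"
    and k_int': "\<forall>x\<in>space N. \<forall>g\<in>borel_measurable N.
        (\<integral>\<^sup>+y. g y \<partial>sweep is x) = (\<integral>\<^sup>+b. k x b * g (override W x b) \<partial>PiM W M)"
    by (elim exE conjE)
  note k_pos = k_pos'[rule_format] and k_int = k_int'[rule_format]
  have iW: "insert i W \<subseteq> I" using i W by auto
  \<comment> \<open>The new factor is the conditional density of site i given the state after the
    earlier sites: f at the new state over the section integral at the old one.\<close>
  define k' where "k' x b = k x (restrict b W) * (f (override (insert i W) x b) / sec i (override W x (restrict b W)))" for x b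
  have restr: "(\<lambda>(x, b). (x, restrict b W)) \<in> N \<Otimes>\<^sub>M PiM (insert i W) M \<rightarrow>\<^sub>M N \<Otimes>\<^sub>M PiM W M"
    unfolding split_beta' by (intro measurable_Pair measurable_fst measurable_compose[OF measurable_snd measurable_restrict_subset]) auto
  have k'_meas: "case_prod k' \<in> borel_measurable (N \<Otimes>\<^sub>M PiM (insert i W) M)"
  proof -
    let ?D = "N \<Otimes>\<^sub>M PiM (insert i W) M"
    have 1: "(\<lambda>z. k (fst z) (restrict (snd z) W)) \<in> borel_measurable ?D"
      using measurable_compose[OF restr k] by (simp only: split_beta' fst_conv snd_conv)
    have "(\<lambda>z. override W (fst z) (restrict (snd z) W)) \<in> ?D \<rightarrow>\<^sub>M N"
      using measurable_compose[OF restr override_measurable[OF W(1)]]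
      by (simp only: split_beta' fst_conv snd_conv)
    from measurable_compose[OF this sec_measurable[OF i(1)]]
    have 2: "(\<lambda>z. sec i (override W (fst z) (restrict (snd z) W))) \<in> borel_measurable ?D" .
    have 3: "(\<lambda>z. f (override (insert i W) (fst z) (snd z))) \<in> borel_measurable ?D"
      using measurable_compose[OF override_measurable[OF iW] f_measurable]
      by (simp only: split_beta')
    show ?thesis
      unfolding k'_def split_beta' using 1 2 3
      by (intro borel_measurable_times_ennreal borel_measurable_divide_ennreal)
  qed
  have ov_space: "override V x b \<in> space N" if "x \<in> space N" "b \<in> space (PiM V M)" "V \<subseteq> I" for x b V
    using measurable_space[OF override_measurable[OF that(3)], of "(x, b)"] that by (simp add: space_pair_measure)
  have restr_space: "restrict b W \<in> space (PiM W M)" if "b \<in> space (PiM (insert i W) M)" for b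
    using that by (auto simp: space_PiM)
  show ?case
  proof (intro exI[of _ k'] conjI ballI)
    show "case_prod k' \<in> borel_measurable (N \<Otimes>\<^sub>M PiM (set (is @ [i])) M)"
      using k'_meas by (simp add: W_def)
    show "0 < k' x b" if "x \<in> space N" "b \<in> space (PiM (set (is @ [i])) M)" for x b
    proof -
      have b: "b \<in> space (PiM (insert i W) M)" using that by (simp add: W_def)
      show ?thesis
        unfolding k'_def
        using k_pos[OF that(1) restr_space[OF b]] f_pos[OF ov_space[OF that(1) b iW]]
          sec_finite[OF i(1) ov_space[OF that(1) restr_space[OF b] W(1)]]
        by (simp add: ennreal_zero_less_mult_iff ennreal_zero_less_divide)
    qed
    fix x and g :: "_ \<Rightarrow> ennreal" assume x: "x \<in> space N" and g [measurable]: "g \<in> borel_measurable N"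
    have ovI: "override (insert i W) x \<in> PiM (insert i W) M \<rightarrow>\<^sub>M N"
      using measurable_Pair2[OF override_measurable[OF iW] x] by simp
    have k'x: "k' x \<in> borel_measurable (PiM (insert i W) M)"
      using measurable_Pair2[OF k'_meas x] by simp
    have sw: "sweep is x \<in> space (prob_algebra N)"
      using measurable_space[OF sweep_measurable[of "is"] x] W by (simp add: W_def)
    have "(\<integral>\<^sup>+y. g y \<partial>sweep (is @ [i]) x) = (\<integral>\<^sup>+y. \<integral>\<^sup>+z. g z \<partial>resample i y \<partial>sweep is x)"
      unfolding sweep_snoc
      using measurable_prob_algebraD[OF resample_measurable[OF i(1)]] sw
      by (subst nn_integral_bind[where B=N]) (auto simp: space_prob_algebra cong: measurable_cong_sets)
    also have "\<dots> = (\<integral>\<^sup>+b. k x b * (\<integral>\<^sup>+z. g z \<partial>resample i (override W x b)) \<partial>PiM W M)"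
      by (rule k_int[OF x measurable_compose[OF measurable_prob_algebraD[OF resample_measurable[OF i(1)]]
            nn_integral_measurable_subprob_algebra[OF g]]])
    also have "\<dots> = (\<integral>\<^sup>+b. \<integral>\<^sup>+c. k' x (b(i := c)) * g (override (insert i W) x (b(i := c))) \<partial>M i \<partial>PiM W M)"
    proof (rule nn_integral_cong)
      fix b assume b: "b \<in> space (PiM W M)"
      let ?y = "override W x b"
      have y: "?y \<in> space N" by (rule ov_space[OF x b W(1)])
      have "(\<lambda>c. ?y(i := c)) \<in> M i \<rightarrow>\<^sub>M N"
        using measurable_Pair2[OF upd_measurable[OF i(1)] y] by (simp only: prod.case)
      note fy = measurable_compose[OF this f_measurable] and gy = measurable_compose[OF this g]
      have r: "restrict (b(i := c)) W = b" for c
        using b i by (auto simp: space_PiM PiE_def extensional_def fun_eq_iff)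
      have o: "override (insert i W) x (b(i := c)) = ?y(i := c)" for c
        using i by (auto simp: override_def fun_eq_iff)
      have "k x b * (\<integral>\<^sup>+z. g z \<partial>resample i ?y) =
          (\<integral>\<^sup>+c. k x b * (f (?y(i := c)) * g (?y(i := c)) / sec i ?y) \<partial>M i)"
        unfolding nn_integral_resample[OF i(1) y g]
        using borel_measurable_times_ennreal[OF fy gy]
        by (subst nn_integral_cmult) (simp_all add: nn_integral_divide)
      also have "\<dots> = (\<integral>\<^sup>+c. k' x (b(i := c)) * g (override (insert i W) x (b(i := c))) \<partial>M i)"
        by (simp add: k'_def r o divide_ennreal_def mult_ac)
      finally show "k x b * (\<integral>\<^sup>+z. g z \<partial>resample i ?y) =
          (\<integral>\<^sup>+c. k' x (b(i := c)) * g (override (insert i W) x (b(i := c))) \<partial>M i)" .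
    qed
    also have "\<dots> = (\<integral>\<^sup>+b. k' x b * g (override (insert i W) x b) \<partial>PiM (insert i W) M)"
      by (rule product_nn_integral_insert[OF W(2) i(2), symmetric])
        (rule borel_measurable_times_ennreal[OF k'x measurable_compose[OF ovI g]])
    finally show "(\<integral>\<^sup>+y. g y \<partial>sweep (is @ [i]) x) =
      (\<integral>\<^sup>+b. k' x b * g (override (set (is @ [i])) x b) \<partial>PiM (set (is @ [i])) M)"
      by (simp add: W_def)
  qed
qed

text \<open>After a full sweep \<open>override I x b\<close> is b itself, so
  \<open>sweep_density\<close> gives a density with respect to \<open>N\<close>; the factor Z / f
  changes the reference measure to \<open>target\<close>, and it is positive since f is
  finite.\<close>

theorem sweep_positive_density:
  assumes "distinct is" "set is = I"
  obtains k where "positive_density_kernel N (sweep is) target k"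
proof -
  from sweep_density[of "is"] assms obtain k where
    k [measurable]: "case_prod k \<in> borel_measurable (N \<Otimes>\<^sub>M N)"
    and k_pos: "\<And>x b. x \<in> space N \<Longrightarrow> b \<in> space N \<Longrightarrow> 0 < k x b"
    and k_int: "\<And>x g. x \<in> space N \<Longrightarrow> g \<in> borel_measurable N \<Longrightarrow>
        (\<integral>\<^sup>+y. g y \<partial>sweep is x) = (\<integral>\<^sup>+b. k x b * g (override I x b) \<partial>N)" by auto
  have ov: "override I x b = b" if "b \<in> space N" for x b
    using that by (auto simp: override_def space_PiM PiE_def extensional_def fun_eq_iff)
  have "positive_density_kernel N (sweep is) target (\<lambda>x y. k x y * (Z / f y))"
  proof
    show "sweep is \<in> N \<rightarrow>\<^sub>M prob_algebra N" using sweep_measurable assms by simp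
    show "target \<in> space (prob_algebra N)" by (rule target_prob)
    show "target \<bind> sweep is = target" using sweep_invariant assms by simp
    show "(\<lambda>(x, y). k x y * (Z / f y)) \<in> borel_measurable (N \<Otimes>\<^sub>M N)" by measurable
    show "0 < k x y * (Z / f y)" if "x \<in> space N" "y \<in> space N" for x y
      using k_pos[OF that] Z_pos f_finite[OF that(2)]
      by (simp add: ennreal_zero_less_mult_iff ennreal_zero_less_divide)
    fix x assume x: "x \<in> space N"
    have [measurable]: "k x \<in> borel_measurable N" using measurable_Pair2[OF k x] by simp
    have s: "sets (sweep is x) = sets N"
      using measurable_space[OF sweep_measurable x] assms by (simp add: space_prob_algebra)
    show "sweep is x = density target (\<lambda>y. k x y * (Z / f y))"
    proof (rule measure_eqI)
      fix A assume "A \<in> sets (sweep is x)"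
      then have [measurable]: "A \<in> sets N" using s by simp
      have "emeasure (sweep is x) A = (\<integral>\<^sup>+y. indicator A y \<partial>sweep is x)" using s by simp
      also have "\<dots> = (\<integral>\<^sup>+y. k x y * indicator A (override I x y) \<partial>N)"
        by (rule k_int[OF x]) simp
      also have "\<dots> = (\<integral>\<^sup>+y. f y / Z * (k x y * (Z / f y) * indicator A y) \<partial>N)"
      proof (rule nn_integral_cong)
        fix y assume y: "y \<in> space N"
        have "f y / Z * (Z / f y) = 1"
          using ennreal_cancel_factor[OF f_pos[OF y] f_finite[OF y], of Z Z] Z_pos Z_finite
          by (simp add: ennreal_divide_times)
        then have "(f y / Z * (Z / f y)) * (k x y * indicator A y) = k x y * indicator A y" by simp
        then show "k x y * indicator A (override I x y) = f y / Z * (k x y * (Z / f y) * indicator A y)"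
          using ov[OF y] by (simp only: mult_ac)
      qed
      also have "\<dots> = emeasure (density target (\<lambda>y. k x y * (Z / f y))) A"
        unfolding target_def
        by (simp add: emeasure_density nn_integral_density)
      finally show "emeasure (sweep is x) A = emeasure (density target (\<lambda>y. k x y * (Z / f y))) A" .
    qed (simp add: s target_def)
  qed
  then show ?thesis by (rule that)
qed

end

section \<open>Matrix inverses\<close>

text \<open>\<open>matrix_inv\<close> is given by a choice operator; for square matrices a one-sided
  inverse is two-sided and hence unique.\<close>

lemma matrix_inv_eqI:
  fixes A B :: "real^'n^'n"
  assumes "A ** B = mat 1" shows "matrix_inv A = B"
proof -
  have BA: "B ** A = mat 1" using assms matrix_left_right_inverse by blast
  have "A ** matrix_inv A = mat 1 \<and> matrix_inv A ** A = mat 1"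
    unfolding matrix_inv_def using assms BA by (intro someI) auto
  then have "matrix_inv A = (B ** A) ** matrix_inv A" "B = B ** (A ** matrix_inv A)"
    using BA by simp_all
  then show ?thesis by (simp add: matrix_mul_assoc)
qed

lemma matrix_inv_right:
  fixes A :: "real^'n^'n"
  assumes "det A \<noteq> 0" shows "A ** matrix_inv A = mat 1"
  using assms matrix_inv_eqI[of A] by (metis invertible_det_nz invertible_right_inverse)

text \<open>Cramer's rule for column l of the inverse. It exhibits the entries as quotients of
  polynomials in the entries of A, which yields measurability of the inverse.\<close>

lemma matrix_inv_cramer:
  fixes A :: "real^'n^'n"
  assumes "det A \<noteq> 0"
  shows "matrix_inv A $ k $ l = det (\<chi> i j. if j = k then (if i = l then 1 else 0) else A $ i $ j) / det A"
proof -
  define x where "x = (\<chi> k. matrix_inv A $ k $ l)"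
  define b :: "real^'n" where "b = (\<chi> i. if i = l then 1 else 0)"
  have "A *v x = b"
    using matrix_inv_right[OF assms]
    by (simp add: vec_eq_iff matrix_vector_mult_def matrix_matrix_mult_def x_def b_def mat_def)
  then have "x = (\<chi> k. det (\<chi> i j. if j = k then b $ i else A $ i $ j) / det A)"
    by (simp add: cramer[OF assms])
  then have "x $ k = det (\<chi> i j. if j = k then b $ i else A $ i $ j) / det A" by simp
  then show ?thesis by (simp add: x_def b_def cong: if_cong)
qed

lemma borel_measurable_det:
  fixes A :: "'a \<Rightarrow> real^'n^'n"
  assumes [measurable]: "\<And>i j. (\<lambda>x. A x $ i $ j) \<in> borel_measurable M"
  shows "(\<lambda>x. det (A x)) \<in> borel_measurable M"
  unfolding det_def by measurable

lemma borel_measurable_matrix_inv: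
  fixes A :: "'a \<Rightarrow> real^'n^'n"
  assumes A: "\<And>i j. (\<lambda>x. A x $ i $ j) \<in> borel_measurable M" and "\<And>x. x \<in> space M \<Longrightarrow> det (A x) \<noteq> 0"
  shows "(\<lambda>x. matrix_inv (A x) $ k $ l) \<in> borel_measurable M"
proof (subst measurable_cong[OF matrix_inv_cramer])
  show "(\<lambda>x. det (\<chi> i j. if j = k then (if i = l then 1 else 0) else A x $ i $ j) / det (A x)) \<in> borel_measurable M"
  proof (intro borel_measurable_divide borel_measurable_det A)
    show "(\<lambda>x. (\<chi> i j. if j = k then (if i = l then 1 else 0) else A x $ i $ j) $ p $ q) \<in> borel_measurable M" for p q
      using A by (cases "q = k") auto
  qed
qed (use assms in auto)

lemma borel_measurable_matI:
  fixes A :: "'a \<Rightarrow> real^'n^'m"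
  assumes "\<And>i j. (\<lambda>x. A x $ i $ j) \<in> borel_measurable M" shows "A \<in> borel_measurable M"
proof -
  have "(\<lambda>x. A x \<bullet> axis i (axis j 1)) \<in> borel_measurable M" for i j
    using assms[of i j] by (simp add: inner_axis)
  then show ?thesis
    unfolding borel_measurable_euclidean_space[of A] by (auto simp: Basis_vec_def)
qed

section \<open>The density in terms of the rows of the inverse of \<open>L\<close>\<close>

lemma unit_lower_det: "unit_lower (L :: 'm::{finite,wellorder} rmat) \<Longrightarrow> det L = 1"
  by (subst det_lowerdiagonal) (auto simp: unit_lower_def)

text \<open>Forward substitution: once the entries above k in a column of the inverse vanish, row k
  of \<open>L ** matrix_inv L\<close> reduces to the entry at k itself.\<close>

lemma unit_lower_matrix_inv:
  fixes L :: "'m::{finite,wellorder} rmat"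
  assumes L: "unit_lower L" shows "unit_lower (matrix_inv L)"
proof -
  let ?R = "matrix_inv L"
  have LR: "L ** ?R = mat 1" using unit_lower_det[OF L] by (intro matrix_inv_right) simp
  have *: "(\<Sum>j\<in>UNIV. L $ i $ j * ?R $ j $ v) = (if i = v then 1 else 0)" for i v
    using arg_cong[OF LR, of "\<lambda>A. A $ i $ v"] by (simp add: matrix_matrix_mult_def mat_def)
  have sum_eq: "(\<Sum>j\<in>UNIV. L $ k $ j * ?R $ j $ v) = ?R $ k $ v"
    if "\<forall>j<k. ?R $ j $ v = 0" for k v
  proof -
    have "L $ k $ j * ?R $ j $ v = (if j = k then ?R $ k $ v else 0)" for j
      using that L by (cases j k rule: linorder_cases) (auto simp: unit_lower_def)
    then show ?thesis by simp
  qed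
  have 0: "?R $ k $ v = 0" if "k < v" for k v
    using that
  proof (induction k rule: less_induct)
    case (less k)
    then have "\<forall>j<k. ?R $ j $ v = 0" by auto
    from sum_eq[OF this] *[of k v] less.prems show ?case by (auto split: if_splits)
  qed
  moreover have "?R $ v $ v = 1" for v
    using sum_eq[of v v] *[of v v] 0 by simp
  ultimately show ?thesis by (simp add: unit_lower_def)
qed

lemma det_cov:
  fixes L D :: "'m::{finite,wellorder} rmat"
  assumes "unit_lower L" "pos_diag D" shows "det (cov (L, D)) = (\<Prod>i\<in>UNIV. D $ i $ i)"
  using assms by (simp add: cov_def det_mul unit_lower_det) (subst det_diagonal; simp add: pos_diag_def)

lemma det_cov_pos:
  fixes L D :: "'m::{finite,wellorder} rmat"
  assumes "unit_lower L" "pos_diag D" shows "det (cov (L, D)) > 0"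
  using assms by (simp add: det_cov) (simp add: pos_diag_def prod_pos)

definition row_form :: "'m rmat \<Rightarrow> 'm::{finite,wellorder} rmat \<Rightarrow> 'm \<Rightarrow> real" where
  "row_form U L i = matrix_inv L $ i \<bullet> (U *v (matrix_inv L $ i))"

lemma matrix_inv_cov:
  fixes L D :: "'m::{finite,wellorder} rmat"
  assumes L: "unit_lower L" and D: "pos_diag D"
  shows "matrix_inv (cov (L, D)) = transpose (matrix_inv L) ** (\<chi> i j. if i = j then 1 / D $ i $ i else 0) ** matrix_inv L"
proof (rule matrix_inv_eqI)
  let ?R = "matrix_inv L" and ?Di = "\<chi> i j. if i = j then 1 / D $ i $ i else 0"
  have LR: "L ** ?R = mat 1" using unit_lower_det[OF L] by (intro matrix_inv_right) simp
  have LRt: "transpose L ** transpose ?R = mat 1"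
    using LR matrix_left_right_inverse by (metis matrix_transpose_mul transpose_mat)
  have DD: "D ** ?Di = mat 1"
  proof -
    have "D $ i $ k * ?Di $ k $ j = (if k = i then (if i = j then 1 else 0) else 0)" for i j k
      using D by (auto simp: pos_diag_def less_imp_neq[symmetric])
    then show ?thesis by (simp add: vec_eq_iff matrix_matrix_mult_def mat_def)
  qed
  have "cov (L, D) ** (transpose ?R ** ?Di ** ?R) = L ** (D ** ((transpose L ** transpose ?R) ** ?Di)) ** ?R"
    by (simp add: cov_def matrix_mul_assoc)
  also have "\<dots> = mat 1" by (simp add: LRt DD LR)
  finally show "cov (L, D) ** (transpose ?R ** ?Di ** ?R) = mat 1" .
qed

text \<open>By cyclicity of the trace only the diagonal of
  \<open>matrix_inv L ** U ** transpose (matrix_inv L)\<close> matters, and its entries are the row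
  forms.\<close>

lemma trace_cov_inv:
  fixes L D U :: "'m::{finite,wellorder} rmat"
  assumes L: "unit_lower L" and D: "pos_diag D"
  shows "trace (matrix_inv (cov (L, D)) ** U) = (\<Sum>i\<in>UNIV. row_form U L i / D $ i $ i)"
proof -
  let ?R = "matrix_inv L" and ?Di = "\<chi> i j. if i = j then 1 / D $ i $ i else 0"
  have "trace (matrix_inv (cov (L, D)) ** U) = trace (transpose ?R ** (?Di ** ?R ** U))"
    by (simp add: matrix_inv_cov[OF L D] matrix_mul_assoc)
  also have "\<dots> = trace (?Di ** (?R ** U ** transpose ?R))"
    by (subst trace_mul_sym) (simp add: matrix_mul_assoc)
  also have "\<dots> = (\<Sum>i\<in>UNIV. (?R ** U ** transpose ?R) $ i $ i / D $ i $ i)"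
  proof -
    have "(\<Sum>k\<in>UNIV. (if i = k then 1 / D $ i $ i else 0) * X $ k $ i) = X $ i $ i / D $ i $ i" for i and X :: "'m rmat"
      by (subst sum.remove[of _ i]) auto
    then show ?thesis by (simp add: trace_def matrix_matrix_mult_def[of ?Di])
  qed
  also have "\<dots> = (\<Sum>i\<in>UNIV. row_form U L i / D $ i $ i)"
  proof (intro sum.cong refl arg_cong2[where f="(/)"])
    fix i
    have "(?R ** U ** transpose ?R) $ i $ i = (\<Sum>k\<in>UNIV. \<Sum>j\<in>UNIV. ?R $ i $ j * U $ j $ k * ?R $ i $ k)"
      by (simp add: matrix_matrix_mult_def transpose_def sum_distrib_right)
    also have "\<dots> = row_form U L i"
      unfolding row_form_def inner_vec_def matrix_vector_mult_def
      by (subst sum.swap) (simp add: sum_distrib_left mult_ac)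
    finally show "(?R ** U ** transpose ?R) $ i $ i = row_form U L i" .
  qed
  finally show ?thesis .
qed

lemma pi_tilde_eq:
  assumes "unit_lower L" "pos_diag D"
  shows "pi_tilde U \<alpha> (L, D) =
    exp (- (1/2) * (\<Sum>i\<in>UNIV. row_form U L i / D $ i $ i + \<alpha> $ i * ln (D $ i $ i)))"
  using assms by (simp add: pi_tilde_def trace_cov_inv sum.distrib)

text \<open>\<epsilon> is the minimum of the quadratic form on the unit sphere, attained by
  compactness; homogeneity does the rest.\<close>

lemma pos_def_bounds:
  fixes U :: "'m::finite rmat"
  assumes "pos_def U"
  obtains \<epsilon> where "0 < \<epsilon>" "\<And>x. \<epsilon> * (x \<bullet> x) \<le> x \<bullet> (U *v x)"
proof -
  have ne: "sphere (0::'m rvec) 1 \<noteq> {}" by simp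
  have "continuous_on (sphere 0 1) (\<lambda>x. x \<bullet> (U *v x))"
    by (intro continuous_intros linear_continuous_on linear_linear[THEN iffD2] matrix_vector_mul_linear)
  from continuous_attains_inf[OF compact_sphere ne this] obtain x0
    where x0: "norm x0 = 1" "\<And>y. norm y = 1 \<Longrightarrow> x0 \<bullet> (U *v x0) \<le> y \<bullet> (U *v y)" by auto
  define \<epsilon> where "\<epsilon> = x0 \<bullet> (U *v x0)"
  have "x0 \<noteq> 0" using x0(1) by auto
  then have "0 < \<epsilon>" using assms by (auto simp: \<epsilon>_def pos_def_def)
  moreover have "\<epsilon> * (x \<bullet> x) \<le> x \<bullet> (U *v x)" for x
  proof (cases "x = 0")
    case False
    define y where "y = (1 / norm x) *\<^sub>R x"
    have "norm y = 1" using False by (simp add: y_def)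
    then have "\<epsilon> \<le> y \<bullet> (U *v y)" using x0(2) by (simp add: \<epsilon>_def)
    also have "y \<bullet> (U *v y) = (x \<bullet> (U *v x)) / (x \<bullet> x)"
      by (simp add: y_def matrix_vector_mult_scaleR power2_norm_eq_inner[symmetric] power2_eq_square)
    finally show ?thesis using False by (simp add: field_simps)
  qed simp
  ultimately show thesis by (rule that)
qed

lemma row_form_ge:
  fixes L U :: "'m::{finite,wellorder} rmat"
  assumes "\<And>x. \<epsilon> * (x \<bullet> x) \<le> x \<bullet> (U *v x)"
  shows "\<epsilon> * (\<Sum>j\<in>UNIV. (matrix_inv L $ i $ j)\<^sup>2) \<le> row_form U L i"
  using assms[of "matrix_inv L $ i"] by (simp add: row_form_def inner_vec_def power2_eq_square)

text \<open>The inverse of L has unit diagonal, so each of its rows has norm at least 1. The bound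
  does not depend on L, which later allows different L to be compared.\<close>

lemma row_form_ge':
  fixes L U :: "'m::{finite,wellorder} rmat"
  assumes "unit_lower L" "0 < \<epsilon>" "\<And>x. \<epsilon> * (x \<bullet> x) \<le> x \<bullet> (U *v x)"
  shows "\<epsilon> \<le> row_form U L i"
proof -
  have "1 = (matrix_inv L $ i $ i)\<^sup>2"
    using unit_lower_matrix_inv[OF assms(1)] by (simp add: unit_lower_def)
  also have "\<dots> \<le> (\<Sum>j\<in>UNIV. (matrix_inv L $ i $ j)\<^sup>2)"
    by (rule member_le_sum) auto
  finally have "\<epsilon> * 1 \<le> \<epsilon> * (\<Sum>j\<in>UNIV. (matrix_inv L $ i $ j)\<^sup>2)"
    using assms(2) by (intro mult_left_mono) auto
  with row_form_ge[of \<epsilon> U L i, OF assms(3)] show ?thesis by simp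
qed

text \<open>From \<open>L L\<^sup>-\<^sup>1 = 1\<close>, column \<open>v\<close> of \<open>L\<close> is a combination of column \<open>v\<close> of \<open>L\<^sup>-\<^sup>1\<close> with coefficients
  from the later columns of \<open>L\<close>.\<close>

lemma column_bound:
  fixes L :: "'m::{finite,wellorder} rmat"
  assumes L: "unit_lower L" and u: "u > v"
  shows "(L $ u $ v)\<^sup>2 \<le> (\<Sum>k\<in>{v<..}. (L $ u $ k)\<^sup>2) * (\<Sum>k\<in>UNIV. (matrix_inv L $ k $ v)\<^sup>2)"
proof -
  let ?R = "matrix_inv L"
  have R: "unit_lower ?R" by (rule unit_lower_matrix_inv[OF L])
  have LR: "L ** ?R = mat 1" using unit_lower_det[OF L] by (intro matrix_inv_right) simp
  have "0 = (\<Sum>j\<in>UNIV. L $ u $ j * ?R $ j $ v)"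
    using arg_cong[OF LR, of "\<lambda>A. A $ u $ v"] u by (simp add: matrix_matrix_mult_def mat_def)
  also have "\<dots> = (\<Sum>j\<in>insert v {v<..}. L $ u $ j * ?R $ j $ v)"
    using R by (intro sum.mono_neutral_right) (auto simp: unit_lower_def not_less_iff_gr_or_eq)
  also have "\<dots> = L $ u $ v + (\<Sum>j\<in>{v<..}. L $ u $ j * ?R $ j $ v)"
    using R by (simp add: unit_lower_def)
  finally have "L $ u $ v = - (\<Sum>j\<in>{v<..}. L $ u $ j * ?R $ j $ v)" by simp
  then have "(L $ u $ v)\<^sup>2 = (\<Sum>j\<in>{v<..}. L $ u $ j * ?R $ j $ v)\<^sup>2" by simp
  also have "\<dots> \<le> (\<Sum>k\<in>{v<..}. (L $ u $ k)\<^sup>2) * (\<Sum>k\<in>{v<..}. (?R $ k $ v)\<^sup>2)"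
    by (rule Cauchy_Schwarz_ineq_sum)
  also have "\<dots> \<le> (\<Sum>k\<in>{v<..}. (L $ u $ k)\<^sup>2) * (\<Sum>k\<in>UNIV. (?R $ k $ v)\<^sup>2)"
    by (intro mult_left_mono sum_mono2 sum_nonneg) auto
  finally show ?thesis .
qed

section \<open>The parameter space\<close>

lemma Theta_space_space [simp]: "space (Theta_space E) = ThetaG E"
  by (simp add: Theta_space_def space_restrict_space)

lemma Theta_fst_measurable [measurable]: "(\<lambda>\<theta>. fst \<theta> $ i $ j) \<in> borel_measurable (Theta_space E)"
  and Theta_snd_measurable [measurable]: "(\<lambda>\<theta>. snd \<theta> $ i $ j) \<in> borel_measurable (Theta_space E)"
  unfolding Theta_space_def
  by (intro measurable_restrict_space1 borel_measurable_continuous_onI continuous_intros)+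

lemma measurable_Theta_spaceI:
  assumes "\<And>i j. (\<lambda>x. fst (f x) $ i $ j) \<in> borel_measurable M"
    and "\<And>i j. (\<lambda>x. snd (f x) $ i $ j) \<in> borel_measurable M"
    and "\<And>x. x \<in> space M \<Longrightarrow> f x \<in> ThetaG E"
  shows "f \<in> M \<rightarrow>\<^sub>M Theta_space E"
proof -
  have "(\<lambda>x. (fst (f x), snd (f x))) \<in> borel_measurable M"
    using assms by (intro borel_measurable_Pair borel_measurable_matI)
  then show ?thesis
    using assms(3) unfolding Theta_space_def by (intro measurable_restrict_space2) auto
qed

lemma cov_measurable [measurable]: "(\<lambda>\<theta>. cov \<theta> $ i $ j) \<in> borel_measurable (Theta_space E)"
proof -
  have "(\<lambda>\<theta>. cov \<theta> $ i $ j) = (\<lambda>\<theta>. \<Sum>k\<in>UNIV. (\<Sum>l\<in>UNIV. fst \<theta> $ i $ l * snd \<theta> $ l $ k) * fst \<theta> $ j $ k)"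
    by (simp add: cov_def matrix_matrix_mult_def transpose_def split_beta')
  then show ?thesis by simp
qed

lemma ThetaG_D: "\<theta> \<in> ThetaG E \<Longrightarrow> unit_lower (fst \<theta>) \<and> pos_diag (snd \<theta>)"
  by (auto simp: ThetaG_def LG_def)

lemma ThetaG_det_cov: "\<theta> \<in> ThetaG E \<Longrightarrow> 0 < det (cov \<theta>)"
  using ThetaG_D[of \<theta> E] det_cov_pos[of "fst \<theta>" "snd \<theta>"] by simp

lemma det_cov_measurable [measurable]: "(\<lambda>\<theta>. det (cov \<theta>)) \<in> borel_measurable (Theta_space E)"
  by (rule borel_measurable_det) simp

lemma cov_inv_measurable [measurable]:
  "(\<lambda>\<theta>. matrix_inv (cov \<theta>) $ i $ j) \<in> borel_measurable (Theta_space E)"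
  by (rule borel_measurable_matrix_inv) (auto dest: ThetaG_det_cov)

lemma pi_tilde_measurable:
  assumes W [measurable]: "\<And>i j. (\<lambda>x. W x $ i $ j) \<in> borel_measurable M"
    and T: "T \<in> M \<rightarrow>\<^sub>M Theta_space E"
  shows "(\<lambda>x. pi_tilde (W x) \<alpha> (T x)) \<in> borel_measurable M"
proof -
  note [measurable] = measurable_compose[OF T cov_inv_measurable] measurable_compose[OF T Theta_snd_measurable]
  show ?thesis
    unfolding pi_tilde_def trace_def matrix_matrix_mult_def by simp
qed

lemma pi_tilde_measurable1 [measurable]: "pi_tilde U \<alpha> \<in> borel_measurable (Theta_space E)"
  by (rule pi_tilde_measurable[where W="\<lambda>_. U" and T="\<lambda>x. x" and E=E]) auto

lemma pi_tilde_pos: "0 < pi_tilde U \<alpha> \<theta>"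
  by (simp add: pi_tilde_def)

section \<open>Coordinates\<close>

definition low_idx :: "'m rel \<Rightarrow> ('m::{finite,wellorder} \<times> 'm) set" where
  "low_idx E = {(i, j). (i, j) \<in> E \<and> i > j}"

text \<open>\<open>None\<close> stands for the block D and \<open>Some v\<close> for column v; the
  column of the largest vertex has no entry below the diagonal and is left out.\<close>

definition blocks :: "'m::{finite,wellorder} option set" where
  "blocks = insert None (Some ` (UNIV - {Max UNIV}))"

text \<open>All blocks share the value type \<open>'m => real\<close>, so that one
  \<open>product_gibbs\<close> locale covers both columns and diagonal.\<close>

definition blk :: "'m rel \<Rightarrow> 'm option \<Rightarrow> ('m::{finite,wellorder} \<Rightarrow> real) measure" where
  "blk E i = (case i of None \<Rightarrow> dD | Some v \<Rightarrow> \<Pi>\<^sub>M u\<in>col_idx E v. lborel)"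

definition assemble :: "'m rel \<Rightarrow> ('m option \<Rightarrow> 'm \<Rightarrow> real) \<Rightarrow> 'm::{finite,wellorder} state" where
  "assemble E x = (lower_of E (\<lambda>(i, j). x (Some j) i), diag_of (x None))"

definition coords :: "'m rel \<Rightarrow> 'm::{finite,wellorder} state \<Rightarrow> ('m option \<Rightarrow> 'm \<Rightarrow> real)" where
  "coords E \<theta> = (\<lambda>i\<in>blocks. case i of None \<Rightarrow> (\<lambda>u. snd \<theta> $ u $ u)
     | Some v \<Rightarrow> (\<lambda>u\<in>col_idx E v. fst \<theta> $ u $ v))"

lemma finite_blocks [simp]: "finite (blocks :: 'm::{finite,wellorder} option set)"
  by (simp add: blocks_def)

lemma not_less_Max: "i > j \<Longrightarrow> j \<noteq> Max (UNIV :: 'm::{finite,wellorder} set)"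
  using Max_ge[of "UNIV :: 'm set" i] by (auto simp: not_le)

lemma halfline_sigma_finite: "sigma_finite_measure (restrict_space lborel {0::real<..})"
  by (rule sigma_finite_measure_restrict_space[OF lborel.sigma_finite_measure_axioms]) simp

lemma product_sigma_finite_halfline: "product_sigma_finite (\<lambda>_::'i. restrict_space lborel {0::real<..})"
  using halfline_sigma_finite by (simp add: product_sigma_finite_def)

lemma product_sigma_finite_lborel: "product_sigma_finite (\<lambda>_::'i. lborel :: real measure)"
  by (simp add: product_sigma_finite_def lborel.sigma_finite_measure_axioms)

lemma space_dD: "space dD = {d. \<forall>i. 0 < d i}"
  by (auto simp: dD_def space_PiM space_restrict_space)

lemma dD_component: "(\<lambda>d. d i) \<in> borel_measurable dD"
proof -
  have "(\<lambda>d. d i) \<in> dD \<rightarrow>\<^sub>M restrict_space lborel {0<..}"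
    unfolding dD_def by (rule measurable_component_singleton) simp
  then show ?thesis by (auto simp: measurable_restrict_space2_iff)
qed

lemma measurable_dDI:
  assumes "\<And>i. (\<lambda>x. f x i) \<in> borel_measurable M" "\<And>x i. x \<in> space M \<Longrightarrow> 0 < f x i"
  shows "f \<in> M \<rightarrow>\<^sub>M dD"
proof -
  have "(\<lambda>x. \<lambda>i\<in>UNIV. f x i) \<in> M \<rightarrow>\<^sub>M dD"
    unfolding dD_def using assms by (intro measurable_restrict measurable_restrict_space2) auto
  then show ?thesis by (simp add: restrict_def)
qed

lemma sigma_finite_dD: "sigma_finite_measure dD"
  unfolding dD_def by (rule product_sigma_finite.sigma_finite[OF product_sigma_finite_halfline]) simp

lemma product_sigma_finite_blk: "product_sigma_finite (blk E)"
  unfolding product_sigma_finite_def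
proof
  fix i show "sigma_finite_measure (blk E i)"
    by (cases i) (auto simp: blk_def sigma_finite_dD
        intro: product_sigma_finite.sigma_finite[OF product_sigma_finite_lborel])
qed

interpretation blk: product_sigma_finite "blk E" for E
  by (rule product_sigma_finite_blk)

lemma lower_of_LG: "lower_of E l \<in> LG E"
  by (auto simp: lower_of_def LG_def unit_lower_def)

lemma pos_diag_diag_of: "pos_diag (diag_of d) \<longleftrightarrow> (\<forall>i. 0 < d i)"
  by (auto simp: pos_diag_def diag_of_def)

lemma diag_of_nth [simp]: "diag_of d $ i $ i = d i"
  by (simp add: diag_of_def)

lemma space_blk_PiM:
  assumes "x \<in> space (PiM blocks (blk E))" shows "0 < x None i"
proof -
  have "x None \<in> space (blk E None)"
    using assms by (simp add: space_PiM PiE_iff blocks_def)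
  then show ?thesis by (simp add: blk_def space_dD)
qed

lemma assemble_ThetaG: "x \<in> space (PiM blocks (blk E)) \<Longrightarrow> assemble E x \<in> ThetaG E"
  using space_blk_PiM[of x E] by (simp add: ThetaG_def assemble_def lower_of_LG pos_diag_diag_of)

lemma blk_diag_component: "(\<lambda>x. x None i) \<in> borel_measurable (PiM blocks (blk E))"
proof -
  have "(\<lambda>x. x None) \<in> PiM blocks (blk E) \<rightarrow>\<^sub>M blk E None"
    by (rule measurable_component_singleton) (simp add: blocks_def)
  then have "(\<lambda>x. x None) \<in> PiM blocks (blk E) \<rightarrow>\<^sub>M dD"
    by (simp add: blk_def)
  from measurable_compose[OF this dD_component] show ?thesis .
qed

lemma blk_col_component:
  assumes "v \<noteq> Max UNIV" "u \<in> col_idx E v" and B: "Some v \<in> B"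
  shows "(\<lambda>x. x (Some v) u) \<in> borel_measurable (PiM B (blk E))"
proof -
  have 1: "(\<lambda>x. x (Some v)) \<in> PiM B (blk E) \<rightarrow>\<^sub>M blk E (Some v)"
    using B by (rule measurable_component_singleton)
  have 2: "(\<lambda>y. y u) \<in> blk E (Some v) \<rightarrow>\<^sub>M lborel"
    unfolding blk_def option.case by (rule measurable_component_singleton) (rule assms)
  from measurable_compose[OF 1 2] show ?thesis by simp
qed

lemma assemble_measurable: "assemble E \<in> PiM blocks (blk E) \<rightarrow>\<^sub>M Theta_space E"
proof (rule measurable_Theta_spaceI)
  fix i j :: 'a
  show "(\<lambda>x. fst (assemble E x) $ i $ j) \<in> borel_measurable (PiM blocks (blk E))"
  proof (cases "i > j \<and> (i, j) \<in> E")
    case True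
    then show ?thesis
      using blk_col_component[of j i E blocks] not_less_Max[of j i]
      by (auto simp: assemble_def lower_of_def col_idx_def blocks_def)
  next
    case False
    then have "(\<lambda>x. fst (assemble E x) $ i $ j) = (\<lambda>_. if i = j then 1 else 0)"
      by (auto simp: assemble_def lower_of_def)
    then show ?thesis by simp
  qed
  show "(\<lambda>x. snd (assemble E x) $ i $ j) \<in> borel_measurable (PiM blocks (blk E))"
    using blk_diag_component[of i E] by (cases "i = j") (simp_all add: assemble_def diag_of_def)
qed (rule assemble_ThetaG)

lemma coords_measurable: "coords E \<in> Theta_space E \<rightarrow>\<^sub>M PiM blocks (blk E)"
  unfolding coords_def
proof (rule measurable_restrict)
  fix i :: "'a option" assume "i \<in> blocks"
  show "(\<lambda>\<theta>. case i of None \<Rightarrow> \<lambda>u. snd \<theta> $ u $ u | Some v \<Rightarrow> \<lambda>u\<in>col_idx E v. fst \<theta> $ u $ v)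
      \<in> Theta_space E \<rightarrow>\<^sub>M blk E i"
  proof (cases i)
    case None
    then show ?thesis
      by (auto simp: blk_def intro!: measurable_dDI dest!: ThetaG_D simp: pos_diag_def)
  next
    case (Some v)
    then show ?thesis unfolding blk_def by (auto intro!: measurable_restrict)
  qed
qed

lemma coords_assemble: "x \<in> space (PiM blocks (blk E)) \<Longrightarrow> coords E (assemble E x) = x"
proof (rule ext)
  fix i assume x: "x \<in> space (PiM blocks (blk E))"
  show "coords E (assemble E x) i = x i"
  proof (cases "i \<in> blocks")
    case False
    then show ?thesis using x by (auto simp: coords_def space_PiM PiE_def extensional_def)
  next
    case i: True
    show ?thesis
    proof (cases i)
      case None
      then show ?thesis using i by (auto simp: coords_def assemble_def)
    next
      case (Some v)
      have "x (Some v) \<in> space (blk E (Some v))" using x i Some by (auto simp: space_PiM)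
      then have "x (Some v) \<in> extensional (col_idx E v)" by (auto simp: blk_def space_PiM PiE_def)
      then show ?thesis using i Some
        by (auto simp: coords_def assemble_def lower_of_def col_idx_def extensional_def fun_eq_iff)
    qed
  qed
qed

lemma assemble_coords: "\<theta> \<in> ThetaG E \<Longrightarrow> assemble E (coords E \<theta>) = \<theta>"
proof -
  assume \<theta>: "\<theta> \<in> ThetaG E"
  have "lower_of E (\<lambda>(i, j). coords E \<theta> (Some j) i) = fst \<theta>"
    unfolding vec_eq_iff
  proof (intro allI)
    fix i j
    show "lower_of E (\<lambda>(i, j). coords E \<theta> (Some j) i) $ i $ j = fst \<theta> $ i $ j"
      using \<theta> not_less_Max[of j i]
      by (cases i j rule: linorder_cases)
        (auto simp: lower_of_def coords_def ThetaG_def LG_def unit_lower_def blocks_def col_idx_def)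
  qed
  moreover have "diag_of (coords E \<theta> None) = snd \<theta>"
    using \<theta> by (auto simp: coords_def blocks_def diag_of_def ThetaG_def pos_diag_def vec_eq_iff)
  ultimately show ?thesis by (simp add: assemble_def)
qed

lemma put_col_assemble:
  assumes "v \<noteq> Max UNIV"
  shows "put_col E v (assemble E x) l = assemble E (x(Some v := l))"
  by (auto simp: put_col_def assemble_def lower_of_def col_idx_def vec_eq_iff)

lemma put_diag_assemble: "put_diag (assemble E x) d = assemble E (x(None := d))"
  by (simp add: put_diag_def assemble_def)

section \<open>The reference measure in coordinates\<close>

definition cols :: "'m::{finite,wellorder} option set" where
  "cols = Some ` (UNIV - {Max UNIV})"

lemma blocks_eq: "blocks = insert None cols" and None_notin_cols: "None \<notin> cols" and finite_cols [simp]: "finite cols"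
  by (auto simp: blocks_def cols_def)

text \<open>Regroups the columns into a single vector indexed by edges, the form in which
  \<open>dLdD\<close> is defined.\<close>

definition flat :: "'m rel \<Rightarrow> ('m option \<Rightarrow> 'm \<Rightarrow> real) \<Rightarrow> ('m::{finite,wellorder} \<times> 'm \<Rightarrow> real)" where
  "flat E x = (\<lambda>(i, j)\<in>low_idx E. x (Some j) i)"

lemma flat_measurable:
  assumes "cols \<subseteq> B"
  shows "flat E \<in> PiM B (blk E) \<rightarrow>\<^sub>M (\<Pi>\<^sub>M p\<in>low_idx E. lborel)"
  unfolding flat_def
proof (rule measurable_restrict)
  fix p assume p: "p \<in> low_idx E"
  then have "(\<lambda>x. x (Some (snd p)) (fst p)) \<in> borel_measurable (PiM B (blk E))"
    using assms not_less_Max[of "snd p" "fst p"]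
    by (intro blk_col_component) (auto simp: low_idx_def col_idx_def cols_def)
  then show "(\<lambda>x. case p of (i, j) \<Rightarrow> x (Some j) i) \<in> PiM B (blk E) \<rightarrow>\<^sub>M lborel"
    by (simp add: split_beta')
qed

lemma low_idx_Sigma:
  "low_idx E = prod.swap ` (SIGMA v:UNIV - {Max UNIV}. col_idx E v)"
  using not_less_Max by (force simp: low_idx_def col_idx_def)

text \<open>A product measure is determined by its boxes. The preimage of a box of edges is a box of
  column boxes, and the double product over columns and their entries is the product over
  \<open>low_idx\<close>.\<close>

lemma distr_flat: "distr (PiM cols (blk E)) (\<Pi>\<^sub>M p\<in>low_idx E. lborel) (flat E) = (\<Pi>\<^sub>M p\<in>low_idx E. lborel)"
proof (rule product_sigma_finite.PiM_eqI[OF product_sigma_finite_lborel])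
  show "finite (low_idx E)" by simp
  fix A :: "_ \<Rightarrow> real set" assume A: "\<And>p. p \<in> low_idx E \<Longrightarrow> A p \<in> sets lborel"
  \<comment> \<open>The sides of the box A that belong to column \<open>the i\<close>, collected
    into a box of that block.\<close>
  define C where "C i = (\<Pi>\<^sub>E u\<in>col_idx E (the i). A (u, the i))" for i
  have Cm: "C i \<in> sets (blk E i)" if "i \<in> cols" for i
    using that A unfolding C_def cols_def blk_def
    by (auto intro!: sets_PiM_I_finite simp: low_idx_def col_idx_def)
  have "flat E -` Pi\<^sub>E (low_idx E) A \<inter> space (PiM cols (blk E)) = Pi\<^sub>E cols C"
  proof (intro set_eqI iffI)
    fix x assume "x \<in> flat E -` Pi\<^sub>E (low_idx E) A \<inter> space (PiM cols (blk E))"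
    then have x: "x \<in> space (PiM cols (blk E))" and f: "flat E x \<in> Pi\<^sub>E (low_idx E) A" by auto
    have "x (Some v) \<in> C (Some v)" if v: "v \<noteq> Max UNIV" for v
    proof -
      have "x (Some v) \<in> space (blk E (Some v))" using x v by (simp add: space_PiM PiE_iff cols_def)
      then have "x (Some v) \<in> extensional (col_idx E v)" by (simp add: blk_def space_PiM PiE_iff)
      moreover have "x (Some v) u \<in> A (u, v)" if "u \<in> col_idx E v" for u
      proof -
        have p: "(u, v) \<in> low_idx E" using that by (simp add: low_idx_def col_idx_def)
        from PiE_mem[OF f p] show ?thesis by (simp add: flat_def p)
      qed
      ultimately show ?thesis by (simp add: C_def PiE_iff)
    qed
    moreover have "x \<in> extensional cols" using x by (simp add: space_PiM PiE_iff)
    ultimately show "x \<in> Pi\<^sub>E cols C" unfolding PiE_iff cols_def by blast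
  next
    fix x assume x: "x \<in> Pi\<^sub>E cols C"
    have "x i \<in> space (blk E i)" if "i \<in> cols" for i
      using PiE_mem[OF x that] sets.sets_into_space[OF Cm[OF that]] by blast
    then have "x \<in> space (PiM cols (blk E))"
      using x by (simp add: space_PiM PiE_iff)
    moreover have "x (Some j) i \<in> A (i, j)" if p: "(i, j) \<in> low_idx E" for i j
    proof -
      have "i > j" "i \<in> col_idx E j" using p by (auto simp: low_idx_def col_idx_def)
      then have "x (Some j) \<in> C (Some j)"
        using not_less_Max[of j i] by (intro PiE_mem[OF x]) (simp add: cols_def)
      then show ?thesis using \<open>i \<in> col_idx E j\<close> by (simp add: C_def PiE_iff)
    qed
    then have "flat E x \<in> Pi\<^sub>E (low_idx E) A" by (auto simp: flat_def)
    ultimately show "x \<in> flat E -` Pi\<^sub>E (low_idx E) A \<inter> space (PiM cols (blk E))" by simp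
  qed
  then have "emeasure (distr (PiM cols (blk E)) (\<Pi>\<^sub>M p\<in>low_idx E. lborel) (flat E)) (Pi\<^sub>E (low_idx E) A) =
      emeasure (PiM cols (blk E)) (Pi\<^sub>E cols C)"
    using A by (subst emeasure_distr[OF flat_measurable]) (auto intro!: sets_PiM_I_finite)
  also have "\<dots> = (\<Prod>i\<in>cols. emeasure (blk E i) (C i))"
    by (rule blk.emeasure_PiM) (auto simp: Cm)
  also have "\<dots> = (\<Prod>v\<in>UNIV - {Max UNIV}. emeasure (blk E (Some v)) (C (Some v)))"
    unfolding cols_def by (subst prod.reindex) auto
  also have "\<dots> = (\<Prod>v\<in>UNIV - {Max UNIV}. \<Prod>u\<in>col_idx E v. emeasure lborel (A (u, v)))"
  proof (rule prod.cong[OF refl])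
    fix v
    show "emeasure (blk E (Some v)) (C (Some v)) = (\<Prod>u\<in>col_idx E v. emeasure lborel (A (u, v)))"
      unfolding blk_def C_def option.case option.sel
      using A by (intro product_sigma_finite.emeasure_PiM[OF product_sigma_finite_lborel])
        (auto simp: low_idx_def col_idx_def)
  qed
  also have "\<dots> = (\<Prod>p\<in>low_idx E. emeasure lborel (A p))"
    unfolding low_idx_Sigma by (subst prod.reindex) (auto simp: prod.Sigma split_beta' intro!: prod.cong)
  finally show "emeasure (distr (PiM cols (blk E)) (\<Pi>\<^sub>M p\<in>low_idx E. lborel) (flat E)) (Pi\<^sub>E (low_idx E) A) =
      (\<Prod>p\<in>low_idx E. emeasure lborel (A p))" .
qed simp

text \<open>On rectangles: \<open>flat\<close> ignores the coordinate \<open>None\<close>, so the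
  integral over the diagonal block factors out and \<open>distr_flat\<close> handles the
  columns.\<close>

lemma pair_flat:
  "(\<Pi>\<^sub>M p\<in>low_idx E. lborel) \<Otimes>\<^sub>M dD =
    distr (PiM blocks (blk E)) ((\<Pi>\<^sub>M p\<in>low_idx E. lborel) \<Otimes>\<^sub>M dD) (\<lambda>x. (flat E x, x None))"
proof (rule pair_measure_eqI)
  show "sigma_finite_measure (\<Pi>\<^sub>M p\<in>low_idx E. lborel :: real measure)"
    by (rule product_sigma_finite.sigma_finite[OF product_sigma_finite_lborel]) simp
  show "sigma_finite_measure dD" by (rule sigma_finite_dD)
  fix A B assume A [measurable]: "A \<in> sets (\<Pi>\<^sub>M p\<in>low_idx E. lborel :: real measure)"
    and B [measurable]: "B \<in> sets (dD :: ('a \<Rightarrow> real) measure)"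
  have N: "(\<lambda>x. x None) \<in> PiM blocks (blk E) \<rightarrow>\<^sub>M dD"
    using measurable_component_singleton[of None blocks "blk E"] by (simp add: blocks_def blk_def)
  have F: "flat E \<in> PiM blocks (blk E) \<rightarrow>\<^sub>M (\<Pi>\<^sub>M p\<in>low_idx E. lborel)"
    by (rule flat_measurable) (auto simp: blocks_eq)
  note [measurable] = N F flat_measurable[OF subset_refl]
  have "emeasure (distr (PiM blocks (blk E)) ((\<Pi>\<^sub>M p\<in>low_idx E. lborel) \<Otimes>\<^sub>M dD) (\<lambda>x. (flat E x, x None))) (A \<times> B)
      = (\<integral>\<^sup>+z. indicator (A \<times> B) z \<partial>distr (PiM blocks (blk E)) ((\<Pi>\<^sub>M p\<in>low_idx E. lborel) \<Otimes>\<^sub>M dD) (\<lambda>x. (flat E x, x None)))"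
    by (rule nn_integral_indicator[symmetric]) simp
  also have "\<dots> = (\<integral>\<^sup>+x. indicator A (flat E x) * indicator B (x None) \<partial>PiM blocks (blk E))"
    by (subst nn_integral_distr) (auto simp: indicator_times)
  also have "\<dots> = (\<integral>\<^sup>+x. \<integral>\<^sup>+d. indicator A (flat E (x(None := d))) * indicator B ((x(None := d)) None) \<partial>blk E None \<partial>PiM cols (blk E))"
    unfolding blocks_eq
    by (rule blk.product_nn_integral_insert[OF finite_cols None_notin_cols]) (simp add: blocks_eq[symmetric])
  also have "\<dots> = (\<integral>\<^sup>+x. indicator A (flat E x) * emeasure dD B \<partial>PiM cols (blk E))"
  proof -
    have "flat E (x(None := d)) = flat E x" for x d by (simp add: flat_def)
    then show ?thesis by (simp add: blk_def nn_integral_cmult)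
  qed
  also have "\<dots> = (\<integral>\<^sup>+x. indicator A (flat E x) \<partial>PiM cols (blk E)) * emeasure dD B"
    by (rule nn_integral_multc) simp
  also have "(\<integral>\<^sup>+x. indicator A (flat E x) \<partial>PiM cols (blk E)) =
      (\<integral>\<^sup>+y. indicator A y \<partial>distr (PiM cols (blk E)) (\<Pi>\<^sub>M p\<in>low_idx E. lborel) (flat E))"
    by (subst nn_integral_distr) auto
  also have "\<dots> = emeasure (\<Pi>\<^sub>M p\<in>low_idx E. lborel) A"
    by (simp add: distr_flat)
  finally show "emeasure (\<Pi>\<^sub>M p\<in>low_idx E. lborel) A * emeasure dD B =
    emeasure (distr (PiM blocks (blk E)) ((\<Pi>\<^sub>M p\<in>low_idx E. lborel) \<Otimes>\<^sub>M dD) (\<lambda>x. (flat E x, x None))) (A \<times> B)" ..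
qed simp

lemma lower_diag_measurable:
  fixes E :: "'m::{finite,wellorder} rel"
  shows "(\<lambda>(l, d). (lower_of E l, diag_of d)) \<in> (\<Pi>\<^sub>M p\<in>low_idx E. lborel) \<Otimes>\<^sub>M dD \<rightarrow>\<^sub>M Theta_space E"
proof (rule measurable_Theta_spaceI)
  fix i j :: 'm
  let ?P = "(\<Pi>\<^sub>M p\<in>low_idx E. lborel) \<Otimes>\<^sub>M (dD :: ('m \<Rightarrow> real) measure)"
  show "(\<lambda>x. fst (case x of (l, d) \<Rightarrow> (lower_of E l, diag_of d)) $ i $ j) \<in> borel_measurable ?P"
  proof (cases "i > j \<and> (i, j) \<in> E")
    case True
    then have "(\<lambda>x. fst x (i, j)) \<in> ?P \<rightarrow>\<^sub>M lborel"
      by (intro measurable_compose[OF measurable_fst measurable_component_singleton]) (simp add: low_idx_def)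
    then have m: "(\<lambda>x. fst x (i, j)) \<in> borel_measurable ?P" by simp
    have eq: "(\<lambda>x :: _ \<times> ('m \<Rightarrow> real). fst (case x of (l, d) \<Rightarrow> (lower_of E l, diag_of d)) $ i $ j) = (\<lambda>x. fst x (i, j))"
      using True by (auto simp: lower_of_def split_beta')
    show ?thesis unfolding eq by (rule m)
  next
    case False
    then have "(\<lambda>x :: _ \<times> ('m \<Rightarrow> real). fst (case x of (l, d) \<Rightarrow> (lower_of E l, diag_of d)) $ i $ j) = (\<lambda>_. if i = j then 1 else 0)"
      by (auto simp: lower_of_def split_beta')
    then show ?thesis by simp
  qed
  show "(\<lambda>x. snd (case x of (l, d) \<Rightarrow> (lower_of E l, diag_of d)) $ i $ j) \<in> borel_measurable ?P"
  proof (cases "i = j")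
    case True
    have "(\<lambda>x. snd x i) \<in> borel_measurable ?P"
      by (rule measurable_compose[OF measurable_snd dD_component])
    then show ?thesis using True by (simp add: diag_of_def split_beta')
  qed (simp add: diag_of_def split_beta')
qed (auto simp: ThetaG_def lower_of_LG pos_diag_diag_of space_pair_measure space_dD)

text \<open>From here on integrals over the parameter space can be computed on the product of
  blocks.\<close>

theorem dLdD_coords: "dLdD E = distr (PiM blocks (blk E)) (Theta_space E) (assemble E)"
proof -
  have F: "flat E \<in> PiM blocks (blk E) \<rightarrow>\<^sub>M (\<Pi>\<^sub>M p\<in>low_idx E. lborel)"
    by (rule flat_measurable) (auto simp: blocks_eq)
  have N: "(\<lambda>x. x None) \<in> PiM blocks (blk E) \<rightarrow>\<^sub>M dD"
    using measurable_component_singleton[of None blocks "blk E"] by (simp add: blocks_def blk_def)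
  have l: "lower_of E (flat E x) = lower_of E (\<lambda>(i, j). x (Some j) i)" for x
    by (auto simp: lower_of_def flat_def low_idx_def vec_eq_iff)
  have "dLdD E = distr ((\<Pi>\<^sub>M p\<in>low_idx E. lborel) \<Otimes>\<^sub>M dD) (Theta_space E) (\<lambda>(l, d). (lower_of E l, diag_of d))"
    by (simp add: dLdD_def low_idx_def)
  also have "\<dots> = distr (PiM blocks (blk E)) (Theta_space E)
      ((\<lambda>(l, d). (lower_of E l, diag_of d)) \<circ> (\<lambda>x. (flat E x, x None)))"
    by (subst pair_flat, rule distr_distr[OF lower_diag_measurable measurable_Pair[OF F N]])
  also have "\<dots> = distr (PiM blocks (blk E)) (Theta_space E) (assemble E)"
    by (simp add: comp_def assemble_def[abs_def] l)
  finally show ?thesis .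
qed

section \<open>Integrability\<close>

lemma distr_halfline_scale:
  assumes c: "0 < c" and A: "A \<in> sets (restrict_space lborel {0::real<..})"
  shows "emeasure (restrict_space lborel {0<..}) {d\<in>{0<..}. c * d \<in> A} =
    ennreal (1 / c) * emeasure (restrict_space lborel {0<..}) A"
proof -
  have A': "A \<in> sets borel" "A \<subseteq> {0<..}" using A by (auto simp: sets_restrict_space)
  \<comment> \<open>The summand 0 matches the affine form of the substitution rule
    \<open>nn_integral_real_affine\<close>.\<close>
  have eq: "{d\<in>{0<..}. c * d \<in> A} = (\<lambda>d. 0 + c * d) -` A"
    using A'(2) c by (auto simp: zero_less_mult_iff)
  have m: "(\<lambda>d. 0 + c * d) -` A \<in> sets borel"
    using measurable_sets[of "\<lambda>d. 0 + c * d" borel borel A] A'(1) by simp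
  have sub: "(\<lambda>d. 0 + c * d) -` A \<subseteq> {0<..}" using A'(2) c by (auto simp: zero_less_mult_iff)
  have "emeasure lborel A = (\<integral>\<^sup>+x. indicator A x \<partial>lborel)" using A' by simp
  also have "\<dots> = ennreal c * (\<integral>\<^sup>+x. indicator A (0 + c * x) \<partial>lborel)"
    using nn_integral_real_affine[of "indicator A" c 0] A' c by simp
  also have "(\<integral>\<^sup>+x. indicator A (0 + c * x) \<partial>lborel) = (\<integral>\<^sup>+x. indicator ((\<lambda>d. 0 + c * d) -` A) x \<partial>lborel)"
    by (intro nn_integral_cong) (auto split: split_indicator)
  also have "\<dots> = emeasure lborel ((\<lambda>d. 0 + c * d) -` A)" using m by simp
  finally have "ennreal (1 / c) * emeasure lborel A = emeasure lborel ((\<lambda>d. 0 + c * d) -` A)"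
    using c by (simp add: mult.assoc[symmetric] ennreal_mult[symmetric])
  then show ?thesis
    unfolding eq using A' sub by (simp add: emeasure_restrict_space)
qed

text \<open>The image of \<open>dD\<close> under dilation by c, multiplied by c^m, agrees with
  \<open>dD\<close> on boxes and hence equals it.\<close>

lemma nn_integral_dD_scale:
  fixes g :: "('m::finite \<Rightarrow> real) \<Rightarrow> ennreal"
  assumes c: "0 < c" and g: "g \<in> borel_measurable dD"
  shows "(\<integral>\<^sup>+d. g d \<partial>dD) = ennreal (c ^ CARD('m)) * (\<integral>\<^sup>+d. g (\<lambda>i. c * d i) \<partial>dD)"
proof -
  let ?H = "restrict_space lborel {0::real<..}"
  have S: "(\<lambda>d i. c * d i) \<in> dD \<rightarrow>\<^sub>M (dD :: ('m \<Rightarrow> real) measure)"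
    using c by (intro measurable_dDI borel_measurable_times borel_measurable_const dD_component) (auto simp: space_dD)
  have "scale_measure (ennreal (c ^ CARD('m))) (distr dD dD (\<lambda>d i. c * d i)) = (\<Pi>\<^sub>M i\<in>(UNIV::'m set). ?H)"
  proof (rule product_sigma_finite.PiM_eqI[OF product_sigma_finite_halfline])
    show "sets (scale_measure (ennreal (c ^ CARD('m))) (distr dD dD (\<lambda>d i. c * d i))) = sets (\<Pi>\<^sub>M i\<in>(UNIV::'m set). ?H)"
      by (simp add: dD_def)
    fix A :: "'m \<Rightarrow> real set" assume A: "\<And>i. i \<in> UNIV \<Longrightarrow> A i \<in> sets ?H"
    have AD: "Pi\<^sub>E UNIV A \<in> sets dD" unfolding dD_def using A by (intro sets_PiM_I_finite) auto
    have "(\<lambda>d i. c * d i) -` Pi\<^sub>E UNIV A \<inter> space dD = Pi\<^sub>E UNIV (\<lambda>i. {d\<in>{0<..}. c * d \<in> A i})"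
      by (auto simp: space_dD PiE_iff)
    then have "emeasure (distr dD dD (\<lambda>d i. c * d i)) (Pi\<^sub>E UNIV A) =
        emeasure dD (Pi\<^sub>E UNIV (\<lambda>i. {d\<in>{0<..}. c * d \<in> A i}))"
      by (simp add: emeasure_distr[OF S AD])
    also have "\<dots> = (\<Prod>i\<in>UNIV. emeasure ?H {d\<in>{0<..}. c * d \<in> A i})"
      unfolding dD_def
    proof (rule product_sigma_finite.emeasure_PiM[OF product_sigma_finite_halfline])
      fix i
      have "(\<lambda>d. c * d) \<in> ?H \<rightarrow>\<^sub>M ?H"
        using c by (intro measurable_restrict_space3) auto
      from measurable_sets[OF this A[of i]] show "{d\<in>{0<..}. c * d \<in> A i} \<in> sets ?H"
        by (simp add: vimage_def Int_def conj_commute space_restrict_space)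
    qed simp
    also have "\<dots> = (\<Prod>i\<in>UNIV. ennreal (1 / c) * emeasure ?H (A i))"
      using A by (intro prod.cong refl distr_halfline_scale[OF c]) auto
    also have "\<dots> = ennreal ((1 / c) ^ CARD('m)) * (\<Prod>i\<in>UNIV. emeasure ?H (A i))"
      using c by (simp add: prod.distrib ennreal_power)
    finally show "emeasure (scale_measure (ennreal (c ^ CARD('m))) (distr dD dD (\<lambda>d i. c * d i))) (Pi\<^sub>E UNIV A) =
        (\<Prod>i\<in>UNIV. emeasure ?H (A i))"
      using c by (simp add: mult.assoc[symmetric] ennreal_mult[symmetric] power_mult_distrib[symmetric])
  qed simp
  then have "(\<integral>\<^sup>+d. g d \<partial>dD) = (\<integral>\<^sup>+d. g d \<partial>scale_measure (ennreal (c ^ CARD('m))) (distr dD dD (\<lambda>d i. c * d i)))"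
    by (simp add: dD_def)
  also have "\<dots> = ennreal (c ^ CARD('m)) * (\<integral>\<^sup>+d. g (\<lambda>i. c * d i) \<partial>dD)"
    using g by (simp add: nn_integral_scale_measure nn_integral_distr[OF S])
  finally show ?thesis .
qed

text \<open>The unnormalised marginal density of L, with D integrated out.\<close>

definition diag_int :: "'m rmat \<Rightarrow> 'm rvec \<Rightarrow> 'm::{finite,wellorder} rmat \<Rightarrow> ennreal" where
  "diag_int U \<alpha> L = (\<integral>\<^sup>+d. ennreal (pi_tilde U \<alpha> (L, diag_of d)) \<partial>dD)"

lemma diag_measurable: "L \<in> LG E \<Longrightarrow> (\<lambda>d. (L, diag_of d)) \<in> dD \<rightarrow>\<^sub>M Theta_space E"
proof (rule measurable_Theta_spaceI)
  fix i j :: 'a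
  show "(\<lambda>x. snd (L, diag_of x) $ i $ j) \<in> borel_measurable dD"
    using dD_component[of i] by (cases "i = j") (simp_all add: diag_of_def)
qed (auto simp: ThetaG_def pos_diag_diag_of space_dD)

lemma pi_tilde_diag_measurable:
  "L \<in> LG E \<Longrightarrow> (\<lambda>d. ennreal (pi_tilde U \<alpha> (L, diag_of d))) \<in> borel_measurable dD"
  by (rule measurable_compose[OF _ measurable_ennreal],
      rule measurable_compose[OF diag_measurable pi_tilde_measurable1])

lemma row_form_scale: "row_form (c *\<^sub>R U) L i = c * row_form U L i"
  by (simp add: row_form_def scaleR_matrix_vector_assoc[symmetric])

lemma pi_tilde_diag:
  assumes "L \<in> LG E" "d \<in> space dD"
  shows "pi_tilde U \<alpha> (L, diag_of d) = exp (- (1/2) * (\<Sum>i\<in>UNIV. row_form U L i / d i + \<alpha> $ i * ln (d i)))"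
  using assms by (subst pi_tilde_eq) (auto simp: LG_def pos_diag_diag_of space_dD)

text \<open>The quotients of row forms by diagonal entries are unchanged when U and D are both
  multiplied by c; only the Jacobian and the constant from the logarithms remain.\<close>

lemma diag_int_scale:
  assumes L: "L \<in> LG E" and c: "0 < c"
  shows "diag_int (c *\<^sub>R U) \<alpha> L =
    ennreal (c ^ CARD('m) * exp (- (1/2) * (\<Sum>i\<in>UNIV. \<alpha> $ i * ln c))) * diag_int U \<alpha> (L :: 'm::{finite,wellorder} rmat)"
proof -
  let ?k = "exp (- (1/2) * (\<Sum>i\<in>UNIV. \<alpha> $ i * ln c))"
  have *: "pi_tilde (c *\<^sub>R U) \<alpha> (L, diag_of (\<lambda>i. c * d i)) = ?k * pi_tilde U \<alpha> (L, diag_of d)"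
    if d: "d \<in> space dD" for d
  proof -
    have cd: "(\<lambda>i. c * d i) \<in> space dD" using d c by (simp add: space_dD)
    have "row_form (c *\<^sub>R U) L i / (c * d i) + \<alpha> $ i * ln (c * d i) =
        \<alpha> $ i * ln c + (row_form U L i / d i + \<alpha> $ i * ln (d i))" for i
    proof -
      have "0 < d i" using d by (simp add: space_dD)
      then show ?thesis using c by (simp add: row_form_scale ln_mult algebra_simps)
    qed
    then show ?thesis
      unfolding pi_tilde_diag[OF L d] pi_tilde_diag[OF L cd]
      by (simp add: sum.distrib exp_add[symmetric] algebra_simps)
  qed
  have "diag_int (c *\<^sub>R U) \<alpha> L =
      ennreal (c ^ CARD('m)) * (\<integral>\<^sup>+d. ennreal (pi_tilde (c *\<^sub>R U) \<alpha> (L, diag_of (\<lambda>i. c * d i))) \<partial>dD)"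
    unfolding diag_int_def by (rule nn_integral_dD_scale[OF c pi_tilde_diag_measurable[OF L]])
  also have "(\<integral>\<^sup>+d. ennreal (pi_tilde (c *\<^sub>R U) \<alpha> (L, diag_of (\<lambda>i. c * d i))) \<partial>dD) =
      (\<integral>\<^sup>+d. ennreal ?k * ennreal (pi_tilde U \<alpha> (L, diag_of d)) \<partial>dD)"
    by (intro nn_integral_cong) (simp add: * ennreal_mult[symmetric] pi_tilde_pos less_imp_le)
  also have "\<dots> = ennreal ?k * diag_int U \<alpha> L"
    unfolding diag_int_def by (rule nn_integral_cmult[OF pi_tilde_diag_measurable[OF L]])
  finally show ?thesis using c by (simp add: mult.assoc[symmetric] ennreal_mult[symmetric])
qed

lemma zG_diag_int:
  "zG E U \<alpha> = (\<integral>\<^sup>+l. diag_int U \<alpha> (lower_of E l) \<partial>(\<Pi>\<^sub>M p\<in>low_idx E. lborel))"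
proof -
  have "zG E U \<alpha> = (\<integral>\<^sup>+x. ennreal (pi_tilde U \<alpha> (lower_of E (fst x), diag_of (snd x))) \<partial>((\<Pi>\<^sub>M p\<in>low_idx E. lborel) \<Otimes>\<^sub>M dD))"
    unfolding zG_def dLdD_def low_idx_def[symmetric]
    by (subst nn_integral_distr[OF lower_diag_measurable]) (auto simp: split_beta')
  also have "\<dots> = (\<integral>\<^sup>+l. diag_int U \<alpha> (lower_of E l) \<partial>(\<Pi>\<^sub>M p\<in>low_idx E. lborel))"
    unfolding diag_int_def
    using measurable_compose[OF lower_diag_measurable[of E] pi_tilde_measurable1[of U \<alpha> E]]
    by (subst sigma_finite_measure.nn_integral_fst[OF sigma_finite_dD, symmetric]) (auto simp: split_beta')
  finally show ?thesis .
qed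

lemma diag_int_measurable:
  "(\<lambda>l. diag_int U \<alpha> (lower_of E l)) \<in> borel_measurable (\<Pi>\<^sub>M p\<in>low_idx E. lborel)"
  unfolding diag_int_def
  using measurable_compose[OF lower_diag_measurable[of E] pi_tilde_measurable1[of U \<alpha> E]]
  by (intro sigma_finite_measure.borel_measurable_nn_integral[OF sigma_finite_dD]) (simp add: split_beta')

lemma zG_scale_finite:
  assumes "zG E U \<alpha> < \<infinity>" "0 < c" shows "zG E (c *\<^sub>R U) \<alpha> < \<infinity>"
  using assms unfolding zG_diag_int
  by (subst nn_integral_cong[OF diag_int_scale[OF lower_of_LG assms(2)]])
    (simp add: nn_integral_cmult[OF diag_int_measurable] ennreal_mult_less_top)

lemma emeasure_PiM_lborel_nonzero:
  "finite I \<Longrightarrow> emeasure (\<Pi>\<^sub>M i\<in>I. lborel :: real measure) (space (\<Pi>\<^sub>M i\<in>I. lborel)) \<noteq> 0"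
  using product_sigma_finite.emeasure_PiM[OF product_sigma_finite_lborel, of I "\<lambda>_. UNIV"]
  by (simp add: space_PiM)

lemma emeasure_dD_nonzero: "emeasure dD (space dD) \<noteq> 0"
proof -
  have "emeasure lborel {0<..1::real} \<le> emeasure lborel {0::real<..}"
    by (rule emeasure_mono) auto
  then have "emeasure (restrict_space lborel {0::real<..}) {0<..} \<noteq> 0"
    by (auto simp: emeasure_restrict_space)
  then show ?thesis
    unfolding dD_def space_PiM
    by (subst product_sigma_finite.emeasure_PiM[OF product_sigma_finite_halfline])
      (auto simp: space_restrict_space sets_restrict_space_iff)
qed

text \<open>Fubini gives finiteness at some L0. The row forms at L are bounded below and those at L0
  above, so shrinking U by a suitable c makes the integrand at L0 dominate the one at L;
  \<open>diag_int_scale\<close> then removes c.\<close>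

lemma diag_int_finite:
  fixes L :: "'m::{finite,wellorder} rmat"
  assumes U: "pos_def U" and z: "zG E U \<alpha> < \<infinity>" and L: "L \<in> LG E"
  shows "diag_int U \<alpha> L < \<infinity>"
proof -
  \<comment> \<open>A finite integral forces finite values almost everywhere, and since the
    reference measure is not null at least one good l exists.\<close>
  have "AE l in (\<Pi>\<^sub>M p\<in>low_idx E. lborel). diag_int U \<alpha> (lower_of E l) \<noteq> \<infinity>"
    using z unfolding zG_diag_int by (intro nn_integral_PInf_AE diag_int_measurable) auto
  moreover have "\<not> (AE l in (\<Pi>\<^sub>M p\<in>low_idx E. lborel :: real measure). False)"
    using emeasure_PiM_lborel_nonzero[of "low_idx E"] by (simp add: eventually_False ae_filter_eq_bot_iff)
  ultimately obtain l where fin: "diag_int U \<alpha> (lower_of E l) < \<infinity>"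
    by (metis (mono_tags, lifting) eventually_mono less_top infinity_ennreal_def)
  define L0 where "L0 = lower_of E l"
  have L0: "L0 \<in> LG E" by (simp add: L0_def lower_of_LG)
  from pos_def_bounds[OF U] obtain \<epsilon> where \<epsilon>: "0 < \<epsilon>" "\<And>x. \<epsilon> * (x \<bullet> x) \<le> x \<bullet> (U *v x)" by blast
  have pos: "\<epsilon> \<le> row_form U L' i" if "L' \<in> LG E" for L' i
    using that \<epsilon> by (intro row_form_ge') (auto simp: LG_def)
  define m where "m = (\<Sum>i\<in>UNIV. row_form U L0 i)"
  have m: "row_form U L0 i \<le> m" for i
    unfolding m_def using pos[OF L0] \<epsilon> by (intro member_le_sum) (auto intro: order_trans less_imp_le)
  have m0: "0 < m" using m[of undefined] pos[OF L0, of undefined] \<epsilon> by linarith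
  \<comment> \<open>Row forms at L0 are at most m and those at L at least \<epsilon>, so this ratio
    brings the former below the latter.\<close>
  define c where "c = \<epsilon> / m"
  have c: "0 < c" using m0 \<epsilon> by (simp add: c_def)
  have le: "row_form (c *\<^sub>R U) L0 i \<le> row_form U L i" for i
  proof -
    have "c * row_form U L0 i \<le> c * m" using m[of i] c by (intro mult_left_mono) auto
    also have "\<dots> = \<epsilon>" using m0 by (simp add: c_def)
    also have "\<dots> \<le> row_form U L i" by (rule pos[OF L])
    finally show ?thesis by (simp add: row_form_scale)
  qed
  have "diag_int U \<alpha> L \<le> diag_int (c *\<^sub>R U) \<alpha> L0"
    unfolding diag_int_def
  proof (intro nn_integral_mono ennreal_leI)
    fix d :: "'m \<Rightarrow> real" assume d: "d \<in> space dD"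
    then show "pi_tilde U \<alpha> (L, diag_of d) \<le> pi_tilde (c *\<^sub>R U) \<alpha> (L0, diag_of d)"
      unfolding pi_tilde_diag[OF L d] pi_tilde_diag[OF L0 d]
      using le by (auto intro!: sum_mono divide_right_mono simp: space_dD less_imp_le)
  qed
  also have "\<dots> < \<infinity>"
    using fin by (simp add: diag_int_scale[OF L0 c] L0_def[symmetric] ennreal_mult_less_top)
  finally show ?thesis .
qed

section \<open>Gaussian tails in a column block\<close>

lemma nn_integral_gaussian_finite:
  assumes c: "0 < c" shows "(\<integral>\<^sup>+x. ennreal (exp (- c * x\<^sup>2)) \<partial>lborel) < \<infinity>"
proof -
  \<comment> \<open>The standard deviation for which the normal density has exponent - c
    x^2.\<close>
  define s where "s = sqrt (1 / (2 * c))"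
  have s: "0 < s" "2 * s\<^sup>2 = 1 / c" using c by (auto simp: s_def)
  have "integrable lborel (\<lambda>x. sqrt (2 * pi * s\<^sup>2) * normal_density 0 s x)"
    using integrable_normal_density[OF s(1), of 0] by simp
  also have "(\<lambda>x. sqrt (2 * pi * s\<^sup>2) * normal_density 0 s x) = (\<lambda>x. exp (- c * x\<^sup>2))"
    using s by (simp add: normal_density_def fun_eq_iff)
  finally have "integrable lborel (\<lambda>x. exp (- c * x\<^sup>2))" .
  then have "(\<integral>\<^sup>+x. ennreal (norm (exp (- c * x\<^sup>2))) \<partial>lborel) < \<infinity>"
    unfolding integrable_iff_bounded by blast
  then show ?thesis by simp
qed

lemma nn_integral_gaussian_prod_finite:
  assumes c: "0 < c" and I: "finite I"
  shows "(\<integral>\<^sup>+x. ennreal (exp (- c * (\<Sum>u\<in>I. (x u)\<^sup>2))) \<partial>(\<Pi>\<^sub>M u\<in>I. lborel)) < \<infinity>"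
proof -
  have "(\<integral>\<^sup>+x. ennreal (exp (- c * (\<Sum>u\<in>I. (x u)\<^sup>2))) \<partial>(\<Pi>\<^sub>M u\<in>I. lborel)) =
      (\<integral>\<^sup>+x. (\<Prod>u\<in>I. ennreal (exp (- c * (x u)\<^sup>2))) \<partial>(\<Pi>\<^sub>M u\<in>I. lborel))"
    using I by (simp add: sum_distrib_left exp_sum prod_ennreal flip: sum_negf)
  also have "\<dots> = (\<Prod>u\<in>I. \<integral>\<^sup>+x. ennreal (exp (- c * x\<^sup>2)) \<partial>lborel)"
    using I by (intro product_sigma_finite.product_nn_integral_prod[OF product_sigma_finite_lborel]) auto
  also have "\<dots> < \<infinity>"
    using nn_integral_gaussian_finite[OF c] by (simp add: power_less_top_ennreal)
  finally show ?thesis .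
qed

text \<open>With D and the later columns fixed, \<open>column_bound\<close> controls the new column
  of L by column v of its inverse, whose squared norm enters the exponent through the row forms. The
  integrand therefore lies below a Gaussian in the new entries.\<close>

lemma col_int_finite:
  fixes \<theta> :: "'m::{finite,wellorder} state"
  assumes U: "pos_def U" and \<theta>: "\<theta> \<in> ThetaG E"
  shows "(\<integral>\<^sup>+l. ennreal (pi_tilde U \<alpha> (put_col E v \<theta> l)) \<partial>(\<Pi>\<^sub>M u\<in>col_idx E v. lborel)) < \<infinity>"
proof -
  obtain L D where \<theta>_eq: "\<theta> = (L, D)" by (cases \<theta>)
  have L: "L \<in> LG E" and D: "pos_diag D" using \<theta> by (auto simp: \<theta>_eq ThetaG_def)
  from pos_def_bounds[OF U] obtain \<epsilon> where \<epsilon>: "0 < \<epsilon>" "\<And>x. \<epsilon> * (x \<bullet> x) \<le> x \<bullet> (U *v x)" by blast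
  \<comment> \<open>Depends only on columns after v, which the update leaves alone; the summand 1
    keeps C positive, since c is to be divided by it.\<close>
  define C where "C = 1 + (\<Sum>u\<in>col_idx E v. \<Sum>k\<in>{v<..}. (L $ u $ k)\<^sup>2)"
  have C: "0 < C" unfolding C_def by (intro add_pos_nonneg sum_nonneg) auto
  define m where "m = (\<Sum>i\<in>UNIV. D $ i $ i)"
  have m: "D $ i $ i \<le> m" "0 < D $ i $ i" for i
    using D unfolding m_def by (auto intro!: member_le_sum simp: pos_diag_def less_imp_le)
  have m0: "0 < m" using m[of undefined] by linarith
  \<comment> \<open>The 2 in the denominator is the factor 1/2 in the exponent of
    \<open>pi_tilde\<close>.\<close>
  define c where "c = \<epsilon> / (2 * (m * C))"
  have c: "0 < c" using \<epsilon> m0 C by (simp add: c_def)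
  define K where "K = exp (- (1/2) * (\<Sum>i\<in>UNIV. \<alpha> $ i * ln (D $ i $ i)))"
  have bound: "pi_tilde U \<alpha> (put_col E v \<theta> l) \<le> K * exp (- c * (\<Sum>u\<in>col_idx E v. (l u)\<^sup>2))" for l
  proof -
    define L' where "L' = (\<chi> i j. if j = v \<and> i \<in> col_idx E v then l i else L $ i $ j)"
    have L': "unit_lower L'"
      using L by (auto simp: L'_def LG_def unit_lower_def col_idx_def)
    define R where "R = matrix_inv L'"
    have put: "put_col E v \<theta> l = (L', D)" by (simp add: put_col_def L'_def \<theta>_eq cong: if_cong)
    let ?S = "\<Sum>k\<in>UNIV. (R $ k $ v)\<^sup>2"
    have "(\<Sum>u\<in>col_idx E v. (l u)\<^sup>2) = (\<Sum>u\<in>col_idx E v. (L' $ u $ v)\<^sup>2)"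
      by (intro sum.cong) (auto simp: L'_def)
    also have "\<dots> \<le> (\<Sum>u\<in>col_idx E v. (\<Sum>k\<in>{v<..}. (L' $ u $ k)\<^sup>2) * ?S)"
      unfolding R_def by (intro sum_mono column_bound[OF L']) (auto simp: col_idx_def)
    \<comment> \<open>Columns after v of \<open>L'\<close> are those of L, so the bound no longer
      involves l except through \<open>?S\<close>.\<close>
    also have "\<dots> = (\<Sum>u\<in>col_idx E v. \<Sum>k\<in>{v<..}. (L $ u $ k)\<^sup>2) * ?S"
      unfolding sum_distrib_right[symmetric]
      by (intro arg_cong2[where f="(*)"] sum.cong refl) (auto simp: L'_def)
    also have "\<dots> \<le> C * ?S"
      by (intro mult_right_mono sum_nonneg) (auto simp: C_def)
    finally have 1: "(\<Sum>u\<in>col_idx E v. (l u)\<^sup>2) \<le> C * ?S" .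
    have "\<epsilon> / m * ?S = (\<Sum>i\<in>UNIV. \<epsilon> / m * (R $ i $ v)\<^sup>2)" by (simp add: sum_distrib_left)
    also have "\<dots> \<le> (\<Sum>i\<in>UNIV. row_form U L' i / D $ i $ i)"
    proof (rule sum_mono)
      fix i
      have "\<epsilon> * (R $ i $ v)\<^sup>2 \<le> \<epsilon> * (\<Sum>j\<in>UNIV. (R $ i $ j)\<^sup>2)"
        using \<epsilon> by (intro mult_left_mono member_le_sum) auto
      also have "\<dots> \<le> row_form U L' i"
        unfolding R_def by (rule row_form_ge[OF \<epsilon>(2)])
      finally have *: "\<epsilon> * (R $ i $ v)\<^sup>2 \<le> row_form U L' i" .
      have "0 \<le> \<epsilon> * (R $ i $ v)\<^sup>2" using \<epsilon> by simp
      with * have "\<epsilon> * (R $ i $ v)\<^sup>2 / m \<le> row_form U L' i / D $ i $ i"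
        using m[of i] by (intro frac_le) auto
      then show "\<epsilon> / m * (R $ i $ v)\<^sup>2 \<le> row_form U L' i / D $ i $ i" by simp
    qed
    finally have 2: "\<epsilon> / m * ?S \<le> (\<Sum>i\<in>UNIV. row_form U L' i / D $ i $ i)" .
    have "2 * c * (\<Sum>u\<in>col_idx E v. (l u)\<^sup>2) \<le> 2 * c * (C * ?S)"
      using 1 c by (intro mult_left_mono) auto
    also have "\<dots> = \<epsilon> / m * ?S" using C m0 by (simp add: c_def)
    also note 2
    finally have "- (1/2) * (\<Sum>i\<in>UNIV. row_form U L' i / D $ i $ i) \<le> - c * (\<Sum>u\<in>col_idx E v. (l u)\<^sup>2)"
      by simp
    then show ?thesis
      unfolding put pi_tilde_eq[OF L' D] K_def exp_add[symmetric]
      by (simp add: sum.distrib algebra_simps)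
  qed
  have "(\<integral>\<^sup>+l. ennreal (pi_tilde U \<alpha> (put_col E v \<theta> l)) \<partial>(\<Pi>\<^sub>M u\<in>col_idx E v. lborel)) \<le>
      (\<integral>\<^sup>+l. ennreal K * ennreal (exp (- c * (\<Sum>u\<in>col_idx E v. (l u)\<^sup>2))) \<partial>(\<Pi>\<^sub>M u\<in>col_idx E v. lborel))"
    using bound by (intro nn_integral_mono) (simp add: ennreal_mult[symmetric] K_def ennreal_leI)
  also have "\<dots> = ennreal K * (\<integral>\<^sup>+l. ennreal (exp (- c * (\<Sum>u\<in>col_idx E v. (l u)\<^sup>2))) \<partial>(\<Pi>\<^sub>M u\<in>col_idx E v. lborel))"
    by (rule nn_integral_cmult) measurable
  also have "\<dots> < \<infinity>"
    using nn_integral_gaussian_prod_finite[OF c, of "col_idx E v"] by (simp add: ennreal_mult_less_top)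
  finally show ?thesis .
qed

section \<open>The block Gibbs sampler\<close>

text \<open>Puts the two kinds of update into one family with the index type of
  \<open>blocks\<close>.\<close>

definition block_step :: "'m rel \<Rightarrow> 'm rmat \<Rightarrow> 'm rvec \<Rightarrow> 'm option \<Rightarrow> 'm::{finite,wellorder} state \<Rightarrow> 'm state measure" where
  "block_step E U \<alpha> i = (case i of None \<Rightarrow> diag_update E U \<alpha> | Some v \<Rightarrow> col_update E U \<alpha> v)"

lemma zG_coords: "zG E U \<alpha> = (\<integral>\<^sup>+x. ennreal (pi_tilde U \<alpha> (assemble E x)) \<partial>PiM blocks (blk E))"
  unfolding zG_def dLdD_coords by (rule nn_integral_distr[OF assemble_measurable]) simp

lemma block_section_finite:
  assumes U: "pos_def U" and z: "zG E U \<alpha> < \<infinity>" and i: "i \<in> blocks"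
    and x: "x \<in> space (PiM blocks (blk E))"
  shows "(\<integral>\<^sup>+b. ennreal (pi_tilde U \<alpha> (assemble E (x(i := b)))) \<partial>blk E i) < \<infinity>"
proof (cases i)
  case None
  have "(\<integral>\<^sup>+b. ennreal (pi_tilde U \<alpha> (assemble E (x(i := b)))) \<partial>blk E i) =
      diag_int U \<alpha> (lower_of E (\<lambda>(i, j). x (Some j) i))"
    by (simp add: None diag_int_def blk_def assemble_def)
  then show ?thesis using diag_int_finite[OF U z lower_of_LG] by simp
next
  case (Some v)
  then have "v \<noteq> Max UNIV" using i by (auto simp: blocks_def)
  then show ?thesis
    using col_int_finite[OF U assemble_ThetaG[OF x], where \<alpha>=\<alpha> and v=v]
    by (simp add: Some blk_def put_col_assemble)
qed

context
  fixes E :: "'m::{finite,wellorder} rel" and U :: "'m rmat" and \<alpha> :: "'m rvec"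
  assumes U: "pos_def U" and z: "zG E U \<alpha> < \<infinity>"
begin

interpretation pg: product_gibbs "blk E" blocks "\<lambda>x. ennreal (pi_tilde U \<alpha> (assemble E x))"
proof (intro product_gibbs.intro product_gibbs_axioms.intro)
  show "product_sigma_finite (blk E)" by (rule product_sigma_finite_blk)
  show "(\<lambda>x. ennreal (pi_tilde U \<alpha> (assemble E x))) \<in> borel_measurable (PiM blocks (blk E))"
    by (rule measurable_compose[OF _ measurable_ennreal],
        rule measurable_compose[OF assemble_measurable pi_tilde_measurable1])
  show "(\<integral>\<^sup>+x. ennreal (pi_tilde U \<alpha> (assemble E x)) \<partial>PiM blocks (blk E)) < \<infinity>"
    using z by (simp add: zG_coords)
  show "emeasure (blk E i) (space (blk E i)) \<noteq> 0" for i
    using emeasure_dD_nonzero emeasure_PiM_lborel_nonzero[OF finite]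
    by (cases i) (auto simp: blk_def)
  show "(\<integral>\<^sup>+b. ennreal (pi_tilde U \<alpha> (assemble E (x(i := b)))) \<partial>blk E i) < \<infinity>"
    if "i \<in> blocks" "x \<in> space (PiM blocks (blk E))" for i x
    using that by (rule block_section_finite[OF U z])
qed (auto simp: pi_tilde_pos)

text \<open>\<open>assemble\<close> intertwines a block update on matrices with the resampling of
  one coordinate, because replacing a block commutes with assembling.\<close>

lemma block_step_assemble:
  assumes i: "i \<in> blocks" and x: "x \<in> space (PiM blocks (blk E))"
  shows "block_step E U \<alpha> i (assemble E x) = distr (pg.resample i x) (Theta_space E) (assemble E)"
proof -
  define put where "put = (\<lambda>b. assemble E (x(i := b)))"
  have m: "(\<lambda>b. x(i := b)) \<in> blk E i \<rightarrow>\<^sub>M PiM blocks (blk E)"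
    using measurable_Pair2[OF pg.upd_measurable[OF i] x] by (simp only: prod.case)
  have "block_step E U \<alpha> i (assemble E x) =
      distr (density (blk E i) (\<lambda>b. ennreal (pi_tilde U \<alpha> (put b)) / (\<integral>\<^sup>+b. ennreal (pi_tilde U \<alpha> (put b)) \<partial>blk E i)))
        (Theta_space E) put"
  proof (cases i)
    case None
    have "put_diag (assemble E x) = put" by (simp add: put_def None put_diag_assemble fun_eq_iff)
    then show ?thesis
      by (simp add: None block_step_def diag_update_def block_update_def block_conditional_def blk_def)
  next
    case (Some v)
    then have "v \<noteq> Max UNIV" using i by (auto simp: blocks_def)
    then have "put_col E v (assemble E x) = put" by (simp add: put_def Some put_col_assemble fun_eq_iff)
    then show ?thesis
      by (simp add: Some block_step_def col_update_def block_update_def block_conditional_def blk_def)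
  qed
  also have "\<dots> = distr (pg.resample i x) (Theta_space E) (assemble E)"
    unfolding pg.resample_def pg.sec_def put_def
    by (subst distr_distr[OF assemble_measurable]) (use m in \<open>simp_all add: comp_def\<close>)
  finally show ?thesis .
qed

lemma block_step_measurable:
  assumes i: "i \<in> blocks" shows "block_step E U \<alpha> i \<in> Theta_space E \<rightarrow>\<^sub>M prob_algebra (Theta_space E)"
proof -
  have "(\<lambda>\<theta>. distr (pg.resample i (coords E \<theta>)) (Theta_space E) (assemble E)) \<in>
      Theta_space E \<rightarrow>\<^sub>M prob_algebra (Theta_space E)"
    by (rule measurable_compose[OF measurable_compose[OF coords_measurable pg.resample_measurable[OF i]]
          measurable_distr_prob_space[OF assemble_measurable]])
  also have "?this \<longleftrightarrow> ?thesis"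
  proof (rule measurable_cong)
    fix \<theta> assume "\<theta> \<in> space (Theta_space E)"
    then show "distr (pg.resample i (coords E \<theta>)) (Theta_space E) (assemble E) = block_step E U \<alpha> i \<theta>"
      using block_step_assemble[OF i measurable_space[OF coords_measurable, of \<theta> E]]
      by (simp add: assemble_coords)
  qed
  finally show ?thesis .
qed

text \<open>The intertwining passes through each \<open>bind\<close>, so it carries over from single
  steps to whole sweeps.\<close>

lemma fold_block_step:
  assumes "set is \<subseteq> blocks" "x \<in> space (PiM blocks (blk E))"
  shows "fold (\<lambda>k K \<theta>. K \<theta> \<bind> k) (map (block_step E U \<alpha>) is) (return (Theta_space E)) (assemble E x) =
    distr (pg.sweep is x) (Theta_space E) (assemble E)"
  using assms(1)
proof (induction "is" rule: rev_induct)
  case Nil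
  then show ?case using assms(2) by (simp add: distr_return[OF assemble_measurable])
next
  case (snoc i "is")
  then have i: "i \<in> blocks" and iss: "set is \<subseteq> blocks" by auto
  let ?S = "pg.sweep is x"
  have S: "?S \<in> space (prob_algebra (PiM blocks (blk E)))"
    using measurable_space[OF pg.sweep_measurable[OF iss] assms(2)] .
  then have sets_S: "sets ?S = sets (PiM blocks (blk E))" by (simp add: space_prob_algebra)
  have ne: "space ?S \<noteq> {}" using S by (auto simp: space_prob_algebra dest: prob_space.not_empty)
  have A: "assemble E \<in> ?S \<rightarrow>\<^sub>M Theta_space E"
    using assemble_measurable by (simp add: measurable_cong_sets[OF sets_S refl])
  have R: "pg.resample i \<in> ?S \<rightarrow>\<^sub>M subprob_algebra (PiM blocks (blk E))"
    using measurable_prob_algebraD[OF pg.resample_measurable[OF i]]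
    by (simp add: measurable_cong_sets[OF sets_S refl])
  have "fold (\<lambda>k K \<theta>. K \<theta> \<bind> k) (map (block_step E U \<alpha>) (is @ [i])) (return (Theta_space E)) (assemble E x) =
      distr ?S (Theta_space E) (assemble E) \<bind> block_step E U \<alpha> i"
    using snoc.IH[OF iss] by simp
  also have "\<dots> = ?S \<bind> (\<lambda>y. block_step E U \<alpha> i (assemble E y))"
    by (rule bind_distr[OF A measurable_prob_algebraD[OF block_step_measurable[OF i]] ne])
  also have "\<dots> = ?S \<bind> (\<lambda>y. distr (pg.resample i y) (Theta_space E) (assemble E))"
    using sets_eq_imp_space_eq[OF sets_S] by (intro bind_cong refl block_step_assemble[OF i]) simp
  also have "\<dots> = distr (?S \<bind> pg.resample i) (Theta_space E) (assemble E)"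
    by (rule distr_bind[OF R ne assemble_measurable, symmetric])
  finally show ?case by (simp add: pg.sweep_snoc)
qed

lemma piG_coords: "piG E U \<alpha> = distr pg.target (Theta_space E) (assemble E)"
proof -
  have "(\<lambda>\<theta>. ennreal (pi_tilde U \<alpha> \<theta>) / zG E U \<alpha>) \<in> borel_measurable (Theta_space E)" by measurable
  from density_distr[OF this assemble_measurable] show ?thesis
    by (simp add: piG_def dLdD_coords pg.target_def pg.Z_def zG_coords)
qed

lemma gibbs_converges: "markov_chain_converges (Theta_space E) (gibbs_kernel E U \<alpha>) (piG E U \<alpha>)"
proof -
  \<comment> \<open>The update order of \<open>gibbs_kernel\<close>; it visits every block exactly
    once, as \<open>sweep_positive_density\<close> requires.\<close>
  define js :: "'m option list" where "js = map Some (sorted_list_of_set (UNIV - {Max UNIV})) @ [None]"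
  have js: "distinct js" "set js = blocks"
    by (auto simp: js_def blocks_def distinct_map)
  have g: "gibbs_kernel E U \<alpha> = fold (\<lambda>k K \<theta>. K \<theta> \<bind> k) (map (block_step E U \<alpha>) js) (return (Theta_space E))"
    by (simp add: gibbs_kernel_def js_def block_step_def[abs_def] comp_def)
  have K: "gibbs_kernel E U \<alpha> \<theta> = distr (pg.sweep js (coords E \<theta>)) (Theta_space E) (assemble E)"
    if "\<theta> \<in> space (Theta_space E)" for \<theta>
    using fold_block_step[of js "coords E \<theta>"] js(2) measurable_space[OF coords_measurable that] that
    by (simp add: g assemble_coords)
  from pg.sweep_positive_density[OF js] obtain k where
    "positive_density_kernel (PiM blocks (blk E)) (pg.sweep js) pg.target k" .
  from positive_density_kernel.isomorphic_copy[OF this assemble_measurable coords_measurable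
      coords_assemble _ K]
  have "positive_density_kernel (Theta_space E) (gibbs_kernel E U \<alpha>) (distr pg.target (Theta_space E) (assemble E))
    (\<lambda>x y. k (coords E x) (coords E y))" by (simp add: assemble_coords)
  then show ?thesis unfolding piG_coords by (rule positive_density_kernel.converges)
qed

lemma zG_pos: "0 < zG E U \<alpha>"
  using pg.Z_pos by (simp add: pg.Z_def zG_coords)

lemma piG_prob: "piG E U \<alpha> \<in> space (prob_algebra (Theta_space E))"
proof -
  have "assemble E \<in> pg.target \<rightarrow>\<^sub>M Theta_space E"
    using assemble_measurable pg.target_prob
    by (simp add: space_prob_algebra cong: measurable_cong_sets)
  then show ?thesis
    unfolding piG_coords using pg.target_prob
    by (auto simp: space_prob_algebra intro: prob_space.prob_space_distr)
qed

end

section \<open>Finiteness of the posterior normalising constant\<close>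

text \<open>For n at least 1 the factor n cancels the 1/n of \<open>sample_cov\<close>, leaving
  rank-one matrices whose quadratic forms are squares.\<close>

lemma post_scale_quadratic:
  fixes x :: "'m::finite rvec"
  assumes n: "n \<ge> 1"
  shows "x \<bullet> (post_scale U n y *v x) = (\<Sum>i<n. (x \<bullet> y i)\<^sup>2) + x \<bullet> (U *v x)"
proof -
  have "post_scale U n y = (\<Sum>i<n. (\<chi> a b. y i $ a * y i $ b)) + U"
    using n by (simp add: post_scale_def sample_cov_def)
  moreover have "x \<bullet> ((\<chi> a b. y i $ a * y i $ b) *v x) = (x \<bullet> y i)\<^sup>2" for i
    by (simp add: inner_vec_def matrix_vector_mult_def power2_eq_square sum_product sum_distrib_left mult_ac)
  moreover have "(\<Sum>i<n. A i) *v x = (\<Sum>i<n. A i *v x)" for A :: "nat \<Rightarrow> 'm rmat"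
    by (induction n) (simp_all add: matrix_vector_mult_add_rdistrib)
  ultimately show ?thesis
    by (simp add: matrix_vector_mult_add_rdistrib inner_add_right inner_sum_right)
qed

lemma post_scale_entry:
  assumes "n \<ge> 1" shows "post_scale U n y $ a $ b = (\<Sum>i<n. y i $ a * y i $ b) + U $ a $ b"
  using assms by (simp add: post_scale_def sample_cov_def)

lemma pos_def_post_scale:
  assumes U: "pos_def U" and n: "n \<ge> 1" shows "pos_def (post_scale U n y)"
  unfolding pos_def_def
proof (intro conjI allI impI)
  have "U $ a $ b = U $ b $ a" for a b
    using U unfolding pos_def_def transpose_def vec_eq_iff by simp
  then show "transpose (post_scale U n y) = post_scale U n y"
    by (simp add: transpose_def vec_eq_iff post_scale_entry[OF n] mult.commute)
  fix x :: "'a rvec" assume "x \<noteq> 0"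
  then have "0 < x \<bullet> (U *v x)" using U by (simp add: pos_def_def)
  then show "0 < x \<bullet> (post_scale U n y *v x)"
    by (simp add: post_scale_quadratic[OF n] add_nonneg_pos sum_nonneg)
qed

text \<open>The function a / d + ln d is smallest at d = a; the bound is ln x <= x - 1 at x = a /
  d.\<close>

lemma ln_inverse_bound:
  fixes d a n :: real
  assumes d: "0 < d" and a: "0 < a" and n: "0 \<le> n"
  shows "n * (1 + ln a) \<le> n * a / d + n * ln d"
proof -
  have "ln (a / d) \<le> a / d - 1" using d a by (intro ln_le_minus_one) simp
  then have "1 + ln a \<le> a / d + ln d" using d a by (simp add: ln_div)
  then have "n * (1 + ln a) \<le> n * (a / d + ln d)" using n by (rule mult_left_mono)
  then show ?thesis by (simp add: algebra_simps)
qed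

text \<open>The sample adds a factor that may blow up as a diagonal entry of D tends to 0. Half of
  each row form of U, which is bounded below, pays for it, and the other half leaves the prior with
  U / 2, whose constant is finite by scaling.\<close>

lemma zG_post_finite:
  fixes U :: "'m::{finite,wellorder} rmat"
  assumes U: "pos_def U" and n: "n \<ge> 1" and z: "zG E U \<alpha> < \<infinity>"
  shows "zG E (post_scale U n y) (post_shape \<alpha> n) < \<infinity>"
proof -
  from pos_def_bounds[OF U] obtain \<epsilon> where \<epsilon>: "0 < \<epsilon>" "\<And>x. \<epsilon> * (x \<bullet> x) \<le> x \<bullet> (U *v x)" by blast
  \<comment> \<open>Chosen so that n * a is \<epsilon> / 2, at most half of any row form of
    U.\<close>
  define a where "a = \<epsilon> / (2 * real n)"
  have a: "0 < a" using \<epsilon> n by (simp add: a_def)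
  define K where "K = exp (- (1/2) * (\<Sum>i\<in>(UNIV::'m set). real n * (1 + ln a)))"
  have bound: "pi_tilde (post_scale U n y) (post_shape \<alpha> n) \<theta> \<le> K * pi_tilde ((1/2) *\<^sub>R U) \<alpha> \<theta>"
    if "\<theta> \<in> ThetaG E" for \<theta>
  proof -
    obtain L D where \<theta>: "\<theta> = (L, D)" by (cases \<theta>)
    have L: "unit_lower L" and D: "pos_diag D" using ThetaG_D[OF that] by (auto simp: \<theta>)
    have "real n * (1 + ln a) + (row_form ((1/2) *\<^sub>R U) L i / D $ i $ i + \<alpha> $ i * ln (D $ i $ i)) \<le>
        row_form (post_scale U n y) L i / D $ i $ i + post_shape \<alpha> n $ i * ln (D $ i $ i)" for i
    proof -
      have d: "0 < D $ i $ i" using D by (simp add: pos_diag_def)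
      have "row_form U L i \<le> row_form (post_scale U n y) L i"
        unfolding row_form_def by (simp add: post_scale_quadratic[OF n] sum_nonneg)
      moreover have "\<epsilon> \<le> row_form U L i" by (rule row_form_ge'[OF L \<epsilon>])
      ultimately have "real n * a + row_form ((1/2) *\<^sub>R U) L i \<le> row_form (post_scale U n y) L i"
        using n by (simp add: row_form_scale a_def)
      then have "(real n * a + row_form ((1/2) *\<^sub>R U) L i) / D $ i $ i \<le> row_form (post_scale U n y) L i / D $ i $ i"
        using d by (intro divide_right_mono) auto
      moreover have "real n * (1 + ln a) \<le> real n * a / D $ i $ i + real n * ln (D $ i $ i)"
        by (rule ln_inverse_bound[OF d a]) simp
      ultimately show ?thesis by (simp add: post_shape_def add_divide_distrib algebra_simps)
    qed
    then have "(\<Sum>i\<in>UNIV. real n * (1 + ln a) + (row_form ((1/2) *\<^sub>R U) L i / D $ i $ i + \<alpha> $ i * ln (D $ i $ i))) \<le>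
        (\<Sum>i\<in>UNIV. row_form (post_scale U n y) L i / D $ i $ i + post_shape \<alpha> n $ i * ln (D $ i $ i))"
      by (intro sum_mono)
    then show ?thesis
      unfolding \<theta> pi_tilde_eq[OF L D] K_def exp_add[symmetric] sum.distrib[of "\<lambda>_. real n * (1 + ln a)"]
      by simp
  qed
  have "zG E (post_scale U n y) (post_shape \<alpha> n) \<le> (\<integral>\<^sup>+\<theta>. ennreal K * ennreal (pi_tilde ((1/2) *\<^sub>R U) \<alpha> \<theta>) \<partial>dLdD E)"
    unfolding zG_def using bound
    by (intro nn_integral_mono) (auto simp: dLdD_def ennreal_mult[symmetric] K_def pi_tilde_pos less_imp_le intro!: ennreal_leI)
  also have "\<dots> = ennreal K * zG E ((1/2) *\<^sub>R U) \<alpha>"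
    unfolding zG_def by (rule nn_integral_cmult) (simp add: dLdD_def)
  also have "\<dots> < \<infinity>"
    using zG_scale_finite[OF z, of "1/2"] by (simp add: ennreal_mult_less_top)
  finally show ?thesis .
qed

section \<open>The posterior distribution\<close>

lemma sets_dLdD [simp, measurable_cong]: "sets (dLdD E) = sets (Theta_space E)"
  by (simp add: dLdD_def)

lemma space_dLdD [simp]: "space (dLdD E) = ThetaG E"
  by (simp add: dLdD_def)

text \<open>The undivided form lets an integral over the joint density be read as marginal density
  times posterior probability.\<close>

lemma emeasure_piG_times:
  assumes "pos_def U" "zG E U \<alpha> < \<infinity>" and A: "A \<in> sets (Theta_space E)"
  shows "zG E U \<alpha> * emeasure (piG E U \<alpha>) A = (\<integral>\<^sup>+t. ennreal (pi_tilde U \<alpha> t) * indicator A t \<partial>dLdD E)"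
proof -
  note [measurable] = A
  have "emeasure (piG E U \<alpha>) A = (\<integral>\<^sup>+t. ennreal (pi_tilde U \<alpha> t) / zG E U \<alpha> * indicator A t \<partial>dLdD E)"
    unfolding piG_def by (rule emeasure_density) auto
  also have "\<dots> = (\<integral>\<^sup>+t. ennreal (pi_tilde U \<alpha> t) * indicator A t / zG E U \<alpha> \<partial>dLdD E)"
    by (simp add: divide_ennreal_def mult_ac)
  also have "\<dots> = (\<integral>\<^sup>+t. ennreal (pi_tilde U \<alpha> t) * indicator A t \<partial>dLdD E) / zG E U \<alpha>"
    by (rule nn_integral_divide) measurable
  finally show ?thesis
    using zG_pos[OF assms(1,2)] assms(2)
      ennreal_mult_divide_eq[of "zG E U \<alpha>" "\<integral>\<^sup>+t. ennreal (pi_tilde U \<alpha> t) * indicator A t \<partial>dLdD E"]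
    by (simp add: ennreal_times_divide mult.commute)
qed

text \<open>\<open>dLdD\<close> is defined as an image measure, so sigma-finiteness is not
  immediate. It is obtained by writing \<open>dLdD\<close> as a measure with finite density with
  respect to the probability \<open>piG\<close>.\<close>

lemma sigma_finite_dLdD:
  assumes "pos_def U" "zG E U \<alpha> < \<infinity>" shows "sigma_finite_measure (dLdD E)"
proof -
  interpret p: prob_space "piG E U \<alpha>"
    using piG_prob[OF assms] by (simp add: space_prob_algebra)
  let ?f = "\<lambda>t. ennreal (pi_tilde U \<alpha> t) / zG E U \<alpha>" and ?g = "\<lambda>t. zG E U \<alpha> / ennreal (pi_tilde U \<alpha> t)"
  have "density (piG E U \<alpha>) ?g = density (dLdD E) (\<lambda>t. ?f t * ?g t)"
    unfolding piG_def by (rule density_density_eq) auto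
  also have "\<dots> = density (dLdD E) (\<lambda>_. 1)"
  proof (intro arg_cong[where f="density _"] ext)
    fix t
    have "?f t * ?g t = ennreal (pi_tilde U \<alpha> t) * (zG E U \<alpha> / ennreal (pi_tilde U \<alpha> t) / zG E U \<alpha>)"
      by (simp add: ennreal_divide_times)
    also have "\<dots> = zG E U \<alpha> / zG E U \<alpha>"
      by (rule ennreal_cancel_factor) (auto simp: pi_tilde_pos)
    finally show "?f t * ?g t = 1"
      using zG_pos[OF assms] assms(2) by simp
  qed
  also have "\<dots> = dLdD E" by (rule density_1)
  finally have eq: "density (piG E U \<alpha>) ?g = dLdD E" .
  have "sigma_finite_measure (density (piG E U \<alpha>) ?g)"
  proof (subst p.sigma_finite_iff_density_finite)
    show "?g \<in> borel_measurable (piG E U \<alpha>)" unfolding piG_def by simp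
    have "?g t \<noteq> \<infinity>" for t
      using assms(2) pi_tilde_pos[of U \<alpha> t] by (auto simp: ennreal_divide_eq_top_iff)
    then show "AE t in piG E U \<alpha>. ?g t \<noteq> \<infinity>" by simp
  qed
  then show ?thesis unfolding eq .
qed

section \<open>Conjugacy of prior and likelihood\<close>

lemma trace_inv_post_scale:
  fixes A :: "'m::finite rmat"
  assumes n: "n \<ge> 1"
  shows "trace (A ** post_scale U n y) = (\<Sum>i<n. y i \<bullet> (A *v y i)) + trace (A ** U)"
proof -
  have "trace (A ** post_scale U n y) = (\<Sum>a\<in>UNIV. \<Sum>b\<in>UNIV. A $ a $ b * (\<Sum>i<n. y i $ b * y i $ a)) + trace (A ** U)"
    by (simp add: trace_def matrix_matrix_mult_def post_scale_entry[OF n] distrib_left sum.distrib)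
  also have "(\<Sum>a\<in>UNIV. \<Sum>b\<in>UNIV. A $ a $ b * (\<Sum>i<n. y i $ b * y i $ a)) =
      (\<Sum>a\<in>UNIV. \<Sum>b\<in>UNIV. \<Sum>i<n. y i $ a * (A $ a $ b * y i $ b))"
    by (simp add: sum_distrib_left mult_ac)
  also have "\<dots> = (\<Sum>a\<in>UNIV. \<Sum>i<n. \<Sum>b\<in>UNIV. y i $ a * (A $ a $ b * y i $ b))"
    by (rule sum.cong[OF refl sum.swap])
  also have "\<dots> = (\<Sum>i<n. \<Sum>a\<in>UNIV. \<Sum>b\<in>UNIV. y i $ a * (A $ a $ b * y i $ b))"
    by (rule sum.swap)
  also have "\<dots> = (\<Sum>i<n. y i \<bullet> (A *v y i))"
    by (simp add: inner_vec_def matrix_vector_mult_def sum_distrib_left)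
  finally show ?thesis .
qed

text \<open>The real density inside \<open>mvn\<close>, named so that products over the sample can
  be formed in the reals.\<close>

definition gauss_dens :: "'m::finite rmat \<Rightarrow> 'm rvec \<Rightarrow> real" where
  "gauss_dens \<Sigma> y = exp (- (1/2) * (y \<bullet> (matrix_inv \<Sigma> *v y))) / sqrt ((2 * pi) ^ CARD('m) * det \<Sigma>)"

lemma gauss_dens_measurable:
  assumes [measurable]: "\<And>a b. (\<lambda>x. matrix_inv (S x) $ a $ b) \<in> borel_measurable M"
    "(\<lambda>x. det (S x)) \<in> borel_measurable M" "\<And>a. (\<lambda>x. y x $ a) \<in> borel_measurable M"
  shows "(\<lambda>x. gauss_dens (S x) (y x)) \<in> borel_measurable M"
  unfolding gauss_dens_def inner_vec_def matrix_vector_mult_def by simp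

text \<open>The determinant of the covariance is the product of the diagonal of D, so each
  observation adds 1 to every shape parameter; the quadratic forms of the observations sum to the
  trace against the sample part of \<open>post_scale\<close>.\<close>

lemma likelihood:
  fixes U :: "'m::{finite,wellorder} rmat"
  assumes n: "n \<ge> 1" and t: "t \<in> ThetaG E"
  shows "pi_tilde U \<alpha> t * (\<Prod>i<n. gauss_dens (cov t) (y i)) =
    (1 / sqrt ((2 * pi) ^ CARD('m))) ^ n * pi_tilde (post_scale U n y) (post_shape \<alpha> n) t"
proof -
  obtain L D where t_eq: "t = (L, D)" by (cases t)
  have L: "unit_lower L" and D: "pos_diag D" using ThetaG_D[OF t] by (auto simp: t_eq)
  let ?A = "matrix_inv (cov t)"
  have d: "0 < D $ i $ i" for i using D by (simp add: pos_diag_def)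
  have "sqrt (det (cov t)) = exp ((1/2) * ln (\<Prod>i\<in>UNIV. D $ i $ i))"
    using det_cov[OF L D] d by (simp add: t_eq powr_half_sqrt[symmetric] prod_nonneg less_imp_le powr_def)
      (simp add: prod_pos less_imp_neq[symmetric] d)
  also have "ln (\<Prod>i\<in>UNIV. D $ i $ i) = (\<Sum>i\<in>UNIV. ln (D $ i $ i))"
    using d by (intro ln_prod) (auto simp: less_imp_neq[symmetric])
  finally have sd: "sqrt (det (cov t)) = exp ((1/2) * (\<Sum>i\<in>UNIV. ln (D $ i $ i)))" .
  have g: "gauss_dens (cov t) (y i) = 1 / sqrt ((2 * pi) ^ CARD('m)) *
      exp (- (1/2) * (y i \<bullet> (?A *v y i) + (\<Sum>i\<in>UNIV. ln (D $ i $ i))))" for i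
  proof -
    have "exp (- (1/2) * (q + s)) = exp (- (1/2) * q) / exp ((1/2) * s)" for q s :: real
      by (simp add: exp_diff[symmetric] algebra_simps)
    then show ?thesis by (simp add: gauss_dens_def real_sqrt_mult sd)
  qed
  have "(\<Prod>i<n. gauss_dens (cov t) (y i)) = (1 / sqrt ((2 * pi) ^ CARD('m))) ^ n *
      exp (\<Sum>i<n. - (1/2) * (y i \<bullet> (?A *v y i) + (\<Sum>i\<in>UNIV. ln (D $ i $ i))))"
    by (simp only: g prod.distrib prod_constant card_lessThan exp_sum[OF finite_lessThan])
  also have "(\<Sum>i<n. - (1/2) * (y i \<bullet> (?A *v y i) + (\<Sum>i\<in>UNIV. ln (D $ i $ i)))) =
      - (1/2) * ((\<Sum>i<n. y i \<bullet> (?A *v y i)) + real n * (\<Sum>i\<in>UNIV. ln (D $ i $ i)))"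
    by (simp only: sum_distrib_left[symmetric] sum.distrib sum_constant card_lessThan)
  finally have p: "(\<Prod>i<n. gauss_dens (cov t) (y i)) = (1 / sqrt ((2 * pi) ^ CARD('m))) ^ n *
      exp (- (1/2) * ((\<Sum>i<n. y i \<bullet> (?A *v y i)) + real n * (\<Sum>i\<in>UNIV. ln (D $ i $ i))))" .
  have "pi_tilde U \<alpha> t * exp (- (1/2) * ((\<Sum>i<n. y i \<bullet> (?A *v y i)) + real n * (\<Sum>i\<in>UNIV. ln (D $ i $ i))))
      = pi_tilde (post_scale U n y) (post_shape \<alpha> n) t"
    unfolding pi_tilde_def trace_inv_post_scale[OF n] exp_add[symmetric]
    by (simp add: post_shape_def t_eq sum.distrib distrib_right sum_distrib_left algebra_simps)
  then show ?thesis unfolding p by simp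
qed

section \<open>Measurability in the data\<close>

lemma vec_component_measurable: "(\<lambda>x::real^'n. x $ a) \<in> borel_measurable lborel"
  using borel_measurable_continuous_onI[of "\<lambda>x::real^'n. x $ a"] by (simp add: continuous_on_component)

lemma borel_box_measurable:
  "(\<lambda>y. y i $ a) \<in> borel_measurable (\<Pi>\<^sub>M i\<in>{..<n}. (borel :: 'm::finite rvec measure))" if "i < n"
proof -
  have 1: "(\<lambda>y. y i) \<in> (\<Pi>\<^sub>M i\<in>{..<n}. (borel :: 'm rvec measure)) \<rightarrow>\<^sub>M borel"
    using that by (intro measurable_component_singleton) auto
  have 2: "(\<lambda>x::'m rvec. x $ a) \<in> borel_measurable borel"
    by (intro borel_measurable_continuous_onI continuous_intros)
  show ?thesis by (rule measurable_compose[OF 1 2])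
qed

lemma post_scale_measurable:
  assumes "n \<ge> 1"
  shows "(\<lambda>y. post_scale U n y $ a $ b) \<in> borel_measurable (\<Pi>\<^sub>M i\<in>{..<n}. borel)"
  unfolding post_scale_entry[OF assms]
  by (intro borel_measurable_add borel_measurable_sum borel_measurable_times borel_measurable_const borel_box_measurable) auto

lemma sets_PiM_lborel: "sets (\<Pi>\<^sub>M i\<in>I. (lborel :: 'b::euclidean_space measure)) = sets (\<Pi>\<^sub>M i\<in>I. borel)"
  by (rule sets_PiM_cong) auto

text \<open>In block coordinates the posteriors for all data have densities with respect to one
  fixed measure, jointly measurable in data and parameter.\<close>

lemma piG_post_measurable:
  fixes U :: "'m::{finite,wellorder} rmat"
  assumes U: "pos_def U" and n: "n \<ge> 1" and z: "zG E U \<alpha> < \<infinity>"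
  shows "(\<lambda>y. piG E (post_scale U n y) (post_shape \<alpha> n)) \<in>
    (\<Pi>\<^sub>M i\<in>{..<n}. borel) \<rightarrow>\<^sub>M prob_algebra (Theta_space E)"
proof -
  let ?B = "\<Pi>\<^sub>M i\<in>{..<n}. (borel :: 'm rvec measure)"
  let ?R = "PiM blocks (blk E)"
  let ?h = "\<lambda>y x. ennreal (pi_tilde (post_scale U n y) (post_shape \<alpha> n) (assemble E x))"
  have R: "sigma_finite_measure ?R"
    by (rule product_sigma_finite.sigma_finite[OF product_sigma_finite_blk]) simp
  have pU: "pos_def (post_scale U n y)" and pz: "zG E (post_scale U n y) (post_shape \<alpha> n) < \<infinity>" for y
    by (rule pos_def_post_scale[OF U n], rule zG_post_finite[OF U n z])
  have "(\<lambda>p. pi_tilde (post_scale U n (fst p)) (post_shape \<alpha> n) (assemble E (snd p))) \<in> borel_measurable (?B \<Otimes>\<^sub>M ?R)"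
    by (rule pi_tilde_measurable[OF measurable_compose[OF measurable_fst post_scale_measurable[OF n]]
          measurable_compose[OF measurable_snd assemble_measurable]])
  from measurable_compose[OF this measurable_ennreal]
  have h: "(\<lambda>(y, x). ?h y x) \<in> borel_measurable (?B \<Otimes>\<^sub>M ?R)"
    by (simp add: split_beta')
  have zm: "(\<lambda>y. zG E (post_scale U n y) (post_shape \<alpha> n)) \<in> borel_measurable ?B"
    unfolding zG_coords by (rule sigma_finite_measure.borel_measurable_nn_integral[OF R h])
  have d: "(\<lambda>y. density ?R (\<lambda>x. ?h y x / zG E (post_scale U n y) (post_shape \<alpha> n))) \<in> ?B \<rightarrow>\<^sub>M prob_algebra ?R"
  proof (rule measurable_density_prob_algebra[OF R])
    have "(\<lambda>p. ?h (fst p) (snd p) / zG E (post_scale U n (fst p)) (post_shape \<alpha> n)) \<in> borel_measurable (?B \<Otimes>\<^sub>M ?R)"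
      using h by (intro borel_measurable_divide_ennreal measurable_compose[OF measurable_fst zm]) (simp add: split_beta')
    then show "(\<lambda>(y, x). ?h y x / zG E (post_scale U n y) (post_shape \<alpha> n)) \<in> borel_measurable (?B \<Otimes>\<^sub>M ?R)"
      by (simp add: split_beta')
    show "(\<integral>\<^sup>+x. ?h y x / zG E (post_scale U n y) (post_shape \<alpha> n) \<partial>?R) = 1" if "y \<in> space ?B" for y
      using zG_pos[OF pU pz, of y] pz[of y] measurable_Pair2[OF h that]
      by (subst nn_integral_divide) (auto simp: zG_coords[symmetric])
  qed
  have "piG E (post_scale U n y) (post_shape \<alpha> n) =
      distr (density ?R (\<lambda>x. ?h y x / zG E (post_scale U n y) (post_shape \<alpha> n))) (Theta_space E) (assemble E)" for y
  proof -
    have "(\<lambda>\<theta>. ennreal (pi_tilde (post_scale U n y) (post_shape \<alpha> n) \<theta>) / zG E (post_scale U n y) (post_shape \<alpha> n))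
        \<in> borel_measurable (Theta_space E)" by measurable
    from density_distr[OF this assemble_measurable] show ?thesis by (simp add: piG_def dLdD_coords)
  qed
  then show ?thesis
    using measurable_compose[OF d measurable_distr_prob_space[OF assemble_measurable]] by simp
qed

text \<open>\<open>gaussian_sample\<close> prescribes the law on rectangles only. For fixed A both
  sides are measures in C that agree on boxes, by \<open>likelihood\<close> and Tonelli, and
  therefore on all C.\<close>

lemma joint_law:
  fixes U :: "'m::{finite,wellorder} rmat" and Y :: "nat \<Rightarrow> 'w \<Rightarrow> 'm rvec"
  assumes U: "pos_def U" and n: "n \<ge> 1" and z: "zG E U \<alpha> < \<infinity>"
    and gs: "gaussian_sample M E (piG E U \<alpha>) \<theta> n Y"
    and A: "A \<in> sets (Theta_space E)" and C: "C \<in> sets (\<Pi>\<^sub>M i\<in>{..<n}. borel)"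
  shows "emeasure M {\<omega>\<in>space M. \<theta> \<omega> \<in> A \<and> (\<lambda>i\<in>{..<n}. Y i \<omega>) \<in> C} =
    (\<integral>\<^sup>+y. ennreal ((1 / sqrt ((2 * pi) ^ CARD('m))) ^ n) / zG E U \<alpha> *
      (\<integral>\<^sup>+t. ennreal (pi_tilde (post_scale U n y) (post_shape \<alpha> n) t) * indicator A t \<partial>dLdD E) * indicator C y
      \<partial>(\<Pi>\<^sub>M i\<in>{..<n}. lborel))"
proof -
  let ?B = "\<Pi>\<^sub>M i\<in>{..<n}. (borel :: 'm rvec measure)" and ?LB = "\<Pi>\<^sub>M i\<in>{..<n}. (lborel :: 'm rvec measure)"
  let ?T = "\<lambda>\<omega>. \<lambda>i\<in>{..<n}. Y i \<omega>"
  let ?c = "ennreal ((1 / sqrt ((2 * pi) ^ CARD('m))) ^ n) / zG E U \<alpha>"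
  let ?h = "\<lambda>y t. ennreal (pi_tilde (post_scale U n y) (post_shape \<alpha> n) t)"
  let ?w = "\<lambda>y. ?c * (\<integral>\<^sup>+t. ?h y t * indicator A t \<partial>dLdD E)"
  interpret M: prob_space M using gs by (simp add: gaussian_sample_def)
  have \<theta> [measurable]: "\<theta> \<in> M \<rightarrow>\<^sub>M Theta_space E" and Y: "\<And>i. i < n \<Longrightarrow> Y i \<in> M \<rightarrow>\<^sub>M borel"
    and rect: "\<And>Bs. (\<And>i. i < n \<Longrightarrow> Bs i \<in> sets borel) \<Longrightarrow>
        emeasure M {\<omega> \<in> space M. \<theta> \<omega> \<in> A \<and> (\<forall>i<n. Y i \<omega> \<in> Bs i)} =
        (\<integral>\<^sup>+t\<in>A. (\<Prod>i<n. emeasure (mvn (cov t)) (Bs i)) \<partial>piG E U \<alpha>)"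
    using gs A by (auto simp: gaussian_sample_def)
  have T: "?T \<in> M \<rightarrow>\<^sub>M ?B" using Y by (intro measurable_restrict) auto
  have sLB: "sets ?LB = sets ?B" by (rule sets_PiM_lborel)
  have sfD: "sigma_finite_measure (dLdD E)" by (rule sigma_finite_dLdD[OF U z])
  have sfL: "sigma_finite_measure ?LB"
    by (rule product_sigma_finite.sigma_finite) (auto simp: product_sigma_finite_def lborel.sigma_finite_measure_axioms)
  interpret DL: pair_sigma_finite "dLdD E" ?LB
    using sfD sfL by (simp add: pair_sigma_finite_def)
  note [measurable] = A
  have A': "A \<in> sets (dLdD E)" using A by simp
  have "(\<lambda>p. pi_tilde (post_scale U n (snd p)) (post_shape \<alpha> n) (fst p)) \<in> borel_measurable (dLdD E \<Otimes>\<^sub>M ?LB)"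
  proof (rule pi_tilde_measurable)
    show "(\<lambda>p. post_scale U n (snd p) $ i $ j) \<in> borel_measurable (dLdD E \<Otimes>\<^sub>M ?LB)" for i j
      using post_scale_measurable[OF n, of U i j]
      by (intro measurable_compose[OF measurable_snd]) (simp add: measurable_cong_sets[OF sLB refl])
    have "fst \<in> dLdD E \<Otimes>\<^sub>M ?LB \<rightarrow>\<^sub>M dLdD E" by simp
    then show "fst \<in> dLdD E \<Otimes>\<^sub>M ?LB \<rightarrow>\<^sub>M Theta_space E"
      by (simp add: measurable_cong_sets[OF refl sets_dLdD])
  qed
  from measurable_compose[OF this measurable_ennreal]
  have h: "(\<lambda>p. ?h (snd p) (fst p)) \<in> borel_measurable (dLdD E \<Otimes>\<^sub>M ?LB)" .
  have iA: "(\<lambda>p. indicator A (fst p) :: ennreal) \<in> borel_measurable (dLdD E \<Otimes>\<^sub>M ?LB)"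
    by (intro measurable_compose[OF measurable_fst] borel_measurable_indicator A')
  have w: "?w \<in> borel_measurable ?LB"
  proof (intro borel_measurable_times_ennreal borel_measurable_const)
    have "(\<lambda>(y, t). ?h y t * indicator A t) \<in> borel_measurable (?LB \<Otimes>\<^sub>M dLdD E)"
      using measurable_compose[OF measurable_pair_swap' borel_measurable_times_ennreal[OF h iA]]
      by (simp add: split_beta')
    then show "(\<lambda>y. \<integral>\<^sup>+t. ?h y t * indicator A t \<partial>dLdD E) \<in> borel_measurable ?LB"
      by (rule sigma_finite_measure.borel_measurable_nn_integral[OF sfD])
  qed
  \<comment> \<open>The law of the sample restricted to the event that the parameter lies in A;
    \<open>P2\<close> is the claimed density.\<close>
  define P1 where "P1 = distr (density M (indicator (\<theta> -` A \<inter> space M))) ?B ?T"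
  define P2 where "P2 = density ?LB ?w"
  have \<theta>A: "\<theta> -` A \<inter> space M \<in> sets M" using \<theta> A by (rule measurable_sets)
  have P1: "emeasure P1 X = emeasure M {\<omega>\<in>space M. \<theta> \<omega> \<in> A \<and> ?T \<omega> \<in> X}" if X: "X \<in> sets ?B" for X
  proof -
    have TX: "?T -` X \<inter> space M \<in> sets M" using T X by (rule measurable_sets)
    have "emeasure P1 X = emeasure (density M (indicator (\<theta> -` A \<inter> space M))) (?T -` X \<inter> space M)"
      unfolding P1_def using T X by (subst emeasure_distr) auto
    also have "\<dots> = (\<integral>\<^sup>+\<omega>. indicator (\<theta> -` A \<inter> space M) \<omega> * indicator (?T -` X \<inter> space M) \<omega> \<partial>M)"
      using \<theta>A TX by (intro emeasure_density) auto
    also have "\<dots> = emeasure M ((\<theta> -` A \<inter> space M) \<inter> (?T -` X \<inter> space M))"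
      using \<theta>A TX by (simp add: indicator_inter_arith[symmetric])
    also have "(\<theta> -` A \<inter> space M) \<inter> (?T -` X \<inter> space M) = {\<omega>\<in>space M. \<theta> \<omega> \<in> A \<and> ?T \<omega> \<in> X}" by auto
    finally show ?thesis .
  qed
  have "P1 = P2"
  \<comment> \<open>\<open>P1\<close> is finite, so the constant sequence of whole spaces serves as
    the exhausting sequence.\<close>
  proof (rule measure_eqI_PiM_finite[where A="\<lambda>_. space ?LB" and I="{..<n}" and M="\<lambda>_. lborel"])
    show "sets P1 = sets ?LB" by (simp add: P1_def sLB)
    show "sets P2 = sets ?LB" by (simp add: P2_def)
    show "range (\<lambda>_::nat. space ?LB) \<subseteq> prod_algebra {..<n} (\<lambda>_. lborel)"
      using space_in_prod_algebra[of "{..<n}" "\<lambda>_. lborel"] by (auto simp: space_PiM)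
    show "emeasure P1 (space ?LB) \<noteq> \<infinity>"
      using sets.top[of ?LB] sLB by (simp add: P1 M.emeasure_eq_measure)
    fix Bs :: "nat \<Rightarrow> 'm rvec set" assume "\<And>i. i \<in> {..<n} \<Longrightarrow> Bs i \<in> sets lborel"
    then have Bs: "\<And>i. i < n \<Longrightarrow> Bs i \<in> sets borel" by simp
    have box: "Pi\<^sub>E {..<n} Bs \<in> sets ?B" using Bs by (intro sets_PiM_I_finite) auto
    have boxL: "Pi\<^sub>E {..<n} Bs \<in> sets ?LB" using box sLB by simp
    let ?i = "indicator (Pi\<^sub>E {..<n} Bs) :: _ \<Rightarrow> ennreal"
    have gauss1: "gauss_dens (cov t) \<in> borel_measurable lborel" for t :: "'m state"
      by (rule gauss_dens_measurable[OF borel_measurable_const borel_measurable_const vec_component_measurable])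
    have mv: "(\<Prod>i<n. emeasure (mvn (cov t)) (Bs i)) =
        (\<integral>\<^sup>+y. (\<Prod>i<n. ennreal (gauss_dens (cov t) (y i))) * ?i y \<partial>?LB)" for t :: "'m state"
    proof -
      have "(\<Prod>i<n. emeasure (mvn (cov t)) (Bs i)) =
          (\<Prod>i<n. \<integral>\<^sup>+y. ennreal (gauss_dens (cov t) y) * indicator (Bs i) y \<partial>lborel)"
        using Bs unfolding mvn_def gauss_dens_def[symmetric]
        by (intro prod.cong refl emeasure_density measurable_compose[OF gauss1 measurable_ennreal]) auto
      also have "\<dots> = (\<integral>\<^sup>+y. (\<Prod>i<n. ennreal (gauss_dens (cov t) (y i)) * indicator (Bs i) (y i)) \<partial>?LB)"
        using Bs
        by (intro product_sigma_finite.product_nn_integral_prod[symmetric] borel_measurable_times_ennreal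
            measurable_compose[OF gauss1 measurable_ennreal] borel_measurable_indicator)
          (auto simp: product_sigma_finite_def lborel.sigma_finite_measure_axioms)
      also have "\<dots> = (\<integral>\<^sup>+y. (\<Prod>i<n. ennreal (gauss_dens (cov t) (y i))) * ?i y \<partial>?LB)"
      proof (rule nn_integral_cong)
        fix y assume "y \<in> space ?LB"
        then have "?i y = (\<Prod>i<n. indicator (Bs i) (y i))"
          by (auto simp: indicator_def space_PiM PiE_iff)
        then show "(\<Prod>i<n. ennreal (gauss_dens (cov t) (y i)) * indicator (Bs i) (y i)) =
            (\<Prod>i<n. ennreal (gauss_dens (cov t) (y i))) * ?i y" by (simp add: prod.distrib)
      qed
      finally show ?thesis .
    qed
    \<comment> \<open>Prior density times likelihood at a fixed parameter, rewritten by conjugacy as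
      an integral over data of the unnormalised posterior density.\<close>
    have step: "ennreal (pi_tilde U \<alpha> t) / zG E U \<alpha> * ((\<Prod>i<n. emeasure (mvn (cov t)) (Bs i)) * indicator A t) =
        (\<integral>\<^sup>+y. ?c * (?h y t * indicator A t) * ?i y \<partial>?LB)" if t: "t \<in> ThetaG E" for t
    proof -
      have gm: "(\<lambda>y. (\<Prod>i<n. ennreal (gauss_dens (cov t) (y i))) * ?i y) \<in> borel_measurable ?LB"
      proof (intro borel_measurable_times_ennreal borel_measurable_prod_ennreal borel_measurable_indicator boxL
            measurable_compose[OF _ measurable_ennreal])
        fix i assume "i \<in> {..<n}"
        then have "(\<lambda>y. y i) \<in> ?LB \<rightarrow>\<^sub>M lborel" by (rule measurable_component_singleton)
        from measurable_compose[OF this gauss1]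
        show "(\<lambda>y. gauss_dens (cov t) (y i)) \<in> borel_measurable ?LB" .
      qed
      have "ennreal (pi_tilde U \<alpha> t) / zG E U \<alpha> * ((\<Prod>i<n. emeasure (mvn (cov t)) (Bs i)) * indicator A t) =
          (ennreal (pi_tilde U \<alpha> t) / zG E U \<alpha> * indicator A t) * (\<integral>\<^sup>+y. (\<Prod>i<n. ennreal (gauss_dens (cov t) (y i))) * ?i y \<partial>?LB)"
        by (simp add: mv mult_ac)
      also have "\<dots> = (\<integral>\<^sup>+y. (ennreal (pi_tilde U \<alpha> t) / zG E U \<alpha> * indicator A t) * ((\<Prod>i<n. ennreal (gauss_dens (cov t) (y i))) * ?i y) \<partial>?LB)"
        by (rule nn_integral_cmult[OF gm, symmetric])
      also have "\<dots> = (\<integral>\<^sup>+y. ?c * (?h y t * indicator A t) * ?i y \<partial>?LB)"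
      proof (rule nn_integral_cong)
        fix y
        have g0: "0 \<le> gauss_dens (cov t) x" for x
          using ThetaG_det_cov[OF t] by (simp add: gauss_dens_def)
        have "ennreal (pi_tilde U \<alpha> t) * (\<Prod>i<n. ennreal (gauss_dens (cov t) (y i))) =
            ennreal (pi_tilde U \<alpha> t * (\<Prod>i<n. gauss_dens (cov t) (y i)))"
          using g0 pi_tilde_pos[of U \<alpha> t] by (simp add: prod_ennreal ennreal_mult prod_nonneg less_imp_le)
        also have "\<dots> = ennreal ((1 / sqrt ((2 * pi) ^ CARD('m))) ^ n) * ?h y t"
          unfolding likelihood[OF n t] using pi_tilde_pos[of "post_scale U n y" "post_shape \<alpha> n" t]
          by (intro ennreal_mult) auto
        finally have "ennreal (pi_tilde U \<alpha> t) * (\<Prod>i<n. ennreal (gauss_dens (cov t) (y i))) =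
            ennreal ((1 / sqrt ((2 * pi) ^ CARD('m))) ^ n) * ?h y t" .
        then have "(ennreal (pi_tilde U \<alpha> t) * (\<Prod>i<n. ennreal (gauss_dens (cov t) (y i)))) * (inverse (zG E U \<alpha>) * indicator A t * ?i y) =
            (ennreal ((1 / sqrt ((2 * pi) ^ CARD('m))) ^ n) * ?h y t) * (inverse (zG E U \<alpha>) * indicator A t * ?i y)" by simp
        then show "(ennreal (pi_tilde U \<alpha> t) / zG E U \<alpha> * indicator A t) * ((\<Prod>i<n. ennreal (gauss_dens (cov t) (y i))) * ?i y) =
            ?c * (?h y t * indicator A t) * ?i y"
          unfolding divide_ennreal_def by (simp only: mult_ac)
      qed
      finally show ?thesis .
    qed
    have Tbox: "{\<omega>\<in>space M. \<theta> \<omega> \<in> A \<and> ?T \<omega> \<in> Pi\<^sub>E {..<n} Bs} = {\<omega> \<in> space M. \<theta> \<omega> \<in> A \<and> (\<forall>i<n. Y i \<omega> \<in> Bs i)}"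
      by (auto simp: PiE_iff)
    have pm: "(\<lambda>t. \<Prod>i<n. emeasure (mvn (cov t)) (Bs i)) \<in> borel_measurable (dLdD E)"
    proof (rule borel_measurable_prod_ennreal)
      fix i assume "i \<in> {..<n}"
      then have Bi: "Bs i \<in> sets lborel" using Bs by simp
      have "(\<lambda>p. gauss_dens (cov (fst p)) (snd p)) \<in> borel_measurable (Theta_space E \<Otimes>\<^sub>M (lborel :: 'm rvec measure))"
        by (intro gauss_dens_measurable measurable_compose[OF measurable_fst cov_inv_measurable]
            measurable_compose[OF measurable_fst det_cov_measurable]
            measurable_compose[OF measurable_snd vec_component_measurable])
      then have "(\<lambda>p. ennreal (gauss_dens (cov (fst p)) (snd p)) * indicator (Bs i) (snd p)) \<in>
          borel_measurable (Theta_space E \<Otimes>\<^sub>M (lborel :: 'm rvec measure))"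
        using Bi
        by (intro borel_measurable_times_ennreal measurable_compose[OF _ measurable_ennreal]
            measurable_compose[OF measurable_snd] borel_measurable_indicator)
      then have "(\<lambda>t. \<integral>\<^sup>+y. ennreal (gauss_dens (cov t) y) * indicator (Bs i) y \<partial>lborel) \<in> borel_measurable (Theta_space E)"
        by (intro lborel.borel_measurable_nn_integral) (simp only: split_beta')
      also have "(\<lambda>t. \<integral>\<^sup>+y. ennreal (gauss_dens (cov t) y) * indicator (Bs i) y \<partial>lborel) = (\<lambda>t. emeasure (mvn (cov t)) (Bs i))"
        using Bi unfolding mvn_def gauss_dens_def[symmetric]
        by (intro ext emeasure_density[symmetric] measurable_compose[OF gauss1 measurable_ennreal])
      finally show "(\<lambda>t. emeasure (mvn (cov t)) (Bs i)) \<in> borel_measurable (dLdD E)"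
        by (simp add: measurable_cong_sets[OF sets_dLdD refl])
    qed
    have "emeasure P1 (Pi\<^sub>E {..<n} Bs) = (\<integral>\<^sup>+t\<in>A. (\<Prod>i<n. emeasure (mvn (cov t)) (Bs i)) \<partial>piG E U \<alpha>)"
      unfolding P1[OF box] Tbox by (rule rect[OF Bs])
    also have "\<dots> = (\<integral>\<^sup>+t. ennreal (pi_tilde U \<alpha> t) / zG E U \<alpha> * ((\<Prod>i<n. emeasure (mvn (cov t)) (Bs i)) * indicator A t) \<partial>dLdD E)"
      unfolding piG_def using pm by (intro nn_integral_density) auto
    also have "\<dots> = (\<integral>\<^sup>+t. \<integral>\<^sup>+y. ?c * (?h y t * indicator A t) * ?i y \<partial>?LB \<partial>dLdD E)"
      by (intro nn_integral_cong step) simp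
    also have "\<dots> = (\<integral>\<^sup>+y. \<integral>\<^sup>+t. ?c * (?h y t * indicator A t) * ?i y \<partial>dLdD E \<partial>?LB)"
    proof (rule DL.Fubini'[symmetric])
      have "(\<lambda>p. ?i (snd p)) \<in> borel_measurable (dLdD E \<Otimes>\<^sub>M ?LB)"
        by (intro measurable_compose[OF measurable_snd] borel_measurable_indicator boxL)
      then have "(\<lambda>p. ?c * (?h (snd p) (fst p) * indicator A (fst p)) * ?i (snd p)) \<in> borel_measurable (dLdD E \<Otimes>\<^sub>M ?LB)"
        using h iA by (intro borel_measurable_times_ennreal borel_measurable_const)
      then show "(\<lambda>(t, y). ?c * (?h y t * indicator A t) * ?i y) \<in> borel_measurable (dLdD E \<Otimes>\<^sub>M ?LB)"
        by (simp only: split_beta')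
    qed
    also have "\<dots> = (\<integral>\<^sup>+y. ?w y * ?i y \<partial>?LB)"
    proof (rule nn_integral_cong)
      fix y
      have m: "(\<lambda>t. ?h y t * indicator A t) \<in> borel_measurable (dLdD E)"
        using measurable_compose[OF pi_tilde_measurable1[of "post_scale U n y" "post_shape \<alpha> n" E] measurable_ennreal]
        by (intro borel_measurable_times_ennreal borel_measurable_indicator A')
          (simp add: measurable_cong_sets[OF sets_dLdD refl])
      show "(\<integral>\<^sup>+t. ?c * (?h y t * indicator A t) * ?i y \<partial>dLdD E) = ?w y * ?i y"
        using nn_integral_multc[OF borel_measurable_times_ennreal[OF borel_measurable_const m], of ?c "?i y"]
        by (simp only: nn_integral_cmult[OF m])
    qed
    also have "\<dots> = emeasure P2 (Pi\<^sub>E {..<n} Bs)"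
      unfolding P2_def using w boxL by (intro emeasure_density[symmetric])
    finally show "emeasure P1 (Pi\<^sub>E {..<n} Bs) = emeasure P2 (Pi\<^sub>E {..<n} Bs)" .
  qed (auto)
  then show ?thesis
    using P1[OF C] emeasure_density[OF w, of C] C sLB by (simp add: P2_def)
qed

text \<open>\<open>joint_law\<close> with the full parameter space gives the marginal law of the
  data; comparing it with a general A is Bayes' formula. Integrated over events determined by the
  sample, this formula characterises the conditional expectation.\<close>

lemma posterior:
  fixes U :: "'m::{finite,wellorder} rmat" and Y :: "nat \<Rightarrow> 'w \<Rightarrow> 'm rvec"
  assumes U: "pos_def U" and n: "n \<ge> 1" and z: "zG E U \<alpha> < \<infinity>"
    and gs: "gaussian_sample M E (piG E U \<alpha>) \<theta> n Y"
  shows "posterior_distribution M (Theta_space E) \<theta> n Y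
    (\<lambda>\<omega>. piG E (post_scale U n (\<lambda>i. Y i \<omega>)) (post_shape \<alpha> n))"
proof -
  let ?B = "\<Pi>\<^sub>M i\<in>{..<n}. (borel :: 'm rvec measure)" and ?LB = "\<Pi>\<^sub>M i\<in>{..<n}. (lborel :: 'm rvec measure)"
  define T where "T = (\<lambda>\<omega>. \<lambda>i\<in>{..<n}. Y i \<omega>)"
  define q where "q = (\<lambda>y. piG E (post_scale U n y) (post_shape \<alpha> n))"
  let ?Z = "\<lambda>y. zG E (post_scale U n y) (post_shape \<alpha> n)"
  let ?I = "\<lambda>A y. \<integral>\<^sup>+t. ennreal (pi_tilde (post_scale U n y) (post_shape \<alpha> n) t) * indicator A t \<partial>dLdD E"
  let ?c = "ennreal ((1 / sqrt ((2 * pi) ^ CARD('m))) ^ n) / zG E U \<alpha>"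
  interpret M: prob_space M using gs by (simp add: gaussian_sample_def)
  have \<theta>: "\<theta> \<in> M \<rightarrow>\<^sub>M Theta_space E" and Y: "\<And>i. i < n \<Longrightarrow> Y i \<in> M \<rightarrow>\<^sub>M borel"
    using gs by (auto simp: gaussian_sample_def)
  have T: "T \<in> M \<rightarrow>\<^sub>M ?B" unfolding T_def using Y by (intro measurable_restrict) auto
  have q: "q \<in> ?B \<rightarrow>\<^sub>M prob_algebra (Theta_space E)"
    unfolding q_def by (rule piG_post_measurable[OF U n z])
  have Q: "piG E (post_scale U n (\<lambda>i. Y i \<omega>)) (post_shape \<alpha> n) = q (T \<omega>)" for \<omega>
  proof -
    \<comment> \<open>Only the first n observations enter, so the posterior factors through T and is
      measurable for the sigma-algebra generated by the sample.\<close>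
    have "post_scale U n (\<lambda>i. Y i \<omega>) = post_scale U n (T \<omega>)"
      by (simp add: vec_eq_iff post_scale_entry[OF n] T_def)
    then show ?thesis by (simp add: q_def)
  qed
  have sLB: "sets ?LB = sets ?B" by (rule sets_PiM_lborel)
  have qI: "?I A y = ?Z y * emeasure (q y) A" if "A \<in> sets (Theta_space E)" for A y
    unfolding q_def
    by (rule emeasure_piG_times[OF pos_def_post_scale[OF U n] zG_post_finite[OF U n z] that, symmetric])
  have qA: "(\<lambda>y. emeasure (q y) A) \<in> borel_measurable ?B" if "A \<in> sets (Theta_space E)" for A
    using measurable_compose[OF measurable_prob_algebraD[OF q] measurable_emeasure_subprob_algebra[OF that]] .
  have ZI: "?Z y = ?I (ThetaG E) y" for y
    unfolding zG_def by (intro nn_integral_cong) (simp add: dLdD_def)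
  have top: "ThetaG E \<in> sets (Theta_space E)" using sets.top[of "Theta_space E"] by simp
  have Zm: "?Z \<in> borel_measurable ?B"
  proof -
    have R: "sigma_finite_measure (PiM blocks (blk E))"
      by (rule product_sigma_finite.sigma_finite[OF product_sigma_finite_blk]) simp
    have "(\<lambda>p. pi_tilde (post_scale U n (fst p)) (post_shape \<alpha> n) (assemble E (snd p))) \<in> borel_measurable (?B \<Otimes>\<^sub>M PiM blocks (blk E))"
      by (rule pi_tilde_measurable[OF measurable_compose[OF measurable_fst post_scale_measurable[OF n]]
            measurable_compose[OF measurable_snd assemble_measurable]])
    from measurable_compose[OF this measurable_ennreal] show ?thesis
      unfolding zG_coords
      by (intro sigma_finite_measure.borel_measurable_nn_integral[OF R]) (simp add: split_beta')
  qed
  \<comment> \<open>The marginal density of the data is the posterior normalising constant up to a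
    constant factor.\<close>
  have law: "distr M ?B T = density ?LB (\<lambda>y. ?c * ?Z y)"
  proof (rule measure_eqI)
    show "sets (distr M ?B T) = sets (density ?LB (\<lambda>y. ?c * ?Z y))" by (simp add: sLB)
    fix C assume "C \<in> sets (distr M ?B T)"
    then have C: "C \<in> sets ?B" by simp
    have "emeasure (distr M ?B T) C = emeasure M {\<omega>\<in>space M. \<theta> \<omega> \<in> ThetaG E \<and> T \<omega> \<in> C}"
      using measurable_space[OF \<theta>]
      by (subst emeasure_distr[OF T C]) (auto intro!: arg_cong[where f="emeasure M"])
    also have "\<dots> = (\<integral>\<^sup>+y. ?c * ?Z y * indicator C y \<partial>?LB)"
      unfolding T_def ZI by (rule joint_law[OF U n z gs top C])
    also have "\<dots> = emeasure (density ?LB (\<lambda>y. ?c * ?Z y)) C"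
      using Zm C sLB
      by (intro emeasure_density[symmetric] borel_measurable_times_ennreal borel_measurable_const)
        (simp_all add: measurable_cong_sets[OF sLB refl])
    finally show "emeasure (distr M ?B T) C = emeasure (density ?LB (\<lambda>y. ?c * ?Z y)) C" .
  qed
  have bayes: "emeasure M {\<omega>\<in>space M. \<theta> \<omega> \<in> A \<and> T \<omega> \<in> C} =
      (\<integral>\<^sup>+\<omega>. emeasure (q (T \<omega>)) A * indicator C (T \<omega>) \<partial>M)"
    if A: "A \<in> sets (Theta_space E)" and C: "C \<in> sets ?B" for A C
  proof -
    have g: "(\<lambda>y. emeasure (q y) A * indicator C y) \<in> borel_measurable ?B"
      by (intro borel_measurable_times_ennreal qA[OF A] borel_measurable_indicator C)
    have "emeasure M {\<omega>\<in>space M. \<theta> \<omega> \<in> A \<and> T \<omega> \<in> C} = (\<integral>\<^sup>+y. ?c * ?I A y * indicator C y \<partial>?LB)"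
      unfolding T_def by (rule joint_law[OF U n z gs A C])
    also have "\<dots> = (\<integral>\<^sup>+y. (?c * ?Z y) * (emeasure (q y) A * indicator C y) \<partial>?LB)"
      by (simp only: qI[OF A] mult.assoc)
    also have "\<dots> = (\<integral>\<^sup>+y. emeasure (q y) A * indicator C y \<partial>density ?LB (\<lambda>y. ?c * ?Z y))"
      using Zm g
      by (intro nn_integral_density[symmetric] borel_measurable_times_ennreal[OF borel_measurable_const])
        (simp_all only: measurable_cong_sets[OF sLB refl])
    also have "\<dots> = (\<integral>\<^sup>+\<omega>. emeasure (q (T \<omega>)) A * indicator C (T \<omega>) \<partial>M)"
      unfolding law[symmetric] using g by (intro nn_integral_distr[OF T]) simp
    finally show ?thesis .
  qed
  define F where "F = vimage_algebra (space M) T ?B"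
  have spF: "space F = space M" by (simp add: F_def)
  have Tsp: "T \<in> space M \<rightarrow> space ?B" using measurable_space[OF T] by blast
  have TF: "T \<in> F \<rightarrow>\<^sub>M ?B" unfolding F_def by (rule measurable_vimage_algebra1[OF Tsp])
  \<comment> \<open>The events of the sample sigma-algebra are exactly the preimages under T, so
    \<open>bayes\<close> covers all of them.\<close>
  have setsF: "sets F = {T -` C \<inter> space M | C. C \<in> sets ?B}"
    unfolding F_def by (rule sets_vimage_algebra2[OF Tsp])
  have sub: "subalgebra M F"
    unfolding subalgebra_def using spF measurable_sets[OF T] by (auto simp: setsF)
  interpret finite_measure_subalgebra M F
    by (intro finite_measure_subalgebra.intro finite_measure_subalgebra_axioms.intro sub M.finite_measure_axioms)
  have QF: "(\<lambda>\<omega>. q (T \<omega>)) \<in> F \<rightarrow>\<^sub>M prob_algebra (Theta_space E)"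
    by (rule measurable_compose[OF TF q])
  have cond: "AE \<omega> in M. real_cond_exp M F (indicator (\<theta> -` A \<inter> space M)) \<omega> = measure (q (T \<omega>)) A"
    if A: "A \<in> sets (Theta_space E)" for A
  proof (rule real_cond_exp_charact)
    have \<theta>A: "\<theta> -` A \<inter> space M \<in> sets M" using \<theta> A by (rule measurable_sets)
    have p: "prob_space (q (T \<omega>))" if "\<omega> \<in> space M" for \<omega>
      using measurable_space[OF q measurable_space[OF T that]] by (simp add: space_prob_algebra)
    show mF: "(\<lambda>\<omega>. measure (q (T \<omega>)) A) \<in> borel_measurable F"
      by (rule measurable_compose[OF QF measurable_measure_prob_algebra[OF A]])
    have mM: "(\<lambda>\<omega>. measure (q (T \<omega>)) A) \<in> borel_measurable M"
      by (rule measurable_from_subalg[OF sub mF])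
    show i1: "integrable M (indicator (\<theta> -` A \<inter> space M) :: _ \<Rightarrow> real)"
      using \<theta>A by (intro M.integrable_const_bound[where B=1]) auto
    show i2: "integrable M (\<lambda>\<omega>. measure (q (T \<omega>)) A)"
      using mM p by (intro M.integrable_const_bound[where B=1] AE_I2) (auto intro: prob_space.prob_le_1)
    fix X assume "X \<in> sets F"
    then obtain C where C: "C \<in> sets ?B" and X: "X = T -` C \<inter> space M" unfolding setsF by auto
    have XM: "X \<in> sets M" unfolding X using T C by (rule measurable_sets)
    have "ennreal (\<integral>\<omega>\<in>X. indicator (\<theta> -` A \<inter> space M) \<omega> \<partial>M) = emeasure M (X \<inter> (\<theta> -` A \<inter> space M))"
    proof -
      have "(\<integral>\<omega>\<in>X. indicator (\<theta> -` A \<inter> space M) \<omega> \<partial>M) = (\<integral>\<omega>. indicator (X \<inter> (\<theta> -` A \<inter> space M)) \<omega> \<partial>M)"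
        unfolding set_lebesgue_integral_def
        by (intro Bochner_Integration.integral_cong) (auto simp: indicator_def)
      also have "\<dots> = measure M (X \<inter> (\<theta> -` A \<inter> space M))"
        using XM \<theta>A by simp
      finally show ?thesis by (simp add: M.emeasure_eq_measure)
    qed
    also have "X \<inter> (\<theta> -` A \<inter> space M) = {\<omega>\<in>space M. \<theta> \<omega> \<in> A \<and> T \<omega> \<in> C}"
      by (auto simp: X)
    also have "emeasure M \<dots> = (\<integral>\<^sup>+\<omega>. emeasure (q (T \<omega>)) A * indicator C (T \<omega>) \<partial>M)"
      by (rule bayes[OF A C])
    also have "\<dots> = (\<integral>\<^sup>+\<omega>. ennreal (indicator X \<omega> * measure (q (T \<omega>)) A) \<partial>M)"
    proof (rule nn_integral_cong)
      fix \<omega> assume \<omega>: "\<omega> \<in> space M"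
      interpret q: prob_space "q (T \<omega>)" by (rule p[OF \<omega>])
      show "emeasure (q (T \<omega>)) A * indicator C (T \<omega>) = ennreal (indicator X \<omega> * measure (q (T \<omega>)) A)"
        using \<omega> by (auto simp: X q.emeasure_eq_measure indicator_def)
    qed
    also have "\<dots> = ennreal (\<integral>\<omega>\<in>X. measure (q (T \<omega>)) A \<partial>M)"
      unfolding set_lebesgue_integral_def real_scaleR_def
      using integrable_mult_indicator[OF XM i2]
      by (intro nn_integral_eq_integral) auto
    finally show "(\<integral>\<omega>\<in>X. indicator (\<theta> -` A \<inter> space M) \<omega> \<partial>M) = (\<integral>\<omega>\<in>X. measure (q (T \<omega>)) A \<partial>M)"
      by (rule ennreal_inj[THEN iffD1, rotated 2])
        (auto simp: set_lebesgue_integral_def intro!: Bochner_Integration.integral_nonneg)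
  qed
  have "AE \<omega> in M. measure (q (T \<omega>)) A = real_cond_exp M F (indicator (\<theta> -` A \<inter> space M)) \<omega>"
    if A: "A \<in> sets (Theta_space E)" for A
    using cond[OF A] by eventually_elim simp
  then show ?thesis
    unfolding posterior_distribution_def Let_def Q T_def[symmetric] F_def[symmetric]
    using QF by simp
qed

theorem mainTheorem3:
  fixes E :: "'m::{finite,wellorder} rel"
    and U :: "'m rmat" and \<alpha> :: "'m rvec"
    and M :: "'w measure" and \<theta> :: "'w \<Rightarrow> 'm state"
    and n :: nat and Y :: "nat \<Rightarrow> 'w \<Rightarrow> 'm rvec"
  assumes "sym E" "irrefl E" "decomposable E" "S_D E"
    and "pos_def U" "\<forall>i. \<alpha> $ i \<ge> 0" "zG E U \<alpha> < \<infinity>"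
    and "n \<ge> 1" "gaussian_sample M E (piG E U \<alpha>) \<theta> n Y"
  shows "posterior_distribution M (Theta_space E) \<theta> n Y
           (\<lambda>\<omega>. piG E (post_scale U n (\<lambda>i. Y i \<omega>)) (post_shape \<alpha> n))
       \<and> (\<forall>\<omega>\<in>space M.
           markov_chain_converges (Theta_space E)
             (gibbs_kernel E (post_scale U n (\<lambda>i. Y i \<omega>)) (post_shape \<alpha> n))
             (piG E (post_scale U n (\<lambda>i. Y i \<omega>)) (post_shape \<alpha> n)))"
  \<comment> \<open>The posterior scale is positive definite and its constant finite for every value
    of the data, so convergence holds at each sample point and not just almost surely.\<close>
  using assms by (blast intro: posterior gibbs_converges pos_def_post_scale zG_post_finite)

end
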